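(* For every positive integer $k$, the space $(\widetilde{\mathcal{W}}_0^{(k)}, \delta_{\square})$ of graphon systems of order $k$ is a compact metric space.
   Context: A graphon is a symmetric measurable function $W:[0,1]^2\to[0,1]$. A graphon system of order $k$ is a tuple $\mathbf{W}=(W_I)_{I\subseteq[k]}$ of graphons with $W_\emptyset\equiv 1$. For a tuple $\mathbf{W}=(W_I)_I$ of bounded symmetric measurable functions, $\|\mathbf{W}\|_\square=\sup_{S,T\subseteq[0,1]}\sum_I\left|\int_{S\times T}W_I\right|$ (sup over measurable $S,T$). For graphon systems $\mathbf{W},\mathbf{U}$ of order $k$, $\delta_\square(\mathbf{W},\mathbf{U})=\inf_\varphi\|\mathbf{W}-\mathbf{U}^\varphi\|_\square$, where the infimum is over measure-preserving invertible maps $\varphi:[0,1]\to[0,1]$ and $\mathbf{U}^\varphi=(U_I(\varphi(x),\varphi(y)))_I$ (the same $\varphi$ for all $I$). $\widetilde{\mathcal{W}}_0^{(k)}$ is the quotient of the set of graphon systems of order $k$ obtained by identifying $\mathbf{W}$ and $\mathbf{U}$ whenever $\delta_\square(\mathbf{W},\mathbf{U})=0$. *)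

theory Defs
  imports "HOL-Analysis.Analysis"
begin

abbreviation unit_interval :: "real set" where
  "unit_interval \<equiv> {0..1}"

abbreviation unit_square :: "(real \<times> real) set" where
  "unit_square \<equiv> unit_interval \<times> unit_interval"

(* Measurability is with respect to Lebesgue measurable sets throughout. The values of a
   graphon outside the unit square are unconstrained and are never used. *)
definition graphons :: "(real \<times> real \<Rightarrow> real) set" where
  "graphons = {W. W \<in> borel_measurable (lebesgue_on unit_square)
     \<and> (\<forall>x\<in>unit_interval. \<forall>y\<in>unit_interval. W (x, y) = W (y, x))
     \<and> (\<forall>z\<in>unit_square. 0 \<le> W z \<and> W z \<le> 1)}"

(* Tuples are indexed by all sets of natural numbers; only the components at subsets of
   {1..k} matter for a system of order k. *)
type_synonym kernel_tuple = "nat set \<Rightarrow> real \<times> real \<Rightarrow> real"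

definition graphon_systems :: "nat \<Rightarrow> kernel_tuple set" where
  "graphon_systems k =
     {W. (\<forall>I\<in>Pow {1..k}. W I \<in> graphons) \<and> (\<forall>z\<in>unit_square. W {} z = 1)}"

(* The supremum is finite for tuples of bounded measurable kernels. *)
definition cut_norm :: "nat \<Rightarrow> kernel_tuple \<Rightarrow> real" where
  "cut_norm k W =
     (SUP (S, T) \<in> {S \<in> sets lebesgue. S \<subseteq> unit_interval} \<times> {T \<in> sets lebesgue. T \<subseteq> unit_interval}.
        \<Sum>I\<in>Pow {1..k}. \<bar>LINT z:S \<times> T|lebesgue. W I z\<bar>)"

definition invertible_measure_preserving :: "(real \<Rightarrow> real) set" where
  "invertible_measure_preserving =
     {\<phi>. bij_betw \<phi> unit_interval unit_interval
       \<and> \<phi> \<in> measurable (lebesgue_on unit_interval) (lebesgue_on unit_interval)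
       \<and> inv_into unit_interval \<phi> \<in> measurable (lebesgue_on unit_interval) (lebesgue_on unit_interval)
       \<and> distr (lebesgue_on unit_interval) (lebesgue_on unit_interval) \<phi> = lebesgue_on unit_interval}"

definition relabel :: "kernel_tuple \<Rightarrow> (real \<Rightarrow> real) \<Rightarrow> kernel_tuple" where
  "relabel U \<phi> = (\<lambda>I (x, y). U I (\<phi> x, \<phi> y))"

definition cut_distance :: "nat \<Rightarrow> kernel_tuple \<Rightarrow> kernel_tuple \<Rightarrow> real" where
  "cut_distance k W U =
     (INF \<phi> \<in> invertible_measure_preserving. cut_norm k (\<lambda>I z. W I z - relabel U \<phi> I z))"

definition cut_equiv :: "nat \<Rightarrow> (kernel_tuple \<times> kernel_tuple) set" where
  "cut_equiv k = {(W, U). W \<in> graphon_systems k \<and> U \<in> graphon_systems k \<and> cut_distance k W U = 0}"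

definition graphon_system_space :: "nat \<Rightarrow> kernel_tuple set set" where
  "graphon_system_space k = graphon_systems k // cut_equiv k"

(* The distance of two classes is the common value of the cut distance on representatives.
   Outside the quotient it is set to 0 because the locale Metric_space demands
   nonnegativity and symmetry of the distance on the whole type. *)
definition class_cut_distance :: "nat \<Rightarrow> kernel_tuple set \<Rightarrow> kernel_tuple set \<Rightarrow> real" where
  "class_cut_distance k A B =
     (if A \<in> graphon_system_space k \<and> B \<in> graphon_system_space k
      then the_elem ((\<lambda>(W, U). cut_distance k W U) ` (A \<times> B)) else 0)"

end

theory Submission
  imports Defs
begin

text \<open>
  The space is totally bounded and complete.

  Total boundedness: by a greedy energy decrement every component of a system is, up to \<open>e\<close> in cut
  norm, a sum of a bounded number of terms \<open>\<plusminus>e \<cdot> 1\<^bsub>S \<times> T\<^esub>\<close> in which \<open>S\<close> and \<open>T\<close> are unions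
  of dyadic intervals. The sets involved split the interval into boundedly many atoms. If two systems have
  the same signs and nearly the same atom measures, a permutation of dyadic intervals carries almost all of each
  atom of one system to the corresponding atom of the other, so the systems are close. Rounding the atom
  measures leaves finitely many cases.

  Completeness: along a sequence with summable distances, composing near-optimal relabellings gives
  systems \<open>V\<^sub>n\<close> that are Cauchy in the cut norm, so the integrals of their components over rectangles
  converge uniformly. A weak limit exists by the Radon--Nikodym theorem, and uniformity
  makes it a limit in the cut norm.
\<close>

section \<open>Lebesgue measure on the unit square\<close>

text \<open>One relabelling must serve all components at once, so the atoms are those of the
  partition generated by the rectangle sides of all components together. The relabelling must also
  be an invertible map of the interval itself; dyadic sides make it an explicit permutation of equal
  cells, and no isomorphism between abstract atoms has to be constructed. The dyadic level is not
  bounded over the systems, which does no harm: two systems can be refined to a common level, and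
  only signs and atom measures enter the finite case count. Coefficients of fixed size e, instead of
  averages over the parts, leave three possible values per term. As the squared norm of a component
  is at most 1 and each term lowers it by e^2, any number of terms above 1/e^2 suffices.
  Measurability on the square means Lebesgue measurability, and the Lebesgue sigma-algebra is larger
  than the product of the two interval ones. Product measures, Dynkin's lemma and Radon-Nikodym are
  therefore applied to the product sigma-algebra, which rectangles generate, and the results are
  carried over by completion. Testing limits on rectangles is enough because the cut norm sees
  nothing else.\<close>

lemma null_sets_lebesgue_Times:
  fixes N :: "'a::euclidean_space set" and N' :: "'b::euclidean_space set"
  assumes "N \<in> null_sets lborel" "N' \<in> null_sets lborel"
  shows "N \<times> UNIV \<union> UNIV \<times> N' \<in> null_sets (lborel :: ('a \<times> 'b) measure)"
proof -
  have "N \<times> (UNIV :: 'b set) \<in> sets (lborel \<Otimes>\<^sub>M lborel)" "(UNIV :: 'a set) \<times> N' \<in> sets (lborel \<Otimes>\<^sub>M lborel)"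
    using assms by auto
  moreover have "emeasure (lborel \<Otimes>\<^sub>M lborel) (N \<times> (UNIV :: 'b set)) = 0"
      "emeasure (lborel \<Otimes>\<^sub>M lborel) ((UNIV :: 'a set) \<times> N') = 0"
    using assms by (subst lborel.emeasure_pair_measure_Times; auto)+
  ultimately show ?thesis
    unfolding lborel_prod by (intro null_sets.Un) (auto simp only: null_sets_def)
qed

text \<open>\<open>S\<close> and \<open>T\<close> are Borel up to null sets. The product differs
  from the Borel product only inside the null cross of the preceding lemma, so the product formula
  for \<open>lborel\<close> carries over.\<close>

lemma lebesgue_Times:
  fixes S :: "'a::euclidean_space set" and T :: "'b::euclidean_space set"
  assumes "S \<in> sets lebesgue" "T \<in> sets lebesgue"
  shows sets_lebesgue_Times: "S \<times> T \<in> sets lebesgue"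
    and emeasure_lebesgue_Times: "emeasure lebesgue (S \<times> T) = emeasure lebesgue S * emeasure lebesgue T"
proof -
  obtain S0 N N1 where S: "S = S0 \<union> N" "N \<subseteq> N1" "N1 \<in> null_sets lborel" "S0 \<in> sets lborel"
    using sets_completionE[OF assms(1)] by metis
  obtain T0 N' N2 where T: "T = T0 \<union> N'" "N' \<subseteq> N2" "N2 \<in> null_sets lborel" "T0 \<in> sets lborel"
    using sets_completionE[OF assms(2)] by metis
  define R where "R = S \<times> T - S0 \<times> T0"
  have R: "R \<in> null_sets (lebesgue :: ('a \<times> 'b) measure)"
    unfolding null_sets_completion_iff2
    by (rule bexI[OF _ null_sets_lebesgue_Times[OF S(3) T(3)]]) (use S T in \<open>auto simp: R_def\<close>)
  have eq: "S \<times> T = S0 \<times> T0 \<union> R"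
    using S T by (auto simp: R_def)
  have mB: "S0 \<times> T0 \<in> sets (lborel \<Otimes>\<^sub>M lborel)"
    using S T by auto
  then have m0: "S0 \<times> T0 \<in> sets lborel"
    unfolding lborel_prod .
  then show "S \<times> T \<in> sets lebesgue"
    unfolding eq using R by (intro sets.Un) (auto intro: sets_completionI_sets)
  have 1: "emeasure lebesgue S = emeasure lborel S0"
  proof -
    have "emeasure lebesgue (S0 \<union> N) = emeasure lebesgue S0"
      by (rule emeasure_Un_null_set) (use S null_sets_completion_iff2 in auto)
    then show ?thesis using S by simp
  qed
  have 2: "emeasure lebesgue T = emeasure lborel T0"
  proof -
    have "emeasure lebesgue (T0 \<union> N') = emeasure lebesgue T0"
      by (rule emeasure_Un_null_set) (use T null_sets_completion_iff2 in auto)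
    then show ?thesis using T by simp
  qed
  have "emeasure lebesgue (S \<times> T) = emeasure lebesgue (S0 \<times> T0)"
    unfolding eq by (rule emeasure_Un_null_set) (use m0 R in auto)
  also have "\<dots> = emeasure (lborel \<Otimes>\<^sub>M lborel) (S0 \<times> T0)"
    using m0 by (simp add: lborel_prod)
  also have "\<dots> = emeasure lborel S0 * emeasure lborel T0"
    using S T by (intro lborel.emeasure_pair_measure_Times) auto
  finally show "emeasure lebesgue (S \<times> T) = emeasure lebesgue S * emeasure lebesgue T"
    by (simp add: 1 2)
qed

lemma lebesgue_unit_square [simp]: "unit_square \<in> sets lebesgue"
  by (intro sets_lebesgue_Times) auto

lemma sets_lebesgue_on_iff:
  "S \<in> sets lebesgue \<Longrightarrow> A \<in> sets (lebesgue_on S) \<longleftrightarrow> A \<in> sets lebesgue \<and> A \<subseteq> S"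
  by (subst sets_restrict_space_iff) auto

lemma emeasure_lebesgue_unit_square: "emeasure lebesgue unit_square = 1"
  by (subst emeasure_lebesgue_Times) auto

abbreviation interval_measure01 :: "real measure" where
  "interval_measure01 \<equiv> lebesgue_on unit_interval"

abbreviation square_measure01 :: "(real \<times> real) measure" where
  "square_measure01 \<equiv> lebesgue_on unit_square"

interpretation int01: finite_measure interval_measure01
  by standard (simp add: emeasure_restrict_space)

interpretation sq01: finite_measure square_measure01
  by standard (simp add: emeasure_restrict_space emeasure_lebesgue_unit_square)

text \<open>The product sigma-algebra of the two completed measures is smaller than the Lebesgue
  one. The comparison is therefore phrased through the identity map, not as an equality of
  measures.\<close>

lemma square_measure01_pair_measure:
  shows measurable_square_pair: "(\<lambda>z. z) \<in> square_measure01 \<rightarrow>\<^sub>M (interval_measure01 \<Otimes>\<^sub>M interval_measure01)"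
    and pair_measure_distr_square: "interval_measure01 \<Otimes>\<^sub>M interval_measure01 = distr square_measure01 (interval_measure01 \<Otimes>\<^sub>M interval_measure01) (\<lambda>z. z)"
proof -
  let ?L = interval_measure01 and ?L2 = square_measure01
  show m: "(\<lambda>z. z) \<in> ?L2 \<rightarrow>\<^sub>M (?L \<Otimes>\<^sub>M ?L)"
  proof (rule measurable_sigma_sets[where \<Omega>="unit_square" and A="{a \<times> b |a b. a \<in> sets ?L \<and> b \<in> sets ?L}"])
    show "sets (?L \<Otimes>\<^sub>M ?L) = sigma_sets unit_square {a \<times> b |a b. a \<in> sets ?L \<and> b \<in> sets ?L}"
      by (simp add: sets_pair_measure space_pair_measure)
    show "{a \<times> b |a b. a \<in> sets ?L \<and> b \<in> sets ?L} \<subseteq> Pow unit_square"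
      by (auto simp: sets_lebesgue_on_iff)
    show "(\<lambda>z. z) \<in> space ?L2 \<rightarrow> unit_square" by auto
    fix y assume "y \<in> {a \<times> b |a b. a \<in> sets ?L \<and> b \<in> sets ?L}"
    then obtain a b where y: "y = a \<times> b" "a \<in> sets lebesgue" "a \<subseteq> unit_interval" "b \<in> sets lebesgue" "b \<subseteq> unit_interval"
      by (auto simp: sets_lebesgue_on_iff)
    then have "y \<subseteq> unit_square" "y \<in> sets lebesgue" by (auto intro!: sets_lebesgue_Times)
    then show "(\<lambda>z. z) -` y \<inter> space ?L2 \<in> sets ?L2"
      by (auto simp: sets_lebesgue_on_iff)
  qed
  show "?L \<Otimes>\<^sub>M ?L = distr ?L2 (?L \<Otimes>\<^sub>M ?L) (\<lambda>z. z)"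
  proof (rule pair_measure_eqI)
    fix A B assume AB: "A \<in> sets ?L" "B \<in> sets ?L"
    then have *: "A \<times> B \<subseteq> unit_square" "A \<in> sets lebesgue" "B \<in> sets lebesgue"
        "A \<subseteq> unit_interval" "B \<subseteq> unit_interval"
      by (auto simp: sets_lebesgue_on_iff)
    have "emeasure (distr ?L2 (?L \<Otimes>\<^sub>M ?L) (\<lambda>z. z)) (A \<times> B) = emeasure ?L2 ((\<lambda>z. z) -` (A \<times> B) \<inter> space ?L2)"
      using AB by (intro emeasure_distr[OF m]) auto
    also have "(\<lambda>z. z) -` (A \<times> B) \<inter> space ?L2 = A \<times> B" using * by auto
    also have "emeasure ?L2 (A \<times> B) = emeasure lebesgue (A \<times> B)"
      using * by (intro emeasure_restrict_space) auto
    finally show "emeasure ?L A * emeasure ?L B = emeasure (distr ?L2 (?L \<Otimes>\<^sub>M ?L) (\<lambda>z. z)) (A \<times> B)"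
      using * by (simp add: emeasure_lebesgue_Times emeasure_restrict_space)
  qed (auto intro: int01.sigma_finite_measure_axioms)
qed

lemma lebesgue_pair_sets:
  assumes "A \<in> sets (interval_measure01 \<Otimes>\<^sub>M interval_measure01)"
  shows "A \<in> sets square_measure01"
    and "emeasure (interval_measure01 \<Otimes>\<^sub>M interval_measure01) A = emeasure square_measure01 A"
proof -
  have sub: "A \<subseteq> unit_square"
    using sets.sets_into_space[OF assms] by (auto simp: space_pair_measure)
  show "A \<in> sets square_measure01"
    using measurable_sets[OF measurable_square_pair assms] sub by (simp add: inf.absorb1)
  show "emeasure (interval_measure01 \<Otimes>\<^sub>M interval_measure01) A = emeasure square_measure01 A"
    using emeasure_distr[OF measurable_square_pair assms] pair_measure_distr_square sub
    by (simp add: inf.absorb1)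
qed

text \<open>A partial converse to the inclusion of sigma-algebras above; with null sets added it
  yields all Lebesgue sets of the square.\<close>

lemma borel_sets_pair01:
  assumes "A \<in> sets lborel" 
  shows "A \<inter> unit_square \<in> sets (interval_measure01 \<Otimes>\<^sub>M interval_measure01)"
proof -
  have i: "(\<lambda>x. x) \<in> interval_measure01 \<rightarrow>\<^sub>M borel"
    using id_borel_measurable_lebesgue_on[of unit_interval] by (simp add: id_def)
  have "(\<lambda>z. z) \<in> interval_measure01 \<Otimes>\<^sub>M interval_measure01 \<rightarrow>\<^sub>M borel \<Otimes>\<^sub>M borel"
    using i by (auto intro!: measurable_pair simp: o_def intro: measurable_compose[OF measurable_fst] measurable_compose[OF measurable_snd])
  then have "(\<lambda>z. z) \<in> interval_measure01 \<Otimes>\<^sub>M interval_measure01 \<rightarrow>\<^sub>M borel"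
    by (simp add: borel_prod)
  from measurable_sets[OF this, of A] assms show ?thesis
    by (simp add: space_pair_measure)
qed

text \<open>Null sets of the product are Lebesgue null, and every Lebesgue set is Borel up to a
  subset of a null Borel set. This identity is the bridge by which facts on product measures reach
  Lebesgue measure on the square.\<close>

lemma completion_pair01: "completion (interval_measure01 \<Otimes>\<^sub>M interval_measure01) = square_measure01"
proof (rule measure_eqI)
  let ?P = "interval_measure01 \<Otimes>\<^sub>M interval_measure01"
  have null: "N \<in> null_sets ?P \<Longrightarrow> N \<in> null_sets lebesgue" for N
    using lebesgue_pair_sets[of N] 
    by (auto simp: null_sets_def sets_lebesgue_on_iff emeasure_restrict_space)
  have 1: "A \<in> sets square_measure01 \<and> emeasure (completion ?P) A = emeasure square_measure01 A" if A: "A \<in> sets (completion ?P)" for A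
  proof -
    obtain S N N' where S: "A = S \<union> N" "N \<subseteq> N'" "N' \<in> null_sets ?P" "S \<in> sets ?P"
      using sets_completionE[OF A] by metis
    have "N \<in> null_sets lebesgue"
      using null[OF S(3)] S(2) null_sets_completion_subset by blast
    moreover have "N' \<subseteq> unit_square"
      using sets.sets_into_space[of N' ?P] S(3) by (auto simp: space_pair_measure)
    ultimately have N: "N \<in> null_sets square_measure01"
      using S(2) by (auto simp: null_sets_def sets_lebesgue_on_iff emeasure_restrict_space)
    have N1: "N \<in> null_sets (completion ?P)"
      using S null_sets_completion_iff2 by blast
    note SS = lebesgue_pair_sets[OF S(4)]
    have "emeasure (completion ?P) A = emeasure (completion ?P) S"
      unfolding S(1) by (rule emeasure_Un_null_set) (use S N1 in auto)
    also have "\<dots> = emeasure square_measure01 S"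
      using S SS by simp
    also have "\<dots> = emeasure square_measure01 A"
      unfolding S(1) by (rule emeasure_Un_null_set[symmetric]) (use SS N in auto)
    finally show ?thesis using SS N S(1) by auto
  qed
  have 2: "A \<in> sets (completion ?P)" if A: "A \<in> sets square_measure01" for A
  proof -
    have "A \<in> sets lebesgue" "A \<subseteq> unit_square" using A by (auto simp: sets_lebesgue_on_iff)
    then obtain S N N' where S: "A = S \<union> N" "N \<subseteq> N'" "N' \<in> null_sets lborel" "S \<in> sets lborel"
      using sets_completionE[of A lborel] by metis
    have a: "N' \<inter> unit_square \<in> sets ?P" "S \<inter> unit_square \<in> sets ?P"
      using borel_sets_pair01 S by auto
    have "emeasure ?P (N' \<inter> unit_square) = emeasure lebesgue (N' \<inter> unit_square)"
      using lebesgue_pair_sets[OF a(1)] by (simp add: emeasure_restrict_space)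
    also have "\<dots> = 0"
      using S(3) by (metis Int_lower1 emeasure_eq_0 null_setsD1 null_setsD2 null_sets_completionI)
    finally have "N' \<inter> unit_square \<in> null_sets ?P" using a by auto
    then show ?thesis
      using a S \<open>A \<subseteq> unit_square\<close> by (intro sets_completionI[of A "S \<inter> unit_square" N "N' \<inter> unit_square"]) auto
  qed
  show "sets (completion ?P) = sets square_measure01" using 1 2 by auto
  show "emeasure (completion ?P) A = emeasure square_measure01 A" if "A \<in> sets (completion ?P)" for A
    using 1 that by auto
qed

text \<open>Measurability for the product does not by itself pass to completions. It does here
  because a measure-preserving map pulls null sets back to null sets.\<close>

lemma distr_square_measure01_pair:
  assumes m: "\<Phi> \<in> interval_measure01 \<Otimes>\<^sub>M interval_measure01 \<rightarrow>\<^sub>M interval_measure01 \<Otimes>\<^sub>M interval_measure01"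
    and d: "distr (interval_measure01 \<Otimes>\<^sub>M interval_measure01) (interval_measure01 \<Otimes>\<^sub>M interval_measure01) \<Phi>
      = interval_measure01 \<Otimes>\<^sub>M interval_measure01"
  shows "\<Phi> \<in> square_measure01 \<rightarrow>\<^sub>M square_measure01"
    and "distr square_measure01 square_measure01 \<Phi> = square_measure01"
proof -
  let ?P = "interval_measure01 \<Otimes>\<^sub>M interval_measure01"
  have mc: "\<Phi> \<in> completion ?P \<rightarrow>\<^sub>M ?P"
    by (rule measurable_completion[OF m])
  have dc: "distr (completion ?P) ?P \<Phi> = ?P"
    by (simp add: distr_completion[OF m] d)
  have "\<Phi> \<in> completion ?P \<rightarrow>\<^sub>M completion ?P"
    by (rule completion.measurable_completion2[OF mc]) (simp add: dc)
  then show "\<Phi> \<in> square_measure01 \<rightarrow>\<^sub>M square_measure01"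
    by (simp add: completion_pair01)
  have "completion ?P = distr (completion ?P) (completion ?P) \<Phi>"
    using completion.completion_distr_eq[OF mc] dc by simp
  then show "distr square_measure01 square_measure01 \<Phi> = square_measure01"
    by (simp add: completion_pair01)
qed

lemma distr_square_measure01:
  assumes "\<phi> \<in> interval_measure01 \<rightarrow>\<^sub>M interval_measure01"
    and "distr interval_measure01 interval_measure01 \<phi> = interval_measure01"
  shows "(\<lambda>(x, y). (\<phi> x, \<phi> y)) \<in> square_measure01 \<rightarrow>\<^sub>M square_measure01"
    and "distr square_measure01 square_measure01 (\<lambda>(x, y). (\<phi> x, \<phi> y)) = square_measure01"
proof -
  let ?P = "interval_measure01 \<Otimes>\<^sub>M interval_measure01" and ?\<Phi> = "\<lambda>(x, y). (\<phi> x, \<phi> y)"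
  have m: "?\<Phi> \<in> ?P \<rightarrow>\<^sub>M ?P"
    using assms(1) by measurable
  have d: "distr ?P ?P ?\<Phi> = ?P"
    using pair_measure_distr[OF assms(1) assms(1)] assms(2) int01.sigma_finite_measure_axioms by simp
  show "?\<Phi> \<in> square_measure01 \<rightarrow>\<^sub>M square_measure01"
    "distr square_measure01 square_measure01 ?\<Phi> = square_measure01"
    by (rule distr_square_measure01_pair[OF m d])+
qed

lemma distr_square_measure01_swap:
  shows "(\<lambda>(x, y). (y, x)) \<in> square_measure01 \<rightarrow>\<^sub>M square_measure01"
    and "distr square_measure01 square_measure01 (\<lambda>(x, y). (y, x)) = square_measure01"
proof -
  interpret pair_sigma_finite interval_measure01 interval_measure01 ..
  show "(\<lambda>(x, y). (y, x)) \<in> square_measure01 \<rightarrow>\<^sub>M square_measure01"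
    "distr square_measure01 square_measure01 (\<lambda>(x, y). (y, x)) = square_measure01"
    by (rule distr_square_measure01_pair[OF measurable_pair_swap' distr_pair_swap[symmetric]])+
qed

section \<open>Bounded kernels and relabellings\<close>

text \<open>Differences of graphons may be negative, and the step kernels used later need not be
  symmetric. This larger class is closed under the operations of the proof, and its members are
  integrable.\<close>

definition bounded_kernels :: "(real \<times> real \<Rightarrow> real) set" where
  "bounded_kernels = {f \<in> borel_measurable square_measure01. \<exists>C. \<forall>z\<in>unit_square. \<bar>f z\<bar> \<le> C}"

abbreviation rect_integral :: "(real \<times> real \<Rightarrow> real) \<Rightarrow> real set \<Rightarrow> real set \<Rightarrow> real" where
  "rect_integral f S T \<equiv> (LINT z:S \<times> T|lebesgue. f z)"

lemma sets_interval01: "S \<in> sets interval_measure01 \<longleftrightarrow> S \<in> sets lebesgue \<and> S \<subseteq> unit_interval"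
  by (simp add: sets_lebesgue_on_iff)

lemma sets_square01: "A \<in> sets square_measure01 \<longleftrightarrow> A \<in> sets lebesgue \<and> A \<subseteq> unit_square"
  by (simp add: sets_lebesgue_on_iff)

lemma Times_in_square01:
  assumes "S \<in> sets interval_measure01" "T \<in> sets interval_measure01"
  shows "S \<times> T \<in> sets square_measure01"
  using assms by (force simp: sets_interval01 sets_square01 intro!: sets_lebesgue_Times)

lemma bounded_kernels_bound:
  assumes "f \<in> bounded_kernels"
  obtains C where "C \<ge> 0" "\<And>z. z \<in> unit_square \<Longrightarrow> \<bar>f z\<bar> \<le> C"
proof -
  obtain C where C: "\<forall>z\<in>unit_square. \<bar>f z\<bar> \<le> C"
    using assms by (auto simp: bounded_kernels_def)
  then have "\<bar>f (0, 0)\<bar> \<le> C" by auto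
  then show ?thesis using C that[of C] by fastforce
qed

lemma bounded_kernelsI:
  assumes "f \<in> borel_measurable square_measure01" "\<And>z. z \<in> unit_square \<Longrightarrow> \<bar>f z\<bar> \<le> C"
  shows "f \<in> bounded_kernels"
  using assms by (auto simp: bounded_kernels_def)

lemma bounded_kernels_measurable: "f \<in> bounded_kernels \<Longrightarrow> f \<in> borel_measurable square_measure01"
  by (simp add: bounded_kernels_def)

lemma bounded_kernels_diff:
  assumes "f \<in> bounded_kernels" "g \<in> bounded_kernels"
  shows "(\<lambda>z. f z - g z) \<in> bounded_kernels"
proof -
  obtain C D where "\<And>z. z \<in> unit_square \<Longrightarrow> \<bar>f z\<bar> \<le> C" "\<And>z. z \<in> unit_square \<Longrightarrow> \<bar>g z\<bar> \<le> D"
    using bounded_kernels_bound[OF assms(1)] bounded_kernels_bound[OF assms(2)] by metis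
  then show ?thesis
    using assms[THEN bounded_kernels_measurable]
    by (intro bounded_kernelsI[of _ "C + D"]) (fastforce intro: borel_measurable_diff)+
qed

lemma bounded_kernels_mult:
  assumes "f \<in> bounded_kernels" "g \<in> bounded_kernels"
  shows "(\<lambda>z. f z * g z) \<in> bounded_kernels"
proof -
  obtain C where "C \<ge> 0" "\<And>z. z \<in> unit_square \<Longrightarrow> \<bar>f z\<bar> \<le> C"
    using bounded_kernels_bound[OF assms(1)] by metis
  moreover obtain D where "D \<ge> 0" "\<And>z. z \<in> unit_square \<Longrightarrow> \<bar>g z\<bar> \<le> D"
    using bounded_kernels_bound[OF assms(2)] by metis
  ultimately show ?thesis
    using assms[THEN bounded_kernels_measurable]
    by (intro bounded_kernelsI[of _ "C * D"]) (auto simp: abs_mult intro!: mult_mono)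
qed

lemma bounded_kernels_indicator:
  assumes "A \<in> sets square_measure01"
  shows "(\<lambda>z. c * indicator A z) \<in> bounded_kernels"
  using assms by (intro bounded_kernelsI[of _ "\<bar>c\<bar>"]) (auto split: split_indicator)

lemma bounded_kernels_sum:
  assumes "\<And>i. i \<in> X \<Longrightarrow> f i \<in> bounded_kernels"
  shows "(\<lambda>z. \<Sum>i\<in>X. f i z) \<in> bounded_kernels"
proof (cases "finite X")
  case True
  then show ?thesis using assms
  proof (induction X)
    case empty
    show ?case by (auto intro: bounded_kernelsI[of _ 0])
  next
    case (insert x X)
    \<comment> \<open>Only closure under differences is at hand, so the sum is written as a
      difference with a negated remainder.\<close>
    have "(\<lambda>z. f x z - (\<lambda>z. 0 - (\<Sum>i\<in>X. f i z)) z) \<in> bounded_kernels"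
      using insert by (intro bounded_kernels_diff) (auto intro: bounded_kernelsI[of "\<lambda>_. 0" 0])
    then show ?case using insert by simp
  qed
qed (auto intro: bounded_kernelsI[of _ 0])

lemma graphons_bounded_kernels: "W \<in> graphons \<Longrightarrow> W \<in> bounded_kernels"
  by (intro bounded_kernelsI[of _ 1]) (auto simp: graphons_def)

lemma bounded_kernels_integrable: "f \<in> bounded_kernels \<Longrightarrow> integrable square_measure01 f"
proof (rule bounded_kernels_bound)
  fix C assume "f \<in> bounded_kernels" "\<And>z. z \<in> unit_square \<Longrightarrow> \<bar>f z\<bar> \<le> C"
  then show "integrable square_measure01 f"
    by (intro sq01.integrable_const_bound[of _ C]) (auto simp: bounded_kernels_measurable)
qed

lemma bounded_kernels_integrable_indicator:
  assumes "f \<in> bounded_kernels" "A \<in> sets square_measure01"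
  shows "integrable square_measure01 (\<lambda>z. indicator A z * f z)"
  using bounded_kernels_mult[OF bounded_kernels_indicator[OF assms(2), of 1] assms(1)]
  by (auto intro: bounded_kernels_integrable)

lemma rect_integral_square01:
  assumes "S \<subseteq> unit_interval" "T \<subseteq> unit_interval"
  shows "rect_integral f S T = (LINT z|square_measure01. indicator (S \<times> T) z * f z)"
proof -
  have "indicator unit_square z * (indicator (S \<times> T) z * f z) = indicator (S \<times> T) z * f z" for z
    using assms by (auto split: split_indicator)
  then have "(LINT z|lebesgue. indicator unit_square z *\<^sub>R (indicator (S \<times> T) z * f z)) = rect_integral f S T"
    unfolding set_lebesgue_integral_def real_scaleR_def by presburger
  moreover have "(LINT z|square_measure01. indicator (S \<times> T) z * f z)
      = (LINT z|lebesgue. indicator unit_square z *\<^sub>R (indicator (S \<times> T) z * f z))"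
    by (rule integral_restrict_space) simp
  ultimately show ?thesis by simp
qed

lemma rect_integral_cong:
  assumes "S \<subseteq> unit_interval" "T \<subseteq> unit_interval" "\<And>z. z \<in> unit_square \<Longrightarrow> f z = g z"
  shows "rect_integral f S T = rect_integral g S T"
  unfolding set_lebesgue_integral_def
  by (intro Bochner_Integration.integral_cong) (use assms in \<open>auto split: split_indicator\<close>)

lemma rect_integral_diff:
  assumes "S \<in> sets interval_measure01" "T \<in> sets interval_measure01" "f \<in> bounded_kernels" "g \<in> bounded_kernels"
  shows "rect_integral (\<lambda>z. f z - g z) S T = rect_integral f S T - rect_integral g S T"
proof -
  have "S \<subseteq> unit_interval" "T \<subseteq> unit_interval" using assms by (auto simp: sets_interval01)
  then show ?thesis
    using assms bounded_kernels_integrable_indicator[OF _ Times_in_square01]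
    by (simp add: rect_integral_square01 right_diff_distrib)
qed

lemma rect_integral_minus: "rect_integral (\<lambda>z. g z - f z) S T = - rect_integral (\<lambda>z. f z - g z) S T"
proof -
  have "(\<lambda>z. indicator (S \<times> T) z *\<^sub>R (g z - f z)) = (\<lambda>z. - (indicator (S \<times> T) z *\<^sub>R (f z - g z)))"
    by (auto simp: algebra_simps)
  then show ?thesis by (simp only: set_lebesgue_integral_def Bochner_Integration.integral_minus)
qed

lemma measure_square01: "measure square_measure01 unit_square = 1"
  by (simp add: measure_def emeasure_restrict_space emeasure_lebesgue_unit_square)

text \<open>The set \<open>A\<close> carries the support of \<open>f\<close>. Small exceptional sets
  give small integrals this way; with \<open>A\<close> the whole square it is the plain sup
  bound.\<close>

lemma abs_integral_square01_le:
  assumes "f \<in> bounded_kernels" "\<And>z. z \<in> unit_square \<Longrightarrow> \<bar>f z\<bar> \<le> C * indicator A z" "A \<in> sets square_measure01"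
  shows "\<bar>LINT z|square_measure01. f z\<bar> \<le> C * measure square_measure01 A"
proof -
  have "\<bar>LINT z|square_measure01. f z\<bar> \<le> (LINT z|square_measure01. \<bar>f z\<bar>)"
    by (rule integral_abs_bound)
  also have "\<dots> \<le> (LINT z|square_measure01. C * indicator A z)"
    using assms(2)
    by (intro integral_mono integrable_abs bounded_kernels_integrable bounded_kernels_indicator assms) simp
  also have "\<dots> = C * measure square_measure01 A"
    using assms(3) by (simp add: sets_square01 inf.absorb1)
  finally show ?thesis .
qed

lemma abs_rect_integral_le:
  assumes "S \<in> sets interval_measure01" "T \<in> sets interval_measure01" "f \<in> bounded_kernels"
    "\<And>z. z \<in> unit_square \<Longrightarrow> \<bar>f z\<bar> \<le> C * indicator A z" "A \<in> sets square_measure01"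
  shows "\<bar>rect_integral f S T\<bar> \<le> C * measure square_measure01 A"
proof -
  have *: "S \<subseteq> unit_interval" "T \<subseteq> unit_interval" using assms by (auto simp: sets_interval01)
  have "\<bar>LINT z|square_measure01. indicator (S \<times> T) z * f z\<bar> \<le> C * measure square_measure01 A"
  proof (rule abs_integral_square01_le)
    show "(\<lambda>z. indicator (S \<times> T) z * f z) \<in> bounded_kernels"
      using bounded_kernels_mult[OF bounded_kernels_indicator[OF Times_in_square01[OF assms(1,2)], of 1] assms(3)]
      by simp
    fix z assume "z \<in> unit_square"
    from assms(4)[OF this] show "\<bar>indicator (S \<times> T) z * f z\<bar> \<le> C * indicator A z"
      by (cases "z \<in> S \<times> T") auto
  qed (rule assms(5))
  then show ?thesis using * by (simp add: rect_integral_square01)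
qed

lemma abs_rect_integral_bound:
  assumes "S \<in> sets interval_measure01" "T \<in> sets interval_measure01" "f \<in> bounded_kernels"
    "\<And>z. z \<in> unit_square \<Longrightarrow> \<bar>f z\<bar> \<le> C"
  shows "\<bar>rect_integral f S T\<bar> \<le> C"
  using abs_rect_integral_le[OF assms(1-3), of C unit_square] assms(4) measure_square01 by simp

section \<open>Invertible measure-preserving maps of the interval\<close>

lemma imp_id: "(\<lambda>x. x) \<in> invertible_measure_preserving"
proof -
  have "inv_into unit_interval (\<lambda>x. x) x = x" if "x \<in> unit_interval" for x
    using that by (intro inv_into_f_eq) auto
  then have "inv_into unit_interval (\<lambda>x. x) \<in> interval_measure01 \<rightarrow>\<^sub>M interval_measure01"
    by (subst measurable_cong[where g="\<lambda>x. x"]) auto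
  moreover have "distr interval_measure01 interval_measure01 (\<lambda>x. x) = interval_measure01"
    by (rule distr_id)
  ultimately show ?thesis
    by (auto simp: invertible_measure_preserving_def bij_betw_def)
qed

lemma impD:
  assumes "\<phi> \<in> invertible_measure_preserving"
  shows "bij_betw \<phi> unit_interval unit_interval"
    and "\<phi> \<in> interval_measure01 \<rightarrow>\<^sub>M interval_measure01"
    and "inv_into unit_interval \<phi> \<in> interval_measure01 \<rightarrow>\<^sub>M interval_measure01"
    and "distr interval_measure01 interval_measure01 \<phi> = interval_measure01"
  using assms by (auto simp: invertible_measure_preserving_def)

lemma imp_in: "\<phi> \<in> invertible_measure_preserving \<Longrightarrow> x \<in> unit_interval \<Longrightarrow> \<phi> x \<in> unit_interval"
  using impD(1) bij_betwE by metis

lemma imp_inv_into: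
  assumes "\<phi> \<in> invertible_measure_preserving" "x \<in> unit_interval"
  shows "inv_into unit_interval \<phi> (\<phi> x) = x" "\<phi> (inv_into unit_interval \<phi> x) = x"
  using assms impD(1)[OF assms(1)]
  by (auto simp: bij_betw_inv_into_left bij_betw_inv_into_right)

lemma imp_inv:
  assumes "\<phi> \<in> invertible_measure_preserving"
  shows "inv_into unit_interval \<phi> \<in> invertible_measure_preserving"
proof -
  let ?i = "inv_into unit_interval \<phi>"
  note d = impD[OF assms]
  have bi: "bij_betw ?i unit_interval unit_interval"
    using d(1) by (rule bij_betw_inv_into)
  have "inv_into unit_interval ?i x = \<phi> x" if "x \<in> unit_interval" for x
    using inv_into_inv_into_eq[OF d(1) that] by simp
  then have m: "inv_into unit_interval ?i \<in> interval_measure01 \<rightarrow>\<^sub>M interval_measure01"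
    using d(2) by (subst measurable_cong[where g=\<phi>]) auto
  \<comment> \<open>Lebesgue measure is first replaced by its own image under \<open>\<phi>\<close>,
    so that the two push-forwards cancel.\<close>
  have "distr interval_measure01 interval_measure01 ?i
      = distr (distr interval_measure01 interval_measure01 \<phi>) interval_measure01 ?i"
    using d(4) by simp
  also have "\<dots> = distr interval_measure01 interval_measure01 (?i \<circ> \<phi>)"
    using d by (intro distr_distr) auto
  also have "\<dots> = distr interval_measure01 interval_measure01 (\<lambda>x. x)"
    using imp_inv_into[OF assms] by (intro distr_cong) auto
  also have "\<dots> = interval_measure01" by (rule distr_id)
  finally show ?thesis
    using bi m d(3) by (simp add: invertible_measure_preserving_def)
qed

lemma imp_comp:
  assumes "\<phi> \<in> invertible_measure_preserving" "\<psi> \<in> invertible_measure_preserving"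
  shows "(\<lambda>x. \<psi> (\<phi> x)) \<in> invertible_measure_preserving"
proof -
  note d = impD[OF assms(1)] and e = impD[OF assms(2)]
  have b: "bij_betw (\<lambda>x. \<psi> (\<phi> x)) unit_interval unit_interval"
    using bij_betw_trans[OF d(1) e(1)] by (simp add: o_def)
  have "inv_into unit_interval (\<lambda>x. \<psi> (\<phi> x)) x
      = inv_into unit_interval \<phi> (inv_into unit_interval \<psi> x)" if "x \<in> unit_interval" for x
  proof (rule inv_into_f_eq)
    show "inj_on (\<lambda>x. \<psi> (\<phi> x)) unit_interval" using b by (rule bij_betw_imp_inj_on)
    have "inv_into unit_interval \<psi> x \<in> unit_interval"
      using imp_in[OF imp_inv[OF assms(2)] that] .
    then show "inv_into unit_interval \<phi> (inv_into unit_interval \<psi> x) \<in> unit_interval"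
      "\<psi> (\<phi> (inv_into unit_interval \<phi> (inv_into unit_interval \<psi> x))) = x"
      using imp_in[OF imp_inv[OF assms(1)]] imp_inv_into[OF assms(1)] imp_inv_into[OF assms(2) that] by simp_all
  qed
  then have m: "inv_into unit_interval (\<lambda>x. \<psi> (\<phi> x)) \<in> interval_measure01 \<rightarrow>\<^sub>M interval_measure01"
    using measurable_compose[OF e(3) d(3)] by (subst measurable_cong) auto
  have "distr interval_measure01 interval_measure01 (\<lambda>x. \<psi> (\<phi> x)) =
      distr (distr interval_measure01 interval_measure01 \<phi>) interval_measure01 \<psi>"
    using distr_distr[OF e(2) d(2)] by (simp add: o_def)
  then have "distr interval_measure01 interval_measure01 (\<lambda>x. \<psi> (\<phi> x)) = interval_measure01"
    using d(4) e(4) by simp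
  then show ?thesis
    using b m measurable_compose[OF d(2) e(2)] by (simp add: invertible_measure_preserving_def)
qed

text \<open>The image is the preimage under the inverse map, whose measurability is part of the
  definition of invertibility.\<close>

lemma imp_image_sets:
  assumes "\<phi> \<in> invertible_measure_preserving" "S \<in> sets interval_measure01"
  shows "\<phi> ` S \<in> sets interval_measure01"
proof -
  have S: "S \<subseteq> unit_interval" using assms by (simp add: sets_interval01)
  have "\<phi> ` S = inv_into unit_interval \<phi> -` S \<inter> space interval_measure01"
  proof (intro set_eqI iffI)
    fix y assume "y \<in> \<phi> ` S"
    then obtain x where x: "y = \<phi> x" "x \<in> S" by blast
    with S have xI: "x \<in> unit_interval" by blast
    show "y \<in> inv_into unit_interval \<phi> -` S \<inter> space interval_measure01"
      using x imp_inv_into(1)[OF assms(1) xI] imp_in[OF assms(1) xI] by simp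
  next
    fix y assume "y \<in> inv_into unit_interval \<phi> -` S \<inter> space interval_measure01"
    then have y: "inv_into unit_interval \<phi> y \<in> S" "y \<in> unit_interval" by simp_all
    show "y \<in> \<phi> ` S"
      using imp_inv_into(2)[OF assms(1) y(2)] y(1) by (metis image_eqI)
  qed
  then show ?thesis using measurable_sets[OF impD(3)[OF assms(1)] assms(2)] by simp
qed

lemma imp_square:
  assumes "\<phi> \<in> invertible_measure_preserving"
  shows "(\<lambda>(x, y). (\<phi> x, \<phi> y)) \<in> square_measure01 \<rightarrow>\<^sub>M square_measure01"
    and "distr square_measure01 square_measure01 (\<lambda>(x, y). (\<phi> x, \<phi> y)) = square_measure01"
  using distr_square_measure01[OF impD(2,4)[OF assms]] by auto

lemma bounded_kernels_imp:
  assumes "\<phi> \<in> invertible_measure_preserving" "f \<in> bounded_kernels"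
  shows "(\<lambda>(x, y). f (\<phi> x, \<phi> y)) \<in> bounded_kernels"
proof -
  obtain C where C: "\<And>z. z \<in> unit_square \<Longrightarrow> \<bar>f z\<bar> \<le> C"
    using bounded_kernels_bound[OF assms(2)] by metis
  show ?thesis
  proof (rule bounded_kernelsI)
    show "(\<lambda>(x, y). f (\<phi> x, \<phi> y)) \<in> borel_measurable square_measure01"
      using measurable_compose[OF imp_square(1)[OF assms(1)] bounded_kernels_measurable[OF assms(2)]]
      by (simp add: case_prod_unfold)
    fix z assume "z \<in> unit_square"
    then show "\<bar>case z of (x, y) \<Rightarrow> f (\<phi> x, \<phi> y)\<bar> \<le> C"
      using C imp_in[OF assms(1)] by auto
  qed
qed

text \<open>Change of variables on the square. Injectivity turns the indicator of the image
  rectangle, composed with \<open>\<phi>\<close>, back into the indicator of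
  \<open>S \<times> T\<close>.\<close>

lemma rect_integral_imp:
  assumes "\<phi> \<in> invertible_measure_preserving" "f \<in> bounded_kernels"
    "S \<in> sets interval_measure01" "T \<in> sets interval_measure01"
  shows "rect_integral (\<lambda>(x, y). f (\<phi> x, \<phi> y)) S T = rect_integral f (\<phi> ` S) (\<phi> ` T)"
proof -
  let ?P = "\<lambda>(x, y). (\<phi> x, \<phi> y)" and ?g = "\<lambda>z. indicator (\<phi> ` S \<times> \<phi> ` T) z * f z"
  have ST: "S \<subseteq> unit_interval" "T \<subseteq> unit_interval" "\<phi> ` S \<subseteq> unit_interval" "\<phi> ` T \<subseteq> unit_interval"
    using assms imp_in[OF assms(1)] by (auto simp: sets_interval01 subset_iff)
  have inj: "inj_on \<phi> unit_interval" using impD(1)[OF assms(1)] bij_betw_imp_inj_on by blast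
  have g: "?g \<in> bounded_kernels"
    using bounded_kernels_mult[OF bounded_kernels_indicator[OF Times_in_square01, of "\<phi> ` S" "\<phi> ` T" 1] assms(2)]
      imp_image_sets[OF assms(1)] assms by simp
  have "rect_integral f (\<phi> ` S) (\<phi> ` T) = (LINT z|square_measure01. ?g z)"
    using ST by (intro rect_integral_square01)
  also have "\<dots> = (LINT z|distr square_measure01 square_measure01 ?P. ?g z)"
    using imp_square(2)[OF assms(1)] by simp
  also have "\<dots> = (LINT z|square_measure01. ?g (?P z))"
    using imp_square(1)[OF assms(1)] bounded_kernels_measurable[OF g] by (rule integral_distr)
  also have "\<dots> = (LINT z|square_measure01. indicator (S \<times> T) z * (\<lambda>(x, y). f (\<phi> x, \<phi> y)) z)"
  proof (intro Bochner_Integration.integral_cong refl)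
    fix z assume "z \<in> space square_measure01"
    moreover obtain x y where z: "z = (x, y)" by (cases z)
    ultimately have "x \<in> unit_interval" "y \<in> unit_interval" by auto
    then have "\<phi> x \<in> \<phi> ` S \<longleftrightarrow> x \<in> S" "\<phi> y \<in> \<phi> ` T \<longleftrightarrow> y \<in> T"
      using inj_on_image_mem_iff[OF inj] ST by auto
    then show "?g (?P z) = indicator (S \<times> T) z * (\<lambda>(x, y). f (\<phi> x, \<phi> y)) z"
      by (simp add: z indicator_def)
  qed
  also have "\<dots> = rect_integral (\<lambda>(x, y). f (\<phi> x, \<phi> y)) S T"
    using ST by (intro rect_integral_square01[symmetric])
  finally show ?thesis by simp
qed

section \<open>The cut norm and the cut distance\<close>

definition bounded_tuples :: "nat \<Rightarrow> kernel_tuple set" where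
  "bounded_tuples k = {W. \<forall>I\<in>Pow {1..k}. W I \<in> bounded_kernels}"

lemma graphon_systems_bounded: "W \<in> graphon_systems k \<Longrightarrow> W \<in> bounded_tuples k"
  by (auto simp: graphon_systems_def bounded_tuples_def intro: graphons_bounded_kernels)

lemma bounded_tuples_diff:
  "W \<in> bounded_tuples k \<Longrightarrow> U \<in> bounded_tuples k \<Longrightarrow> (\<lambda>I z. W I z - U I z) \<in> bounded_tuples k"
  by (auto simp: bounded_tuples_def intro: bounded_kernels_diff)

lemma bounded_tuples_relabel:
  "\<phi> \<in> invertible_measure_preserving \<Longrightarrow> U \<in> bounded_tuples k \<Longrightarrow> relabel U \<phi> \<in> bounded_tuples k"
  by (auto simp: bounded_tuples_def relabel_def intro: bounded_kernels_imp)

lemma cut_norm_altdef: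
  "cut_norm k W = (SUP (S, T) \<in> sets interval_measure01 \<times> sets interval_measure01.
        \<Sum>I\<in>Pow {1..k}. \<bar>rect_integral (W I) S T\<bar>)"
proof -
  have "{S \<in> sets lebesgue. S \<subseteq> unit_interval} = sets interval_measure01"
    by (simp only: set_eq_iff mem_Collect_eq sets_interval01 simp_thms)
  then show ?thesis by (simp add: cut_norm_def)
qed

text \<open>A real supremum bounds its members only if the set is bounded above; the sum of uniform
  bounds of the components provides this.\<close>

lemma cut_norm_upper:
  assumes "W \<in> bounded_tuples k" "S \<in> sets interval_measure01" "T \<in> sets interval_measure01"
  shows "(\<Sum>I\<in>Pow {1..k}. \<bar>rect_integral (W I) S T\<bar>) \<le> cut_norm k W"
proof -
  have "\<exists>c. \<forall>z\<in>unit_square. \<bar>W I z\<bar> \<le> c" if "I \<in> Pow {1..k}" for I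
    using assms(1) that unfolding bounded_tuples_def bounded_kernels_def by blast
  then obtain C where C: "\<And>I z. I \<in> Pow {1..k} \<Longrightarrow> z \<in> unit_square \<Longrightarrow> \<bar>W I z\<bar> \<le> C I" by metis
  have "bdd_above ((\<lambda>(S, T). \<Sum>I\<in>Pow {1..k}. \<bar>rect_integral (W I) S T\<bar>) `
      (sets interval_measure01 \<times> sets interval_measure01))"
  proof (rule bdd_aboveI2)
    fix ST assume "ST \<in> sets interval_measure01 \<times> sets interval_measure01"
    then obtain S T where ST: "ST = (S, T)" "S \<in> sets interval_measure01" "T \<in> sets interval_measure01" by auto
    have "(\<Sum>I\<in>Pow {1..k}. \<bar>rect_integral (W I) S T\<bar>) \<le> (\<Sum>I\<in>Pow {1..k}. C I)"
      using assms(1) by (intro sum_mono abs_rect_integral_bound ST C) (auto simp: bounded_tuples_def)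
    then show "(\<lambda>(S, T). \<Sum>I\<in>Pow {1..k}. \<bar>rect_integral (W I) S T\<bar>) ST \<le> (\<Sum>I\<in>Pow {1..k}. C I)"
      by (simp add: ST(1))
  qed
  from cSUP_upper[OF _ this, of "(S, T)"] show ?thesis
    using assms by (simp add: cut_norm_altdef)
qed

lemma cut_norm_least:
  assumes "\<And>S T. S \<in> sets interval_measure01 \<Longrightarrow> T \<in> sets interval_measure01 \<Longrightarrow>
    (\<Sum>I\<in>Pow {1..k}. \<bar>rect_integral (W I) S T\<bar>) \<le> c"
  shows "cut_norm k W \<le> c"
proof -
  have "{} \<in> sets interval_measure01" by simp
  then have "sets interval_measure01 \<noteq> {}" by blast
  then show ?thesis
    unfolding cut_norm_altdef by (intro cSUP_least) (use assms in auto)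
qed

lemma cut_norm_nonneg: "W \<in> bounded_tuples k \<Longrightarrow> 0 \<le> cut_norm k W"
  by (rule order_trans[OF _ cut_norm_upper[of _ _ "{}" "{}"]]) (auto intro: sum_nonneg)

text \<open>Values outside the square are arbitrary, so undoing a relabelling recovers a tuple only
  on the square. This lemma absorbs the difference.\<close>

lemma cut_norm_cong:
  assumes "\<And>I z. I \<in> Pow {1..k} \<Longrightarrow> z \<in> unit_square \<Longrightarrow> W I z = U I z"
  shows "cut_norm k W = cut_norm k U"
  unfolding cut_norm_altdef
proof (intro SUP_cong refl)
  fix ST assume "ST \<in> sets interval_measure01 \<times> sets interval_measure01"
  then obtain S T where ST: "ST = (S, T)" "S \<subseteq> unit_interval" "T \<subseteq> unit_interval"
    by (cases ST) (simp add: sets_interval01)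
  have "(\<Sum>I\<in>Pow {1..k}. \<bar>rect_integral (W I) S T\<bar>) = (\<Sum>I\<in>Pow {1..k}. \<bar>rect_integral (U I) S T\<bar>)"
    using assms by (intro sum.cong refl arg_cong[where f=abs] rect_integral_cong ST)
  then show "(case ST of (S, T) \<Rightarrow> \<Sum>I\<in>Pow {1..k}. \<bar>rect_integral (W I) S T\<bar>) =
    (case ST of (S, T) \<Rightarrow> \<Sum>I\<in>Pow {1..k}. \<bar>rect_integral (U I) S T\<bar>)"
    by (simp add: ST)
qed

lemma cut_norm_minus: "cut_norm k (\<lambda>I z. U I z - W I z) = cut_norm k (\<lambda>I z. W I z - U I z)"
proof -
  have "\<bar>rect_integral (\<lambda>z. U I z - W I z) S T\<bar> = \<bar>rect_integral (\<lambda>z. W I z - U I z) S T\<bar>" for I S T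
    using rect_integral_minus[of S T "U I" "W I"] by simp
  then show ?thesis unfolding cut_norm_altdef by simp
qed

lemma cut_norm_triangle:
  assumes "W \<in> bounded_tuples k" "U \<in> bounded_tuples k" "V \<in> bounded_tuples k"
  shows "cut_norm k (\<lambda>I z. W I z - V I z) \<le> cut_norm k (\<lambda>I z. W I z - U I z) + cut_norm k (\<lambda>I z. U I z - V I z)"
proof (rule cut_norm_least)
  fix S T assume ST: "S \<in> sets interval_measure01" "T \<in> sets interval_measure01"
  have "rect_integral (\<lambda>z. W I z - V I z) S T
      = rect_integral (\<lambda>z. W I z - U I z) S T + rect_integral (\<lambda>z. U I z - V I z) S T"
    if "I \<in> Pow {1..k}" for I
    using that assms ST by (simp add: rect_integral_diff bounded_tuples_def)
  then have "(\<Sum>I\<in>Pow {1..k}. \<bar>rect_integral (\<lambda>z. W I z - V I z) S T\<bar>)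
     \<le> (\<Sum>I\<in>Pow {1..k}. \<bar>rect_integral (\<lambda>z. W I z - U I z) S T\<bar> + \<bar>rect_integral (\<lambda>z. U I z - V I z) S T\<bar>)"
    by (intro sum_mono) (simp add: abs_triangle_ineq)
  also have "\<dots> \<le> cut_norm k (\<lambda>I z. W I z - U I z) + cut_norm k (\<lambda>I z. U I z - V I z)"
    unfolding sum.distrib
    using assms ST by (intro add_mono cut_norm_upper bounded_tuples_diff)
  finally show "(\<Sum>I\<in>Pow {1..k}. \<bar>rect_integral (\<lambda>z. W I z - V I z) S T\<bar>)
     \<le> cut_norm k (\<lambda>I z. W I z - U I z) + cut_norm k (\<lambda>I z. U I z - V I z)" .
qed

text \<open>Relabelling sends rectangles to rectangles, so the supremum runs over values that
  already occur for \<open>W\<close>. Applied to the inverse map it will give equality.\<close>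

lemma cut_norm_relabel_le:
  assumes "\<phi> \<in> invertible_measure_preserving" "W \<in> bounded_tuples k"
  shows "cut_norm k (relabel W \<phi>) \<le> cut_norm k W"
proof (rule cut_norm_least)
  fix S T assume ST: "S \<in> sets interval_measure01" "T \<in> sets interval_measure01"
  have "(\<Sum>I\<in>Pow {1..k}. \<bar>rect_integral (relabel W \<phi> I) S T\<bar>)
      = (\<Sum>I\<in>Pow {1..k}. \<bar>rect_integral (W I) (\<phi> ` S) (\<phi> ` T)\<bar>)"
    using assms ST unfolding relabel_def
    by (intro sum.cong refl arg_cong[where f=abs] rect_integral_imp) (auto simp: bounded_tuples_def)
  also have "\<dots> \<le> cut_norm k W"
    using assms ST imp_image_sets by (intro cut_norm_upper) auto
  finally show "(\<Sum>I\<in>Pow {1..k}. \<bar>rect_integral (relabel W \<phi> I) S T\<bar>) \<le> cut_norm k W" .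
qed

lemma relabel_relabel: "relabel (relabel W \<phi>) \<psi> = relabel W (\<lambda>x. \<phi> (\<psi> x))"
  by (auto simp: relabel_def)

lemma relabel_inv:
  assumes "\<phi> \<in> invertible_measure_preserving" "z \<in> unit_square"
  shows "relabel (relabel W \<phi>) (inv_into unit_interval \<phi>) I z = W I z"
    and "relabel (relabel W (inv_into unit_interval \<phi>)) \<phi> I z = W I z"
  using assms(2) imp_inv_into[OF assms(1)] by (auto simp: relabel_def)

lemma relabel_diff: "relabel (\<lambda>I z. W I z - U I z) \<phi> = (\<lambda>I z. relabel W \<phi> I z - relabel U \<phi> I z)"
  by (auto simp: relabel_def)

lemma cut_norm_relabel:
  assumes "\<phi> \<in> invertible_measure_preserving" "W \<in> bounded_tuples k"
  shows "cut_norm k (relabel W \<phi>) = cut_norm k W"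
proof (rule antisym[OF cut_norm_relabel_le[OF assms]])
  have "cut_norm k W = cut_norm k (relabel (relabel W \<phi>) (inv_into unit_interval \<phi>))"
    using relabel_inv(1)[OF assms(1)] by (intro cut_norm_cong) auto
  also have "\<dots> \<le> cut_norm k (relabel W \<phi>)"
    using assms by (intro cut_norm_relabel_le imp_inv bounded_tuples_relabel)
  finally show "cut_norm k W \<le> cut_norm k (relabel W \<phi>)" .
qed

section \<open>The cut distance as a pseudometric\<close>

lemma cut_distance_le:
  assumes "W \<in> bounded_tuples k" "U \<in> bounded_tuples k" "\<phi> \<in> invertible_measure_preserving"
  shows "cut_distance k W U \<le> cut_norm k (\<lambda>I z. W I z - relabel U \<phi> I z)"
  unfolding cut_distance_def
proof (rule cINF_lower[OF bdd_belowI2])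
  show "0 \<le> cut_norm k (\<lambda>I z. W I z - relabel U \<phi> I z)" if "\<phi> \<in> invertible_measure_preserving" for \<phi>
    using that assms by (intro cut_norm_nonneg bounded_tuples_diff bounded_tuples_relabel)
qed (use assms in auto)

lemma cut_distance_greatest:
  assumes "\<And>\<phi>. \<phi> \<in> invertible_measure_preserving \<Longrightarrow> c \<le> cut_norm k (\<lambda>I z. W I z - relabel U \<phi> I z)"
  shows "c \<le> cut_distance k W U"
  unfolding cut_distance_def using imp_id assms by (intro cINF_greatest) auto

lemma cut_distance_nonneg:
  "W \<in> bounded_tuples k \<Longrightarrow> U \<in> bounded_tuples k \<Longrightarrow> 0 \<le> cut_distance k W U"
  by (intro cut_distance_greatest cut_norm_nonneg bounded_tuples_diff bounded_tuples_relabel)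

lemma cut_distance_less_obtain:
  assumes "cut_distance k W U < c"
  obtains \<phi> where "\<phi> \<in> invertible_measure_preserving" "cut_norm k (\<lambda>I z. W I z - relabel U \<phi> I z) < c"
  using cut_distance_greatest[of c k W U] assms by (meson not_le)

lemma cut_distance_self:
  assumes "W \<in> bounded_tuples k"
  shows "cut_distance k W W = 0"
proof (rule antisym)
  have "cut_distance k W W \<le> cut_norm k (\<lambda>I z. W I z - relabel W (\<lambda>x. x) I z)"
    by (rule cut_distance_le[OF assms assms imp_id])
  also have "\<dots> \<le> 0" by (rule cut_norm_least) (simp add: relabel_def set_lebesgue_integral_def)
  finally show "cut_distance k W W \<le> 0" .
qed (rule cut_distance_nonneg[OF assms assms])

text \<open>Relabelling both sides by \<open>\<phi>\<close> leaves the norm unchanged and moves the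
  map from one argument to the other. Symmetry of the cut distance follows.\<close>

lemma cut_norm_relabel_swap:
  assumes "W \<in> bounded_tuples k" "U \<in> bounded_tuples k" "\<phi> \<in> invertible_measure_preserving"
  shows "cut_norm k (\<lambda>I z. U I z - relabel W (inv_into unit_interval \<phi>) I z)
    = cut_norm k (\<lambda>I z. W I z - relabel U \<phi> I z)"
proof -
  let ?i = "inv_into unit_interval \<phi>"
  have i: "?i \<in> invertible_measure_preserving" by (rule imp_inv[OF assms(3)])
  have "cut_norm k (\<lambda>I z. U I z - relabel W ?i I z)
      = cut_norm k (relabel (\<lambda>I z. U I z - relabel W ?i I z) \<phi>)"
    using assms i by (intro cut_norm_relabel[symmetric] bounded_tuples_diff bounded_tuples_relabel)
  also have "\<dots> = cut_norm k (\<lambda>I z. relabel U \<phi> I z - W I z)"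
    unfolding relabel_diff using relabel_inv(2)[OF assms(3)] by (intro cut_norm_cong) auto
  also have "\<dots> = cut_norm k (\<lambda>I z. W I z - relabel U \<phi> I z)"
    by (rule cut_norm_minus)
  finally show ?thesis .
qed

lemma cut_distance_commute_le:
  assumes "W \<in> bounded_tuples k" "U \<in> bounded_tuples k"
  shows "cut_distance k W U \<le> cut_distance k U W"
proof (rule cut_distance_greatest)
  fix \<phi> assume "\<phi> \<in> invertible_measure_preserving"
  then show "cut_distance k W U \<le> cut_norm k (\<lambda>I z. U I z - relabel W \<phi> I z)"
    using cut_distance_le[OF assms imp_inv, of \<phi>] cut_norm_relabel_swap[OF assms(2,1), of \<phi>] by simp
qed

lemma cut_distance_commute:
  "W \<in> bounded_tuples k \<Longrightarrow> U \<in> bounded_tuples k \<Longrightarrow> cut_distance k W U = cut_distance k U W"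
  by (simp add: antisym cut_distance_commute_le)

lemma cut_distance_triangle:
  assumes "W \<in> bounded_tuples k" "U \<in> bounded_tuples k" "V \<in> bounded_tuples k"
  shows "cut_distance k W V \<le> cut_distance k W U + cut_distance k U V"
proof (rule field_le_epsilon)
  fix e :: real assume e: "0 < e"
  obtain \<phi> where p: "\<phi> \<in> invertible_measure_preserving"
      "cut_norm k (\<lambda>I z. W I z - relabel U \<phi> I z) < cut_distance k W U + e / 2"
    using cut_distance_less_obtain[of k W U "cut_distance k W U + e / 2"] e by auto
  obtain \<psi> where q: "\<psi> \<in> invertible_measure_preserving"
      "cut_norm k (\<lambda>I z. U I z - relabel V \<psi> I z) < cut_distance k U V + e / 2"
    using cut_distance_less_obtain[of k U V "cut_distance k U V + e / 2"] e by auto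
  \<comment> \<open>Relabelling the comparison of \<open>U\<close> with
    \<open>relabel V \<psi>\<close> by \<open>\<phi>\<close> produces \<open>V\<close> composed with
    \<open>\<psi>\<close> after \<open>\<phi>\<close>, which fixes the order of composition.\<close>
  note pq = imp_comp[OF p(1) q(1)]
  have "cut_distance k W V \<le> cut_norm k (\<lambda>I z. W I z - relabel V (\<lambda>x. \<psi> (\<phi> x)) I z)"
    using assms(1,3) pq by (rule cut_distance_le)
  also have "\<dots> \<le> cut_norm k (\<lambda>I z. W I z - relabel U \<phi> I z)
      + cut_norm k (\<lambda>I z. relabel U \<phi> I z - relabel V (\<lambda>x. \<psi> (\<phi> x)) I z)"
    using assms p(1) pq by (intro cut_norm_triangle bounded_tuples_relabel)
  also have "cut_norm k (\<lambda>I z. relabel U \<phi> I z - relabel V (\<lambda>x. \<psi> (\<phi> x)) I z)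
     = cut_norm k (\<lambda>I z. U I z - relabel V \<psi> I z)"
    unfolding relabel_relabel[symmetric] relabel_diff[symmetric]
    using assms p q by (intro cut_norm_relabel bounded_tuples_diff bounded_tuples_relabel)
  finally show "cut_distance k W V \<le> cut_distance k W U + cut_distance k U V + e"
    using p q by simp
qed

section \<open>Weak limits and completeness\<close>

text \<open>The limits of the integrals over sets form a measure dominated by \<open>M\<close>: convergence spreads
  from the generator by Dynkin's lemma, and Tannery's theorem gives countable additivity.
  The limit function is its density.\<close>

lemma weak_limit_density:
  fixes M :: "'a measure" and V :: "nat \<Rightarrow> 'a \<Rightarrow> real"
  assumes fin: "finite_measure M"
    and V: "\<And>n. V n \<in> borel_measurable (completion M)"
    and V01: "\<And>n z. z \<in> space M \<Longrightarrow> 0 \<le> V n z \<and> V n z \<le> 1"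
    and G: "Int_stable G" "G \<subseteq> Pow (space M)" "sets M = sigma_sets (space M) G" "space M \<in> G"
    and conv: "\<And>A. A \<in> G \<Longrightarrow> convergent (\<lambda>n. LINT z|completion M. indicator A z * V n z)"
  obtains U where "U \<in> borel_measurable M" "\<And>z. 0 \<le> U z \<and> U z \<le> 1"
    "\<And>A. A \<in> sets M \<Longrightarrow> (\<lambda>n. LINT z|completion M. indicator A z * V n z) \<longlonglongrightarrow>
      (LINT z|completion M. indicator A z * U z)"
proof -
  interpret M: finite_measure M by fact
  interpret N: finite_measure "completion M"
    by standard (simp add: M.emeasure_finite)
  define a where "a n A = (LINT z|completion M. indicator A z * V n z)" for n A
  have sub: "A \<in> sets M \<Longrightarrow> A \<in> sets (completion M)" for A by (rule sets_completionI_sets)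
  have sp: "A \<in> sets M \<Longrightarrow> A \<subseteq> space M" for A by (rule sets.sets_into_space)
  have int: "integrable (completion M) (\<lambda>z. indicator A z * V n z)" if "A \<in> sets M" for A n
    using V01 V sub[OF that]
    by (intro N.integrable_const_bound[of _ 1] AE_I2) (auto simp: abs_mult split: split_indicator)
  have a_nonneg: "0 \<le> a n A" if "A \<in> sets M" for n A
    unfolding a_def using V01 by (intro integral_nonneg_AE AE_I2) auto
  have a_le: "a n A \<le> measure M A" if "A \<in> sets M" for n A
  proof -
    have "integrable (completion M) (\<lambda>z. indicator A z :: real)"
      using sub[OF that] by (intro N.integrable_const_bound[of _ 1] AE_I2) (auto split: split_indicator)
    then have "a n A \<le> (LINT z|completion M. indicator A z)"
      unfolding a_def using V01
      by (intro integral_mono int that) (auto split: split_indicator)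
    also have "\<dots> = measure M A"
      using sub[OF that] sp[OF that] that by (simp add: inf.absorb1)
    finally show ?thesis .
  qed
  have a_UN: "a n (\<Union>i. A i) = (\<Sum>i. a n (A i))"
    if A: "disjoint_family A" "range A \<subseteq> sets M" for n and A :: "nat \<Rightarrow> 'a set"
  proof -
    have UN: "(\<Union>i. A i) \<in> sets M" using A(2) by auto
    have "(LINT z:(\<Union>i. A i)|completion M. V n z) = (\<Sum>i. LINT z:A i|completion M. V n z)"
      using A int[OF UN] sub
      by (intro lebesgue_integral_countable_add) (auto simp: disjoint_family_on_def set_integrable_def)
    then show ?thesis by (simp add: a_def set_lebesgue_integral_def)
  qed
  have a_UN_limit: "(\<lambda>i. b i) sums suminf b \<and> (\<lambda>n. a n (\<Union>i. A i)) \<longlonglongrightarrow> suminf b"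
    if A: "disjoint_family A" "range A \<subseteq> sets M" "\<And>i. (\<lambda>n. a n (A i)) \<longlonglongrightarrow> b i"
    for A :: "nat \<Rightarrow> 'a set" and b
  proof -
    \<comment> \<open>The dominating series is \<open>measure M (A i)\<close>, summable because the
      sets are disjoint and \<open>M\<close> is finite.\<close>
    have "summable (\<lambda>i. norm (b i)) \<and> (\<lambda>n. \<Sum>i. a n (A i)) \<longlonglongrightarrow> suminf b"
      using tannerys_theorem[of "\<lambda>i n. a n (A i)" b sequentially "\<lambda>i. measure M (A i)"]
        A(3) sums_summable[OF M.finite_measure_UNION[OF A(2,1)]] A(2) a_le a_nonneg
      by (auto simp: case_prod_unfold image_subset_iff)
    then show ?thesis using a_UN[OF A(1,2)] summable_norm_cancel[of b] by (auto intro: summable_sums)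
  qed
  have conv_all: "convergent (\<lambda>n. a n A)" if "A \<in> sets M" for A
  proof -
    have "A \<in> sigma_sets (space M) G" using that G(3) by simp
    from G(1,2) this show ?thesis
    proof (induction A rule: sigma_sets_induct_disjoint)
      case (basic A)
      then show ?case using conv by (simp add: a_def)
    next
      case empty
      then show ?case by (simp add: a_def convergent_const)
    next
      case (compl A)
      then have A: "A \<in> sets M" using G(3) by simp
      \<comment> \<open>Complements need convergence on the whole space, hence the hypothesis that
        the generator contains \<open>space M\<close>.\<close>
      have "a n (space M - A) = a n (space M) - a n A" for n
      proof -
        have "a n (space M) - a n A = (LINT z|completion M. indicator (space M) z * V n z - indicator A z * V n z)"
          unfolding a_def using A by (intro Bochner_Integration.integral_diff[symmetric] int) auto
        also have "\<dots> = a n (space M - A)"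
          unfolding a_def by (intro Bochner_Integration.integral_cong) (use sp[OF A] in \<open>auto split: split_indicator\<close>)
        finally show ?thesis by simp
      qed
      moreover have "convergent (\<lambda>n. a n (space M))" using conv[OF G(4)] by (simp add: a_def)
      ultimately show ?case using compl convergent_diff by auto
    next
      case (union A)
      have 1: "range A \<subseteq> sets M" using union(2) G(3) by simp
      have 2: "(\<lambda>n. a n (A i)) \<longlonglongrightarrow> lim (\<lambda>n. a n (A i))" for i
        using union(3) by (simp add: convergent_LIMSEQ_iff)
      show ?case
        by (rule convergentI[OF conjunct2[OF a_UN_limit[OF union(1) 1 2]]])
    qed
  qed
  define \<nu> where "\<nu> A = lim (\<lambda>n. a n A)" for A
  have nu: "(\<lambda>n. a n A) \<longlonglongrightarrow> \<nu> A" if "A \<in> sets M" for A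
    using conv_all[OF that] by (simp add: \<nu>_def convergent_LIMSEQ_iff)
  have nu_nonneg: "0 \<le> \<nu> A" if "A \<in> sets M" for A
    using nu[OF that] a_nonneg[OF that] by (intro LIMSEQ_le_const) auto
  have nu_le: "\<nu> A \<le> measure M A" if "A \<in> sets M" for A
    using nu[OF that] a_le[OF that] by (intro LIMSEQ_le_const2) auto
  define N where "N = measure_of (space M) (sets M) (\<lambda>A. ennreal (\<nu> A))"
  have sets_N: "sets N = sets M" by (simp add: N_def sets.sigma_sets_eq sets.space_closed)
  have emeasure_N: "emeasure N A = ennreal (\<nu> A)" if "A \<in> sets M" for A
    unfolding N_def
  proof (rule emeasure_measure_of_sigma)
    show "sigma_algebra (space M) (sets M)" by (rule sets.sigma_algebra_axioms)
    have "\<nu> {} = 0" using nu[of "{}"] by (simp add: a_def LIMSEQ_const_iff)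
    then show "positive (sets M) (\<lambda>A. ennreal (\<nu> A))" by (simp add: positive_def)
    show "countably_additive (sets M) (\<lambda>A. ennreal (\<nu> A))"
    proof (rule countably_additiveI)
      fix A :: "nat \<Rightarrow> 'a set" assume A: "range A \<subseteq> sets M" "disjoint_family A" "(\<Union>i. A i) \<in> sets M"
      then have *: "(\<lambda>i. \<nu> (A i)) sums suminf (\<lambda>i. \<nu> (A i)) \<and>
          (\<lambda>n. a n (\<Union>i. A i)) \<longlonglongrightarrow> suminf (\<lambda>i. \<nu> (A i))"
        using nu by (intro a_UN_limit) auto
      then have "\<nu> (\<Union>i. A i) = suminf (\<lambda>i. \<nu> (A i))"
        using nu[OF A(3)] LIMSEQ_unique by blast
      then show "(\<Sum>i. ennreal (\<nu> (A i))) = ennreal (\<nu> (\<Union>i. A i))"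
        using * A nu_nonneg by (intro suminf_ennreal_eq) auto
    qed
  qed fact
  have "absolutely_continuous M N"
    unfolding absolutely_continuous_def
  proof
    fix A assume A: "A \<in> null_sets M"
    then have "\<nu> A \<le> 0" using nu_le[of A] by (auto simp: measure_def null_sets_def)
    then show "A \<in> null_sets N" using A by (auto simp: null_sets_def sets_N emeasure_N ennreal_neg)
  qed
  from M.Radon_Nikodym[OF this sets_N] obtain f where
    f[measurable]: "f \<in> borel_measurable M" and fN: "density M f = N" by blast
  have f_int: "(\<integral>\<^sup>+z. f z * indicator A z \<partial>M) = ennreal (\<nu> A)" if "A \<in> sets M" for A
    using emeasure_density[OF f that] emeasure_N[OF that] by (simp add: fN)
  have f1: "AE z in M. f z \<le> 1"
  proof -
    \<comment> \<open>Subtraction in \<open>ennreal\<close> is truncated at 0. The limit measure of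
      \<open>B\<close> is at most its \<open>M\<close>-measure, so the excess of the density over 1
      on \<open>B\<close> integrates to 0 and must vanish almost everywhere.\<close>
    define B where "B = {z \<in> space M. 1 < f z}"
    have B[measurable]: "B \<in> sets M" unfolding B_def by measurable
    have "(\<integral>\<^sup>+z. f z * indicator B z - indicator B z \<partial>M)
        = (\<integral>\<^sup>+z. f z * indicator B z \<partial>M) - (\<integral>\<^sup>+z. indicator B z \<partial>M)"
      by (intro nn_integral_diff) (auto simp: B_def M.emeasure_finite less_top[symmetric] split: split_indicator intro!: AE_I2)
    also have "\<dots> = ennreal (\<nu> B) - ennreal (measure M B)"
      using f_int[OF B] by (simp add: M.emeasure_eq_measure)
    also have "\<dots> = 0" using nu_le[OF B] by (simp add: diff_eq_0_iff_ennreal ennreal_leI)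
    finally have "AE z in M. f z * indicator B z - indicator B z = 0"
      by (subst (asm) nn_integral_0_iff_AE) auto
    then show ?thesis
      using AE_space
    proof eventually_elim
      case (elim z)
      then show ?case
        by (cases "z \<in> B") (auto simp: B_def not_less diff_eq_0_iff_ennreal)
    qed
  qed
  \<comment> \<open>The density is at most 1 only almost everywhere, while a graphon is bounded
    everywhere. Truncation changes it on a null set and also removes the value infinity, which
    \<open>enn2real\<close> would send to 0.\<close>
  define U where "U z = enn2real (min 1 (f z))" for z
  have U[measurable]: "U \<in> borel_measurable M" unfolding U_def by measurable
  have U01: "0 \<le> U z \<and> U z \<le> 1" for z
    unfolding U_def by (auto intro!: enn2real_leI)
  have "(LINT z|completion M. indicator A z * U z) = \<nu> A" if A: "A \<in> sets M" for A
  proof -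
    have "(LINT z|completion M. indicator A z * U z) = (LINT z|M. indicator A z * U z)"
      using A by (intro integral_completion borel_measurable_times borel_measurable_indicator U)
    also have "\<dots> = enn2real (\<integral>\<^sup>+z. ennreal (indicator A z * U z) \<partial>M)"
      using A U01 by (intro integral_eq_nn_integral) auto
    also have "(\<integral>\<^sup>+z. ennreal (indicator A z * U z) \<partial>M) = (\<integral>\<^sup>+z. f z * indicator A z \<partial>M)"
    proof (rule nn_integral_cong_AE, use f1 in eventually_elim)
      fix z assume "f z \<le> 1"
      then have "ennreal (U z) = f z"
        by (auto simp: U_def min_absorb2 ennreal_enn2real_if top_unique)
      then show "ennreal (indicator A z * U z) = f z * indicator A z"
        by (auto split: split_indicator)
    qed
    also have "\<dots> = ennreal (\<nu> A)" by (rule f_int[OF A])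
    finally show ?thesis using nu_nonneg[OF A] by simp
  qed
  then show thesis
    using nu U U01 by (intro that[of U]) (auto simp: a_def)
qed

lemma rect_integral_swap:
  assumes "f \<in> bounded_kernels" "S \<in> sets interval_measure01" "T \<in> sets interval_measure01"
  shows "rect_integral (\<lambda>(x, y). f (y, x)) S T = rect_integral f T S"
proof -
  let ?s = "\<lambda>(x, y). (y, x)"
  have ST: "S \<subseteq> unit_interval" "T \<subseteq> unit_interval"
    using assms by (simp_all add: sets_interval01)
  have g: "(\<lambda>z. indicator (T \<times> S) z * f z) \<in> bounded_kernels"
    using bounded_kernels_mult[OF bounded_kernels_indicator[OF Times_in_square01[OF assms(3,2)], of 1] assms(1)] by simp
  have "rect_integral f T S = (LINT z|distr square_measure01 square_measure01 ?s. indicator (T \<times> S) z * f z)"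
    using ST distr_square_measure01_swap(2) by (simp add: rect_integral_square01)
  also have "\<dots> = (LINT z|square_measure01. indicator (T \<times> S) (?s z) * f (?s z))"
    using distr_square_measure01_swap(1) bounded_kernels_measurable[OF g] by (rule integral_distr)
  also have "\<dots> = (LINT z|square_measure01. indicator (S \<times> T) z * (\<lambda>(x, y). f (y, x)) z)"
    by (intro Bochner_Integration.integral_cong) (auto split: split_indicator)
  also have "\<dots> = rect_integral (\<lambda>(x, y). f (y, x)) S T"
    using ST by (simp add: rect_integral_square01)
  finally show ?thesis by simp
qed

text \<open>Rectangles generate the product sigma-algebra, so convergence on them yields a density.
  It inherits symmetry only at the level of rectangle integrals; averaging it with its transpose
  makes it pointwise symmetric without changing those integrals.\<close>

lemma weak_limit_graphon:
  assumes V: "\<And>n. V n \<in> graphons"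
    and conv: "\<And>S T. S \<in> sets interval_measure01 \<Longrightarrow> T \<in> sets interval_measure01 \<Longrightarrow>
      convergent (\<lambda>n. rect_integral (V n) S T)"
  shows "\<exists>U\<in>graphons. \<forall>S\<in>sets interval_measure01. \<forall>T\<in>sets interval_measure01.
      (\<lambda>n. rect_integral (V n) S T) \<longlonglongrightarrow> rect_integral U S T"
proof -
  let ?P = "interval_measure01 \<Otimes>\<^sub>M interval_measure01"
  let ?G = "{a \<times> b |a b. a \<in> sets interval_measure01 \<and> b \<in> sets interval_measure01}"
  have sub: "S \<subseteq> unit_interval" if "S \<in> sets interval_measure01" for S
    using that by (simp add: sets_interval01)
  have Vb: "V n \<in> bounded_kernels" for n by (rule graphons_bounded_kernels[OF V])
  have finP: "finite_measure ?P"
  proof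
    have "emeasure (completion ?P) (space ?P) = 1"
      unfolding completion_pair01
      by (simp add: space_pair_measure emeasure_restrict_space emeasure_lebesgue_unit_square)
    then show "emeasure ?P (space ?P) \<noteq> \<infinity>" by simp
  qed
  obtain U where U: "U \<in> borel_measurable ?P" "\<And>z. 0 \<le> U z \<and> U z \<le> 1"
    "\<And>A. A \<in> sets ?P \<Longrightarrow> (\<lambda>n. LINT z|square_measure01. indicator A z * V n z) \<longlonglongrightarrow>
      (LINT z|square_measure01. indicator A z * U z)"
  proof (rule weak_limit_density[where M="?P" and V=V and G="?G"])
    show "V n \<in> borel_measurable (completion ?P)" for n
      by (simp add: completion_pair01 bounded_kernels_measurable[OF Vb])
    show "0 \<le> V n z \<and> V n z \<le> 1" if "z \<in> space ?P" for n z
      using V[of n] that by (auto simp: graphons_def space_pair_measure)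
    show "Int_stable ?G" by (rule Int_stable_pair_measure_generator)
    show "?G \<subseteq> Pow (space ?P)" "sets ?P = sigma_sets (space ?P) ?G"
      using pair_measure_closed[of interval_measure01 interval_measure01]
      by (simp_all only: sets_pair_measure space_pair_measure)
    show "space ?P \<in> ?G" unfolding space_pair_measure using sets.top[of interval_measure01] by blast
    show "convergent (\<lambda>n. LINT z|completion ?P. indicator A z * V n z)" if "A \<in> ?G" for A
      using that conv sub by (auto simp: completion_pair01 rect_integral_square01)
  qed (auto simp: completion_pair01 finP)
  have Um: "U \<in> borel_measurable square_measure01"
    using measurable_completion[OF U(1)] by (simp add: completion_pair01)
  then have Ub: "U \<in> bounded_kernels"
    using U(2) by (intro bounded_kernelsI[of _ 1]) auto
  define U' where "U' = (\<lambda>(x, y). (U (x, y) + U (y, x)) / 2)"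
  have Us: "(\<lambda>(x, y). U (y, x)) \<in> borel_measurable square_measure01"
    using measurable_compose[OF distr_square_measure01_swap(1) Um] by (simp add: case_prod_unfold)
  then have Usb: "(\<lambda>(x, y). U (y, x)) \<in> bounded_kernels"
    using U(2) by (intro bounded_kernelsI[of _ 1]) auto
  have U'_eq: "U' = (\<lambda>z. (U z + (\<lambda>(x, y). U (y, x)) z) / 2)"
    by (auto simp: U'_def)
  have "U' \<in> graphons"
    unfolding graphons_def
  proof (intro CollectI conjI ballI)
    show "U' \<in> borel_measurable square_measure01"
      unfolding U'_eq using Um Us by measurable
    show "U' (x, y) = U' (y, x)" for x y by (simp add: U'_def)
    show "0 \<le> U' z" "U' z \<le> 1" for z
      using U(2)[of z] U(2)[of "(snd z, fst z)"] by (simp_all add: U'_def case_prod_unfold)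
  qed
  moreover have "(\<lambda>n. rect_integral (V n) S T) \<longlonglongrightarrow> rect_integral U' S T"
    if ST: "S \<in> sets interval_measure01" "T \<in> sets interval_measure01" for S T
  proof -
    have lim: "(\<lambda>n. rect_integral (V n) S T) \<longlonglongrightarrow> rect_integral U S T"
      if "S \<in> sets interval_measure01" "T \<in> sets interval_measure01" for S T
      using U(3)[of "S \<times> T"] that sub by (auto simp: rect_integral_square01)
    have "rect_integral (V n) T S = rect_integral (V n) S T" for n
    proof -
      have "rect_integral (V n) S T = rect_integral (\<lambda>(x, y). V n (y, x)) S T"
        using ST sub V[of n] by (intro rect_integral_cong) (auto simp: graphons_def)
      then show ?thesis using rect_integral_swap[OF Vb ST] by simp
    qed
    then have "(\<lambda>n. rect_integral (V n) S T) \<longlonglongrightarrow> rect_integral U T S"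
      using lim[OF ST(2,1)] by simp
    then have "rect_integral U T S = rect_integral U S T"
      using lim[OF ST] LIMSEQ_unique by blast
    moreover have "rect_integral U' S T = (rect_integral U S T + rect_integral U T S) / 2"
    proof -
      have "rect_integral U' S T = (LINT z|square_measure01. (indicator (S \<times> T) z * U z
          + indicator (S \<times> T) z * (\<lambda>(x, y). U (y, x)) z) / 2)"
        unfolding U'_eq rect_integral_square01[OF sub sub, OF ST] by (simp add: algebra_simps)
      also have "\<dots> = (rect_integral U S T + rect_integral (\<lambda>(x, y). U (y, x)) S T) / 2"
        using bounded_kernels_integrable_indicator[OF Ub Times_in_square01[OF ST]]
          bounded_kernels_integrable_indicator[OF Usb Times_in_square01[OF ST]]
        by (simp add: rect_integral_square01[OF sub sub, OF ST])
      finally show ?thesis using rect_integral_swap[OF Ub ST] by simp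
    qed
    ultimately show ?thesis using lim[OF ST] by simp
  qed
  ultimately show ?thesis by blast
qed

text \<open>The geometric steps bound the change of each rectangle integral from stage n onwards by
  \<open>2 * (1 / 2) ^ n\<close>, uniformly over rectangles, so the bound survives the passage to
  the weak limit. The factor \<open>2 ^ k\<close> counts the components.\<close>

lemma cut_norm_limit:
  assumes V: "\<And>n. V n \<in> graphon_systems k"
    and step: "\<And>n. cut_norm k (\<lambda>I z. V n I z - V (Suc n) I z) \<le> (1 / 2) ^ n"
  shows "\<exists>U\<in>graphon_systems k. \<forall>n. cut_norm k (\<lambda>I z. V n I z - U I z) \<le> 2 ^ k * (2 * (1 / 2) ^ n)"
proof -
  have Vb: "V n \<in> bounded_tuples k" for n by (rule graphon_systems_bounded[OF V])
  have VIb: "V n I \<in> bounded_kernels" if "I \<in> Pow {1..k}" for n I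
    using Vb[of n] that by (simp add: bounded_tuples_def)
  have diff1: "\<bar>rect_integral (V n I) S T - rect_integral (V (Suc n) I) S T\<bar> \<le> (1 / 2) ^ n"
    if ST: "S \<in> sets interval_measure01" "T \<in> sets interval_measure01" and I: "I \<in> Pow {1..k}" for n I S T
  proof -
    have "\<bar>rect_integral (\<lambda>z. V n I z - V (Suc n) I z) S T\<bar>
        \<le> (\<Sum>I\<in>Pow {1..k}. \<bar>rect_integral (\<lambda>z. V n I z - V (Suc n) I z) S T\<bar>)"
      using I by (intro member_le_sum) auto
    also have "\<dots> \<le> cut_norm k (\<lambda>I z. V n I z - V (Suc n) I z)"
      by (intro cut_norm_upper bounded_tuples_diff Vb ST)
    also have "\<dots> \<le> (1 / 2) ^ n" by (rule step)
    finally show ?thesis using rect_integral_diff[OF ST VIb[OF I] VIb[OF I]] by simp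
  qed
  have diff: "\<bar>rect_integral (V n I) S T - rect_integral (V (n + m) I) S T\<bar> \<le> 2 * (1 / 2) ^ n"
    if ST: "S \<in> sets interval_measure01" "T \<in> sets interval_measure01" and I: "I \<in> Pow {1..k}" for n m I S T
  proof -
    \<comment> \<open>The exact partial sum of the geometric series makes the induction close; the
      weaker bound without the subtracted term would not.\<close>
    have "\<bar>rect_integral (V n I) S T - rect_integral (V (n + m) I) S T\<bar> \<le> 2 * (1 / 2) ^ n - 2 * (1 / 2) ^ (n + m)"
    proof (induction m)
      case (Suc m)
      show ?case using diff1[OF ST I, of "n + m"] Suc by simp
    qed simp
    then show ?thesis by (smt (verit) zero_le_power divide_nonneg_nonneg)
  qed
  have Cauchy: "convergent (\<lambda>n. rect_integral (V n I) S T)"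
    if ST: "S \<in> sets interval_measure01" "T \<in> sets interval_measure01" and I: "I \<in> Pow {1..k}" for I S T
  proof (rule Cauchy_convergent, rule metric_CauchyI)
    fix e :: real assume "0 < e"
    then obtain N where N: "(1 / 2 :: real) ^ N < e / 4"
      using real_arch_pow_inv[of "e / 4" "1 / 2"] by auto
    have *: "\<bar>rect_integral (V N I) S T - rect_integral (V m I) S T\<bar> < e / 2" if "m \<ge> N" for m
      using diff[OF ST I, of N "m - N"] that N by simp
    show "\<exists>N. \<forall>m\<ge>N. \<forall>n\<ge>N. dist (rect_integral (V m I) S T) (rect_integral (V n I) S T) < e"
    proof (intro exI allI impI)
      fix m n assume "N \<le> m" "N \<le> n"
      then show "dist (rect_integral (V m I) S T) (rect_integral (V n I) S T) < e"
        using *[of m] *[of n] unfolding dist_real_def by linarith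
    qed
  qed
  define good where "good I u \<longleftrightarrow> u \<in> graphons \<and> (I = {} \<longrightarrow> (\<forall>z\<in>unit_square. u z = 1)) \<and>
     (\<forall>S\<in>sets interval_measure01. \<forall>T\<in>sets interval_measure01.
      (\<lambda>n. rect_integral (V n I) S T) \<longlonglongrightarrow> rect_integral u S T)" for I u
  \<comment> \<open>The component at the empty set must be 1 everywhere on the square, whereas a
    weak limit would only be 1 almost everywhere. It is therefore taken to be the constant.\<close>
  have "\<exists>u. good I u" if I: "I \<in> Pow {1..k}" for I
  proof (cases "I = {}")
    case True
    have "rect_integral (V n I) S T = rect_integral (\<lambda>_. 1) S T"
      if "S \<in> sets interval_measure01" "T \<in> sets interval_measure01" for n S T
    proof (rule rect_integral_cong)
      show "V n I z = 1" if "z \<in> unit_square" for z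
        using that V[of n] True unfolding graphon_systems_def by blast
    qed (use that in \<open>simp_all add: sets_interval01\<close>)
    moreover have "(\<lambda>_. 1) \<in> graphons" by (simp add: graphons_def)
    ultimately have "good I (\<lambda>_. 1)" unfolding good_def by simp
    then show ?thesis by blast
  next
    case False
    have "V n I \<in> graphons" for n using V[of n] I by (simp add: graphon_systems_def)
    from weak_limit_graphon[of "\<lambda>n. V n I", OF this Cauchy[OF _ _ I]] show ?thesis
      using False unfolding good_def by blast
  qed
  then have "\<forall>I\<in>Pow {1..k}. \<exists>u. good I u" by blast
  then obtain U where "\<forall>I\<in>Pow {1..k}. good I (U I)" by (rule bchoice[THEN exE])
  then have U: "\<And>I. I \<in> Pow {1..k} \<Longrightarrow> U I \<in> graphons"
    "\<And>I. I \<in> Pow {1..k} \<Longrightarrow> I = {} \<Longrightarrow> \<forall>z\<in>unit_square. U I z = 1"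
    "\<And>I S T. I \<in> Pow {1..k} \<Longrightarrow> S\<in>sets interval_measure01 \<Longrightarrow> T\<in>sets interval_measure01 \<Longrightarrow>
      (\<lambda>n. rect_integral (V n I) S T) \<longlonglongrightarrow> rect_integral (U I) S T"
    unfolding good_def by blast+
  have Us: "U \<in> graphon_systems k"
    using U(1) U(2)[of "{}"] by (simp add: graphon_systems_def)
  moreover have "cut_norm k (\<lambda>I z. V n I z - U I z) \<le> 2 ^ k * (2 * (1 / 2) ^ n)" for n
  proof (rule cut_norm_least)
    fix S T assume ST: "S \<in> sets interval_measure01" "T \<in> sets interval_measure01"
    have "\<bar>rect_integral (\<lambda>z. V n I z - U I z) S T\<bar> \<le> 2 * (1 / 2) ^ n" if I: "I \<in> Pow {1..k}" for I
    proof -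
      have "(\<lambda>m. rect_integral (V (m + n) I) S T) \<longlonglongrightarrow> rect_integral (U I) S T"
        using U(3)[OF I ST] by (rule LIMSEQ_ignore_initial_segment)
      then have "(\<lambda>m. \<bar>rect_integral (V n I) S T - rect_integral (V (m + n) I) S T\<bar>)
          \<longlonglongrightarrow> \<bar>rect_integral (V n I) S T - rect_integral (U I) S T\<bar>"
        by (intro tendsto_intros)
      then have "\<bar>rect_integral (V n I) S T - rect_integral (U I) S T\<bar> \<le> 2 * (1 / 2) ^ n"
        using diff[OF ST I, of n] by (intro LIMSEQ_le_const2) (auto simp: add.commute)
      then show ?thesis
        using rect_integral_diff[OF ST VIb[OF I] graphons_bounded_kernels[OF U(1)[OF I]]] by simp
    qed
    then have "(\<Sum>I\<in>Pow {1..k}. \<bar>rect_integral (\<lambda>z. V n I z - U I z) S T\<bar>)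
        \<le> real (card (Pow {1..k})) * (2 * (1 / 2) ^ n)"
      by (rule sum_bounded_above)
    then show "(\<Sum>I\<in>Pow {1..k}. \<bar>rect_integral (\<lambda>z. V n I z - U I z) S T\<bar>)
        \<le> 2 ^ k * (2 * (1 / 2) ^ n)"
      by (simp add: card_Pow)
  qed
  ultimately show ?thesis by blast
qed

section \<open>Completeness of the cut distance\<close>

lemma relabel_graphon_systems:
  assumes "\<phi> \<in> invertible_measure_preserving" "W \<in> graphon_systems k"
  shows "relabel W \<phi> \<in> graphon_systems k"
proof -
  have sq: "(\<phi> x, \<phi> y) \<in> unit_square" if "x \<in> unit_interval" "y \<in> unit_interval" for x y
    using that imp_in[OF assms(1)] by blast
  have "relabel W \<phi> I \<in> graphons" if I: "I \<in> Pow {1..k}" for I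
  proof -
    have W: "W I \<in> graphons" using assms(2) I by (simp add: graphon_systems_def)
    have "relabel W \<phi> I \<in> borel_measurable square_measure01"
      using bounded_kernels_measurable[OF bounded_kernels_imp[OF assms(1) graphons_bounded_kernels[OF W]]]
      by (simp add: relabel_def)
    moreover have "0 \<le> W I (\<phi> x, \<phi> y)" "W I (\<phi> x, \<phi> y) \<le> 1" "W I (\<phi> x, \<phi> y) = W I (\<phi> y, \<phi> x)"
      if "x \<in> unit_interval" "y \<in> unit_interval" for x y
      using W sq[OF that] unfolding graphons_def by blast+
    ultimately show ?thesis by (simp add: graphons_def relabel_def)
  qed
  moreover have "relabel W \<phi> {} z = 1" if "z \<in> unit_square" for z
    using assms(2) that sq unfolding graphon_systems_def relabel_def by auto
  ultimately show ?thesis by (simp add: graphon_systems_def)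
qed

text \<open>Composing near-optimal relabellings turns the sequence into one that is Cauchy for the cut norm itself.\<close>

lemma cut_distance_complete:
  assumes W: "\<And>n. W n \<in> graphon_systems k"
    and step: "\<And>n. cut_distance k (W n) (W (Suc n)) < (1 / 2) ^ n"
  shows "\<exists>U\<in>graphon_systems k. (\<lambda>n. cut_distance k (W n) U) \<longlonglongrightarrow> 0"
proof -
  have "\<exists>\<phi>\<in>invertible_measure_preserving. cut_norm k (\<lambda>I z. W n I z - relabel (W (Suc n)) \<phi> I z) < (1 / 2) ^ n" for n
    using cut_distance_less_obtain[OF step[of n]] by blast
  then have "\<forall>n. \<exists>\<phi>. \<phi> \<in> invertible_measure_preserving \<and>
      cut_norm k (\<lambda>I z. W n I z - relabel (W (Suc n)) \<phi> I z) < (1 / 2) ^ n" by blast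
  then obtain \<phi> where "\<forall>n. \<phi> n \<in> invertible_measure_preserving \<and>
      cut_norm k (\<lambda>I z. W n I z - relabel (W (Suc n)) (\<phi> n) I z) < (1 / 2) ^ n"
    by (rule choice[THEN exE])
  then have \<phi>: "\<And>n. \<phi> n \<in> invertible_measure_preserving"
    "\<And>n. cut_norm k (\<lambda>I z. W n I z - relabel (W (Suc n)) (\<phi> n) I z) < (1 / 2) ^ n"
    by blast+
  \<comment> \<open>The map \<open>\<psi> n\<close> is the composition of the first n relabellings,
    \<open>\<phi> 0\<close> acting first. Since \<open>\<psi> n\<close> is common to stages n and n
    + 1, invariance of the cut norm reduces the distance of the relabelled systems to the original
    step.\<close>
  define \<psi> where "\<psi> n = rec_nat (\<lambda>x. x) (\<lambda>n f x. \<phi> n (f x)) n" for n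
  have \<psi>_Suc: "\<psi> (Suc n) = (\<lambda>x. \<phi> n (\<psi> n x))" for n by (simp add: \<psi>_def)
  have \<psi>: "\<psi> n \<in> invertible_measure_preserving" for n
  proof (induction n)
    case 0
    show ?case using imp_id by (simp add: \<psi>_def)
  next
    case (Suc n)
    show ?case unfolding \<psi>_Suc by (rule imp_comp[OF Suc \<phi>(1)])
  qed
  have Wb: "W n \<in> bounded_tuples k" for n by (rule graphon_systems_bounded[OF W])
  define V where "V n = relabel (W n) (\<psi> n)" for n
  have V: "V n \<in> graphon_systems k" for n
    unfolding V_def by (rule relabel_graphon_systems[OF \<psi> W])
  have "cut_norm k (\<lambda>I z. V n I z - V (Suc n) I z) \<le> (1 / 2) ^ n" for n
  proof -
    have "cut_norm k (\<lambda>I z. V n I z - V (Suc n) I z)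
        = cut_norm k (relabel (\<lambda>I z. W n I z - relabel (W (Suc n)) (\<phi> n) I z) (\<psi> n))"
      by (simp add: V_def \<psi>_Suc relabel_diff relabel_relabel)
    also have "\<dots> \<le> cut_norm k (\<lambda>I z. W n I z - relabel (W (Suc n)) (\<phi> n) I z)"
      by (intro cut_norm_relabel_le \<psi> bounded_tuples_diff bounded_tuples_relabel Wb \<phi>)
    finally show ?thesis using \<phi>(2)[of n] by simp
  qed
  from cut_norm_limit[OF V this] obtain U where U: "U \<in> graphon_systems k"
    "\<And>n. cut_norm k (\<lambda>I z. V n I z - U I z) \<le> 2 ^ k * (2 * (1 / 2) ^ n)"
    by blast
  have Ub: "U \<in> bounded_tuples k" by (rule graphon_systems_bounded[OF U(1)])
  have le: "cut_distance k (W n) U \<le> 2 ^ k * (2 * (1 / 2) ^ n)" for n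
  proof -
    \<comment> \<open>The definition relabels the second argument, but here it is \<open>W n\<close>
      that carries the relabelling, so the arguments are exchanged.\<close>
    have "cut_distance k (W n) U = cut_distance k U (W n)"
      by (rule cut_distance_commute[OF Wb Ub])
    also have "\<dots> \<le> cut_norm k (\<lambda>I z. U I z - V n I z)"
      unfolding V_def by (rule cut_distance_le[OF Ub Wb \<psi>])
    also have "\<dots> \<le> 2 ^ k * (2 * (1 / 2) ^ n)"
      using U(2)[of n] cut_norm_minus[of k U "V n"] by simp
    finally show ?thesis .
  qed
  have "(\<lambda>n. 2 ^ k * (2 * (1 / 2) ^ n) :: real) \<longlonglongrightarrow> 2 ^ k * (2 * 0)"
    by (intro tendsto_mult tendsto_const LIMSEQ_realpow_zero) auto
  then have *: "(\<lambda>n. 2 ^ k * (2 * (1 / 2) ^ n) :: real) \<longlonglongrightarrow> 0" by simp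
  have "(\<lambda>n. cut_distance k (W n) U) \<longlonglongrightarrow> 0"
    by (rule tendsto_sandwich[OF _ _ tendsto_const *])
      (use le cut_distance_nonneg[OF Wb Ub] in \<open>simp_all add: always_eventually\<close>)
  then show ?thesis using U(1) by blast
qed

section \<open>Dyadic sets and weak regularity\<close>

abbreviation sym_difference :: "'a set \<Rightarrow> 'a set \<Rightarrow> 'a set" where
  "sym_difference A B \<equiv> (A - B) \<union> (B - A)"

text \<open>Unions of half-open dyadic intervals of length \<open>1 / 2 ^ n\<close>, encoded as
  invariance under the floor of \<open>2 ^ n * x\<close>. The endpoint 1 forms a cell of its
  own.\<close>

definition dyadic_set :: "nat \<Rightarrow> real set \<Rightarrow> bool" where
  "dyadic_set n D \<longleftrightarrow> D \<subseteq> unit_interval \<and>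
     (\<forall>x\<in>unit_interval. \<forall>y\<in>unit_interval. \<lfloor>2 ^ n * x\<rfloor> = \<lfloor>2 ^ n * y\<rfloor> \<longrightarrow> (x \<in> D \<longleftrightarrow> y \<in> D))"

lemma dyadic_set_subset: "dyadic_set n D \<Longrightarrow> D \<subseteq> unit_interval"
  by (simp add: dyadic_set_def)

text \<open>The coarser floor is an integer quotient of the finer one, so the finer cell determines
  the coarser.\<close>

lemma dyadic_set_mono:
  assumes "dyadic_set n D" "n \<le> m"
  shows "dyadic_set m D"
proof -
  have "\<lfloor>2 ^ n * x\<rfloor> = \<lfloor>2 ^ m * x\<rfloor> div 2 ^ (m - n)" for x :: real
  proof -
    have "\<lfloor>2 ^ n * x\<rfloor> = \<lfloor>2 ^ m * x / of_int (2 ^ (m - n))\<rfloor>"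
    proof -
      have "(2::real) ^ m = 2 ^ n * 2 ^ (m - n)" using assms(2) by (simp flip: power_add)
      then show ?thesis by simp
    qed
    then show ?thesis by (simp only: floor_divide_real_eq_div zero_le_power zero_le_numeral)
  qed
  then have "\<lfloor>2 ^ m * x\<rfloor> = \<lfloor>2 ^ m * y\<rfloor> \<Longrightarrow> \<lfloor>2 ^ n * x\<rfloor> = \<lfloor>2 ^ n * y\<rfloor>" for x y :: real
    by metis
  then show ?thesis using assms(1) unfolding dyadic_set_def by blast
qed

text \<open>Within the interval, the set is the preimage of a set of integers under the Borel floor
  map.\<close>

lemma dyadic_set_measurable:
  assumes "dyadic_set n D"
  shows "D \<in> sets interval_measure01"
proof -
  define J where "J = (\<lambda>x. \<lfloor>2 ^ n * x\<rfloor>) ` D"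
  have "D = ((\<lambda>x. \<lfloor>2 ^ n * x\<rfloor>) -` J \<inter> space borel) \<inter> unit_interval"
  proof (intro set_eqI iffI)
    fix x assume "x \<in> D"
    then show "x \<in> ((\<lambda>x. \<lfloor>2 ^ n * x\<rfloor>) -` J \<inter> space borel) \<inter> unit_interval"
      using dyadic_set_subset[OF assms] by (auto simp: J_def)
  next
    fix x assume x: "x \<in> ((\<lambda>x. \<lfloor>2 ^ n * x\<rfloor>) -` J \<inter> space borel) \<inter> unit_interval"
    then obtain y where "y \<in> D" "\<lfloor>2 ^ n * x\<rfloor> = \<lfloor>2 ^ n * y\<rfloor>" unfolding J_def by blast
    moreover have "y \<in> unit_interval" using \<open>y \<in> D\<close> dyadic_set_subset[OF assms] by blast
    moreover have "x \<in> unit_interval" using x by (rule IntD2)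
    moreover have "\<forall>x\<in>unit_interval. \<forall>y\<in>unit_interval. \<lfloor>2 ^ n * x\<rfloor> = \<lfloor>2 ^ n * y\<rfloor> \<longrightarrow> (x \<in> D \<longleftrightarrow> y \<in> D)"
      using assms unfolding dyadic_set_def by (rule conjunct2)
    ultimately show "x \<in> D" by metis
  qed
  moreover have "(\<lambda>x::real. \<lfloor>2 ^ n * x\<rfloor>) -` J \<inter> space borel \<in> sets borel"
    by (rule measurable_sets[of _ borel "count_space UNIV"]) auto
  ultimately have "D \<in> sets borel" by (metis atLeastAtMost_borel sets.Int)
  then show ?thesis using dyadic_set_subset[OF assms] by (simp add: sets_interval01 sets_completionI_sets)
qed

lemma dyadic_set_Diff: "dyadic_set n D \<Longrightarrow> dyadic_set n (unit_interval - D)"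
  unfolding dyadic_set_def by blast

lemma dyadic_set_empty: "dyadic_set n {}"
  unfolding dyadic_set_def by blast

lemma dyadic_set_UN: "(\<And>i. i \<in> X \<Longrightarrow> dyadic_set n (D i)) \<Longrightarrow> dyadic_set n (\<Union>i\<in>X. D i)"
  unfolding dyadic_set_def by blast

text \<open>The sets approximable in measure by dyadic sets contain the half-lines and form a
  sigma-algebra. For a countable union, the tail beyond finitely many members costs
  \<open>e / 2\<close>, and approximating these members costs the other half.\<close>

lemma dyadic_approx_borel:
  assumes "A \<in> sigma_sets UNIV (range atMost)" "e > 0"
  shows "\<exists>n D. dyadic_set n D \<and> measure interval_measure01 (sym_difference (A \<inter> unit_interval) D) < e"
  using assms
proof (induction A arbitrary: e rule: sigma_sets.induct)
  case (Basic A)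
  then obtain a :: real where a: "A = {..a}" by auto
  obtain n where n: "(1 / 2) ^ n < e" using real_arch_pow_inv[of e "1/2"] Basic by auto
  \<comment> \<open>Rounding the endpoint up to the end of its cell errs only inside that cell,
    whose length is \<open>(1 / 2) ^ n\<close>.\<close>
  define D where "D = {x \<in> unit_interval. \<lfloor>2 ^ n * x\<rfloor> \<le> \<lfloor>2 ^ n * a\<rfloor>}"
  have D: "dyadic_set n D" unfolding dyadic_set_def D_def by auto
  have sub: "sym_difference (A \<inter> unit_interval) D \<subseteq> {a..a + (1 / 2) ^ n} \<inter> unit_interval"
  proof
    fix x assume x: "x \<in> sym_difference (A \<inter> unit_interval) D"
    have "\<lfloor>2 ^ n * x\<rfloor> \<le> \<lfloor>2 ^ n * a\<rfloor>" if "x \<le> a" using that by (intro floor_mono) simp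
    with x have 1: "a < x" "\<lfloor>2 ^ n * x\<rfloor> \<le> \<lfloor>2 ^ n * a\<rfloor>" "x \<in> unit_interval"
      by (auto simp: D_def a)
    then have "2 ^ n * x < 2 ^ n * a + 1" by linarith
    then have "x < a + (1 / 2) ^ n" by (simp add: field_simps power_divide)
    then show "x \<in> {a..a + (1 / 2) ^ n} \<inter> unit_interval" using 1 by auto
  qed
  have "measure interval_measure01 (sym_difference (A \<inter> unit_interval) D)
      \<le> measure interval_measure01 ({a..a + (1 / 2) ^ n} \<inter> unit_interval)"
    by (rule int01.finite_measure_mono[OF sub]) (simp add: sets_interval01)
  also have "\<dots> = measure lebesgue ({a..a + (1 / 2) ^ n} \<inter> unit_interval)"
    by (intro measure_restrict_space) auto
  also have "\<dots> \<le> measure lebesgue {a..a + (1 / 2) ^ n}"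
    by (intro measure_mono_fmeasurable) auto
  also have "\<dots> = (1 / 2) ^ n" by simp
  finally show ?case using n D by fastforce
next
  case Empty
  then show ?case using dyadic_set_empty[of 0] by (intro exI[of _ 0] exI[of _ "{}"]) auto
next
  case (Compl A)
  then obtain n D where D: "dyadic_set n D" "measure interval_measure01 (sym_difference (A \<inter> unit_interval) D) < e"
    by blast
  have "sym_difference ((UNIV - A) \<inter> unit_interval) (unit_interval - D) = sym_difference (A \<inter> unit_interval) D"
    using dyadic_set_subset[OF D(1)] by blast
  then show ?case using dyadic_set_Diff[OF D(1)] D(2) by metis
next
  case (Union A)
  have Am: "A i \<inter> unit_interval \<in> sets interval_measure01" for i
  proof -
    have "A i \<in> sets borel"
      using Union.hyps[of i] by (subst borel_eq_atMost) (simp add: sets_measure_of)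
    then show ?thesis by (simp add: sets_interval01 sets_completionI_sets)
  qed
  have "incseq (\<lambda>N. \<Union>i<N. A i \<inter> unit_interval)"
    by (force simp: incseq_def)
  then have "(\<lambda>N. measure interval_measure01 (\<Union>i<N. A i \<inter> unit_interval))
      \<longlonglongrightarrow> measure interval_measure01 (\<Union>N. \<Union>i<N. A i \<inter> unit_interval)"
    using Am by (intro int01.finite_Lim_measure_incseq image_subsetI sets.finite_UN) auto
  also have "(\<Union>N. \<Union>i<N. A i \<inter> unit_interval) = (\<Union>i. A i \<inter> unit_interval)" by blast
  finally have "eventually (\<lambda>N. measure interval_measure01 (\<Union>i. A i \<inter> unit_interval) - e / 2
      < measure interval_measure01 (\<Union>i<N. A i \<inter> unit_interval)) sequentially"
    by (rule order_tendstoD) (use Union.prems in simp)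
  then obtain N where N: "measure interval_measure01 (\<Union>i. A i \<inter> unit_interval) - e / 2
      < measure interval_measure01 (\<Union>i<N. A i \<inter> unit_interval)"
    by (auto simp: eventually_sequentially)
  \<comment> \<open>Dividing by \<open>Suc N\<close> keeps the tolerance positive even when
    \<open>N\<close> is 0; the \<open>N\<close> errors still add up to at most
    \<open>e / 2\<close>.\<close>
  have "\<exists>n D. dyadic_set n D \<and> measure interval_measure01 (sym_difference (A i \<inter> unit_interval) D) < e / (2 * Suc N)" for i
    using Union.prems by (intro Union.IH) auto
  then obtain n D where D: "\<And>i. dyadic_set (n i) (D i)"
    "\<And>i. measure interval_measure01 (sym_difference (A i \<inter> unit_interval) (D i)) < e / (2 * Suc N)"
    by metis
  define m where "m = Max (n ` {..<N})"
  have mD: "dyadic_set m (\<Union>i<N. D i)"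
    by (intro dyadic_set_UN dyadic_set_mono[OF D(1)]) (auto simp: m_def)
  have Dm: "D i \<in> sets interval_measure01" for i by (rule dyadic_set_measurable[OF D(1)])
  let ?R = "(\<Union>i. A i \<inter> unit_interval) - (\<Union>i<N. A i \<inter> unit_interval)"
  let ?E = "\<lambda>i. sym_difference (A i \<inter> unit_interval) (D i)"
  have "measure interval_measure01 (sym_difference ((\<Union>i. A i) \<inter> unit_interval) (\<Union>i<N. D i))
      \<le> measure interval_measure01 (?R \<union> (\<Union>i<N. ?E i))"
    using Am Dm by (intro int01.finite_measure_mono sets.Un sets.Diff sets.finite_UN sets.countable_UN) blast+
  also have "\<dots> \<le> measure interval_measure01 ?R + measure interval_measure01 (\<Union>i<N. ?E i)"
    using Am Dm by (intro measure_Un_le sets.Un sets.Diff sets.finite_UN sets.countable_UN) blast+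
  also have "measure interval_measure01 ?R < e / 2"
  proof -
    have "measure interval_measure01 ?R = measure interval_measure01 (\<Union>i. A i \<inter> unit_interval)
        - measure interval_measure01 (\<Union>i<N. A i \<inter> unit_interval)"
      using Am by (intro int01.finite_measure_Diff sets.finite_UN sets.countable_UN) blast+
    then show ?thesis using N by linarith
  qed
  also have "measure interval_measure01 (\<Union>i<N. ?E i) \<le> (\<Sum>i<N. measure interval_measure01 (?E i))"
    using Am Dm by (intro measure_UNION_le) auto
  also have "\<dots> \<le> (\<Sum>i<N. e / (2 * Suc N))"
    using D(2) by (intro sum_mono less_imp_le)
  also have "\<dots> \<le> e / 2" using Union.prems by (simp add: field_simps)
  finally show ?case using mD by auto
qed

lemma dyadic_approx:
  assumes "A \<in> sets interval_measure01" "e > 0"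
  shows "\<exists>n D. dyadic_set n D \<and> measure interval_measure01 (sym_difference A D) < e"
proof -
  have A: "A \<in> sets lebesgue" "A \<subseteq> unit_interval" using assms by (simp_all add: sets_interval01)
  obtain S N N' where S: "A = S \<union> N" "N \<subseteq> N'" "N' \<in> null_sets lborel" "S \<in> sets lborel"
    using sets_completionE[OF A(1)] by metis
  have "S \<in> sigma_sets UNIV (range atMost)"
    using S(4) by (subst (asm) sets_lborel, subst (asm) borel_eq_atMost) (simp add: sets_measure_of)
  from dyadic_approx_borel[OF this assms(2)] obtain n D where
    D: "dyadic_set n D" "measure interval_measure01 (sym_difference (S \<inter> unit_interval) D) < e" by blast
  note Dm = dyadic_set_measurable[OF D(1)]
  have Sm: "S \<inter> unit_interval \<in> sets interval_measure01"
    using S(4) by (simp add: sets_interval01 sets_completionI_sets)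
  have "N \<in> null_sets lebesgue" using S null_sets_completion_iff2 by blast
  then have N: "N \<in> null_sets interval_measure01"
    using S(1) A by (auto simp: null_sets_def sets_interval01 emeasure_restrict_space)
  have "measure interval_measure01 (sym_difference A D)
     \<le> measure interval_measure01 (sym_difference (S \<inter> unit_interval) D \<union> N)"
    using S(1) A(2) Sm Dm N
    by (intro int01.finite_measure_mono sets.Un sets.Diff) blast+
  also have "\<dots> = measure interval_measure01 (sym_difference (S \<inter> unit_interval) D)"
    using Sm Dm N by (intro measure_Un_null_set) auto
  finally show ?thesis using D by fastforce
qed

text \<open>Such a cross of two strips contains every point at which replacing the sides of a
  rectangle, or relabelling off a small set of coordinates, can matter.\<close>

lemma measure_strips_le:
  assumes "A \<in> sets interval_measure01" "B \<in> sets interval_measure01"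
  shows "A \<times> unit_interval \<union> unit_interval \<times> B \<in> sets square_measure01"
    and "measure square_measure01 (A \<times> unit_interval \<union> unit_interval \<times> B)
      \<le> measure interval_measure01 A + measure interval_measure01 B"
proof -
  have I: "unit_interval \<in> sets interval_measure01" by (simp add: sets_interval01)
  have "measure square_measure01 (X \<times> Y) = measure interval_measure01 X * measure interval_measure01 Y"
    if "X \<in> sets interval_measure01" "Y \<in> sets interval_measure01" for X Y
  proof -
    have *: "X \<times> Y \<subseteq> unit_square" "X \<subseteq> unit_interval" "Y \<subseteq> unit_interval" "X \<in> sets lebesgue" "Y \<in> sets lebesgue"
      using that by (auto simp: sets_lebesgue_on_iff)
    then show ?thesis
      unfolding measure_def by (simp add: emeasure_restrict_space emeasure_lebesgue_Times enn2real_mult)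
  qed
  note rect = this
  have one: "measure interval_measure01 unit_interval = 1"
    by (simp add: measure_def emeasure_restrict_space)
  show "A \<times> unit_interval \<union> unit_interval \<times> B \<in> sets square_measure01"
    using assms I by (intro sets.Un Times_in_square01)
  show "measure square_measure01 (A \<times> unit_interval \<union> unit_interval \<times> B)
      \<le> measure interval_measure01 A + measure interval_measure01 B"
    using measure_Un_le[OF Times_in_square01[OF assms(1) I] Times_in_square01[OF I assms(2)]]
      rect[OF assms(1) I] rect[OF I assms(2)] by (simp add: one)
qed

text \<open>The indicators of the two rectangles differ only on the cross over the symmetric
  differences of the sides.\<close>

lemma rect_integral_perturb:
  assumes f: "f \<in> bounded_kernels" "\<And>z. z \<in> unit_square \<Longrightarrow> \<bar>f z\<bar> \<le> C"
    and S: "S \<in> sets interval_measure01" "S' \<in> sets interval_measure01"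
    and T: "T \<in> sets interval_measure01" "T' \<in> sets interval_measure01"
  shows "\<bar>rect_integral f S T - rect_integral f S' T'\<bar>
    \<le> C * (measure interval_measure01 (sym_difference S S') + measure interval_measure01 (sym_difference T T'))"
proof -
  let ?E = "sym_difference S S' \<times> unit_interval \<union> unit_interval \<times> sym_difference T T'"
  have C: "0 \<le> C" using f(2)[of "(0, 0)"] by auto
  have D: "sym_difference S S' \<in> sets interval_measure01" "sym_difference T T' \<in> sets interval_measure01"
    using S T by auto
  have sub: "S \<subseteq> unit_interval" "S' \<subseteq> unit_interval" "T \<subseteq> unit_interval" "T' \<subseteq> unit_interval"
    using S T by (simp_all add: sets_interval01)
  have k: "(\<lambda>z. indicator (S \<times> T) z * f z) \<in> bounded_kernels" "(\<lambda>z. indicator (S' \<times> T') z * f z) \<in> bounded_kernels"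
    using bounded_kernels_mult[OF bounded_kernels_indicator[OF Times_in_square01, of S T 1] f(1)]
      bounded_kernels_mult[OF bounded_kernels_indicator[OF Times_in_square01, of S' T' 1] f(1)] S T by simp_all
  have "rect_integral f S T - rect_integral f S' T'
      = (LINT z|square_measure01. indicator (S \<times> T) z * f z - indicator (S' \<times> T') z * f z)"
    using sub k by (simp add: rect_integral_square01 bounded_kernels_integrable)
  also have "\<bar>\<dots>\<bar> \<le> C * measure square_measure01 ?E"
  proof (rule abs_integral_square01_le[OF bounded_kernels_diff[OF k]])
    fix z assume "z \<in> unit_square"
    then obtain x y where z: "z = (x, y)" "x \<in> unit_interval" "y \<in> unit_interval" by blast
    from f(2)[OF \<open>z \<in> unit_square\<close>]
    show "\<bar>indicator (S \<times> T) z * f z - indicator (S' \<times> T') z * f z\<bar> \<le> C * indicator ?E z"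
      using z(2,3) C unfolding z(1) indicator_def by auto
  qed (rule measure_strips_le(1)[OF D])
  also have "\<dots> \<le> C * (measure interval_measure01 (sym_difference S S') + measure interval_measure01 (sym_difference T T'))"
    by (rule mult_left_mono[OF measure_strips_le(2)[OF D] C])
  finally show ?thesis .
qed

text \<open>The strict inequality leaves a positive gap, and dyadic sides close enough to
  \<open>S\<close> and \<open>T\<close> lose less than this gap. A witness for a large cut norm can
  thus always be taken dyadic.\<close>

lemma rect_integral_dyadic:
  assumes f: "f \<in> bounded_kernels"
    and ST: "S \<in> sets interval_measure01" "T \<in> sets interval_measure01" "e < \<bar>rect_integral f S T\<bar>"
  obtains n S' T' where "dyadic_set n S'" "dyadic_set n T'" "e < \<bar>rect_integral f S' T'\<bar>"
proof -
  obtain C where C: "0 \<le> C" "\<And>z. z \<in> unit_square \<Longrightarrow> \<bar>f z\<bar> \<le> C" using bounded_kernels_bound[OF f] by metis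
  \<comment> \<open>Chosen so that \<open>(C + 1) * (2 * d)\<close> is exactly the gap;
    \<open>C + 1\<close> avoids division by zero and makes the loss strictly smaller than the
    gap.\<close>
  define d where "d = (\<bar>rect_integral f S T\<bar> - e) / (2 * (C + 1))"
  have d: "d > 0" using C ST by (simp add: d_def)
  obtain n D where D: "dyadic_set n D" "measure interval_measure01 (sym_difference S D) < d"
    using dyadic_approx[OF ST(1) d] by blast
  obtain m E where E: "dyadic_set m E" "measure interval_measure01 (sym_difference T E) < d"
    using dyadic_approx[OF ST(2) d] by blast
  have "\<bar>rect_integral f S T - rect_integral f D E\<bar>
    \<le> C * (measure interval_measure01 (sym_difference S D) + measure interval_measure01 (sym_difference T E))"
    by (intro rect_integral_perturb f C ST dyadic_set_measurable[OF D(1)] dyadic_set_measurable[OF E(1)])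
  also have "\<dots> \<le> C * (2 * d)" using C(1) D(2) E(2) by (intro mult_left_mono) auto
  also have "\<dots> < (C + 1) * (2 * d)" using d by simp
  also have "\<dots> = \<bar>rect_integral f S T\<bar> - e" using C(1) by (simp add: d_def field_simps)
  finally have "e < \<bar>rect_integral f D E\<bar>" by linarith
  then show thesis
    using dyadic_set_mono[OF D(1), of "max n m"] dyadic_set_mono[OF E(1), of "max n m"] that by simp
qed

text \<open>Integer signs times one common size \<open>e\<close> give finitely many coefficient
  patterns. The sign 0 serves as padding, so that every approximation has the same number of
  terms.\<close>

definition step_kernel :: "real \<Rightarrow> nat \<Rightarrow> (nat \<Rightarrow> int) \<Rightarrow> (nat \<Rightarrow> real set) \<Rightarrow> (nat \<Rightarrow> real set) \<Rightarrow> real \<times> real \<Rightarrow> real" where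
  "step_kernel e m s S T z = (\<Sum>i<m. e * of_int (s i) * indicator (S i \<times> T i) z)"

lemma step_kernel_bounded:
  assumes "\<And>i. i < m \<Longrightarrow> S i \<in> sets interval_measure01" "\<And>i. i < m \<Longrightarrow> T i \<in> sets interval_measure01"
  shows "step_kernel e m s S T \<in> bounded_kernels"
proof -
  have "(\<lambda>z. \<Sum>i<m. (e * of_int (s i)) * indicator (S i \<times> T i) z) \<in> bounded_kernels"
    using assms by (intro bounded_kernels_sum bounded_kernels_indicator Times_in_square01) auto
  then show ?thesis by (simp add: step_kernel_def[abs_def])
qed

text \<open>Greedy energy decrement (Frieze--Kannan) with coefficients \<open>\<plusminus>e\<close>: subtracting \<open>\<plusminus>e\<close> on a
  rectangle that witnesses a cut norm above \<open>e\<close> lowers the squared \<open>L\<^sup>2\<close> norm by at least \<open>e\<^sup>2\<close>.\<close>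

lemma step_kernel_greedy:
  assumes f: "f \<in> bounded_kernels" "\<And>z. z \<in> unit_square \<Longrightarrow> \<bar>f z\<bar> \<le> 1" and e: "e > 0"
  shows "\<exists>n s S T. (\<forall>i<j. s i \<in> {-1, 0, 1} \<and> dyadic_set n (S i) \<and> dyadic_set n (T i)) \<and>
     ((\<forall>A\<in>sets interval_measure01. \<forall>B\<in>sets interval_measure01.
         \<bar>rect_integral (\<lambda>z. f z - step_kernel e j s S T z) A B\<bar> \<le> e) \<or>
      (LINT z|square_measure01. (f z - step_kernel e j s S T z)\<^sup>2) \<le> 1 - real j * e\<^sup>2)"
proof (induction j)
  case 0
  have "(\<lambda>z. f z * f z) \<in> bounded_kernels" using f(1) by (intro bounded_kernels_mult)
  moreover have "\<bar>f z * f z\<bar> \<le> 1 * indicator unit_square z" if "z \<in> unit_square" for z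
    using f(2)[OF that] that mult_le_one[of "\<bar>f z\<bar>" "\<bar>f z\<bar>"] by (simp add: abs_mult)
  moreover have "unit_square \<in> sets square_measure01" by (simp add: sets_square01)
  ultimately have "\<bar>LINT z|square_measure01. f z * f z\<bar> \<le> 1 * measure square_measure01 unit_square"
    by (rule abs_integral_square01_le)
  then show ?case by (simp add: step_kernel_def measure_square01 power2_eq_square)
next
  case (Suc j)
  then obtain n s S T where IH: "\<And>i. i < j \<Longrightarrow> s i \<in> {-1, 0, 1}" "\<And>i. i < j \<Longrightarrow> dyadic_set n (S i)"
    "\<And>i. i < j \<Longrightarrow> dyadic_set n (T i)"
    "(\<forall>A\<in>sets interval_measure01. \<forall>B\<in>sets interval_measure01.
         \<bar>rect_integral (\<lambda>z. f z - step_kernel e j s S T z) A B\<bar> \<le> e) \<or>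
      (LINT z|square_measure01. (f z - step_kernel e j s S T z)\<^sup>2) \<le> 1 - real j * e\<^sup>2"
    by blast
  define R where "R = (\<lambda>z. f z - step_kernel e j s S T z)"
  have R: "R \<in> bounded_kernels"
    unfolding R_def using IH by (intro bounded_kernels_diff f step_kernel_bounded) (blast intro: dyadic_set_measurable)+
  show ?case
  proof (cases "\<forall>A\<in>sets interval_measure01. \<forall>B\<in>sets interval_measure01. \<bar>rect_integral R A B\<bar> \<le> e")
    case True
    \<comment> \<open>An approximation that is already good is kept, and a term with sign 0 on the
      empty rectangle is appended.\<close>
    have "step_kernel e (Suc j) (s(j := 0)) (S(j := {})) (T(j := {})) = step_kernel e j s S T"
      by (simp add: step_kernel_def fun_eq_iff)
    then have "\<forall>A\<in>sets interval_measure01. \<forall>B\<in>sets interval_measure01.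
        \<bar>rect_integral (\<lambda>z. f z - step_kernel e (Suc j) (s(j := 0)) (S(j := {})) (T(j := {})) z) A B\<bar> \<le> e"
      using True by (simp add: R_def)
    moreover have "\<forall>i<Suc j. (s(j := 0)) i \<in> {-1, 0, 1} \<and> dyadic_set n ((S(j := {})) i) \<and> dyadic_set n ((T(j := {})) i)"
      using IH(1-3) dyadic_set_empty by (simp add: less_Suc_eq)
    ultimately show ?thesis by blast
  next
    case False
    then obtain A B where AB: "A \<in> sets interval_measure01" "B \<in> sets interval_measure01" "e < \<bar>rect_integral R A B\<bar>"
      by (meson not_le)
    obtain n' S' T' where S': "dyadic_set n' S'" "dyadic_set n' T'" "e < \<bar>rect_integral R S' T'\<bar>"
      by (rule rect_integral_dyadic[OF R AB])
    note m' = dyadic_set_measurable[OF S'(1)] dyadic_set_measurable[OF S'(2)]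
    have sub': "S' \<subseteq> unit_interval" "T' \<subseteq> unit_interval" using S'(1,2) by (simp_all add: dyadic_set_subset)
    \<comment> \<open>The sign of the witnessing integral, so that subtracting the new term lowers
      the energy.\<close>
    define c :: int where "c = (if rect_integral R S' T' > 0 then 1 else - 1)"
    have c: "c \<in> {-1, 0, 1}" "of_int c * of_int c = (1::real)"
      "of_int c * rect_integral R S' T' = \<bar>rect_integral R S' T'\<bar>" by (auto simp: c_def)
    let ?s = "s(j := c)" and ?S = "S(j := S')" and ?T = "T(j := T')" and ?I = "indicator (S' \<times> T') :: real \<times> real \<Rightarrow> real"
    have R'_eq: "f z - step_kernel e (Suc j) ?s ?S ?T z = R z - e * of_int c * ?I z" for z
      by (simp add: step_kernel_def R_def)
    have kI: "(\<lambda>z. a * ?I z) \<in> bounded_kernels" for a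
      by (intro bounded_kernels_indicator Times_in_square01 m')
    have iRR: "integrable square_measure01 (\<lambda>z. R z * R z)"
      by (intro bounded_kernels_integrable bounded_kernels_mult R)
    have iIR: "integrable square_measure01 (\<lambda>z. ?I z * R z)"
      using m' R by (intro bounded_kernels_integrable_indicator Times_in_square01)
    have iI: "integrable square_measure01 ?I"
      using bounded_kernels_integrable[OF kI[of 1]] by simp
    have not_small: "\<not> (\<forall>A\<in>sets interval_measure01. \<forall>B\<in>sets interval_measure01.
         \<bar>rect_integral (\<lambda>z. f z - step_kernel e j s S T z) A B\<bar> \<le> e)"
      using False by (simp add: R_def)
    have "(LINT z|square_measure01. (f z - step_kernel e (Suc j) ?s ?S ?T z)\<^sup>2)
        = (LINT z|square_measure01. R z * R z - (2 * e * of_int c) * (?I z * R z) + e\<^sup>2 * ?I z)"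
    proof (intro Bochner_Integration.integral_cong refl)
      fix z
      have "e * of_int c * (e * of_int c) = e\<^sup>2" using c(2) by (simp add: power2_eq_square)
      then have "(R z - e * of_int c * ?I z)\<^sup>2 = R z * R z - (2 * e * of_int c) * (?I z * R z) + e\<^sup>2 * ?I z"
        by (simp add: power2_eq_square algebra_simps split: split_indicator)
      then show "(f z - step_kernel e (Suc j) ?s ?S ?T z)\<^sup>2 = R z * R z - (2 * e * of_int c) * (?I z * R z) + e\<^sup>2 * ?I z"
        by (simp only: R'_eq)
    qed
    also have "\<dots> = (LINT z|square_measure01. R z * R z) - (2 * e * of_int c) * (LINT z|square_measure01. ?I z * R z)
        + e\<^sup>2 * (LINT z|square_measure01. ?I z)"
      using iRR iIR iI by simp
    also have "(LINT z|square_measure01. ?I z * R z) = rect_integral R S' T'"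
      by (simp add: rect_integral_square01[OF sub'])
    \<comment> \<open>The cross term gains more than \<open>2 * e * e\<close>, since the witness
      exceeds \<open>e\<close>; the square of the new term costs at most \<open>e\<^sup>2\<close>,
      since the rectangle has area at most 1.\<close>
    also have "(LINT z|square_measure01. R z * R z) - (2 * e * of_int c) * rect_integral R S' T'
        + e\<^sup>2 * (LINT z|square_measure01. ?I z) \<le> (1 - real j * e\<^sup>2) - 2 * e * e + e\<^sup>2 * 1"
    proof (intro add_mono diff_mono mult_left_mono)
      show "(LINT z|square_measure01. R z * R z) \<le> 1 - real j * e\<^sup>2"
        using IH(4) not_small by (simp add: R_def power2_eq_square)
      show "2 * e * e \<le> (2 * e * of_int c) * rect_integral R S' T'"
        using S'(3) e c(3) by (simp add: mult.assoc)
      have "\<bar>LINT z|square_measure01. 1 * ?I z\<bar> \<le> 1 * measure square_measure01 unit_square"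
        by (rule abs_integral_square01_le[OF kI]) (auto simp: sets_square01 split: split_indicator)
      then show "(LINT z|square_measure01. ?I z) \<le> 1" by (simp add: measure_square01)
    qed auto
    also have "\<dots> = 1 - real (Suc j) * e\<^sup>2" by (simp add: algebra_simps power2_eq_square)
    finally have "(LINT z|square_measure01. (f z - step_kernel e (Suc j) ?s ?S ?T z)\<^sup>2) \<le> 1 - real (Suc j) * e\<^sup>2" .
    moreover have "?s i \<in> {-1, 0, 1} \<and> dyadic_set (max n n') (?S i) \<and> dyadic_set (max n n') (?T i)"
      if "i < Suc j" for i
    proof (cases "i = j")
      case True
      then show ?thesis
        using c(1) dyadic_set_mono[OF S'(1), of "max n n'"] dyadic_set_mono[OF S'(2), of "max n n'"] by simp
    next
      case False
      with that have "i < j" by simp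
      then show ?thesis
        using IH(1) dyadic_set_mono[OF IH(2), of i "max n n'"] dyadic_set_mono[OF IH(3), of i "max n n'"] False
        by simp
    qed
    ultimately show ?thesis by blast
  qed
qed

text \<open>After \<open>m\<close> rounds the energy would be at most
  \<open>1 - real m * e\<^sup>2\<close>, which is negative. Only the alternative of a good
  approximation remains.\<close>

lemma weak_regularity:
  assumes f: "f \<in> bounded_kernels" "\<And>z. z \<in> unit_square \<Longrightarrow> \<bar>f z\<bar> \<le> 1" and e: "e > 0" and m: "1 < real m * e\<^sup>2"
  shows "\<exists>n s S T. (\<forall>i<m. s i \<in> {-1, 0, 1} \<and> dyadic_set n (S i) \<and> dyadic_set n (T i)) \<and>
     (\<forall>A\<in>sets interval_measure01. \<forall>B\<in>sets interval_measure01.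
         \<bar>rect_integral (\<lambda>z. f z - step_kernel e m s S T z) A B\<bar> \<le> e)"
proof -
  have neg: "\<not> (LINT z|square_measure01. (g z)\<^sup>2) \<le> 1 - real m * e\<^sup>2" for g
  proof -
    have "0 \<le> (LINT z|square_measure01. (g z)\<^sup>2)" by simp
    then show ?thesis using m by linarith
  qed
  from step_kernel_greedy[OF f e, of m] obtain n s S T where
    1: "\<forall>i<m. s i \<in> {-1, 0, 1} \<and> dyadic_set n (S i) \<and> dyadic_set n (T i)" and
    2: "(\<forall>A\<in>sets interval_measure01. \<forall>B\<in>sets interval_measure01.
         \<bar>rect_integral (\<lambda>z. f z - step_kernel e m s S T z) A B\<bar> \<le> e) \<or>
      (LINT z|square_measure01. (f z - step_kernel e m s S T z)\<^sup>2) \<le> 1 - real m * e\<^sup>2"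
    by blast
  have "\<forall>A\<in>sets interval_measure01. \<forall>B\<in>sets interval_measure01.
         \<bar>rect_integral (\<lambda>z. f z - step_kernel e m s S T z) A B\<bar> \<le> e"
    using 2 neg[of "\<lambda>z. f z - step_kernel e m s S T z"] by argo
  with 1 show ?thesis by (intro exI conjI)
qed

section \<open>Interval exchanges\<close>

text \<open>For each label, as many points as both sides have in common are matched bijectively. The
  leftover sets have equal size and are matched arbitrarily; the surplus of a label on the left is
  at most the difference of the two counts.\<close>

lemma permutation_matching_labels:
  fixes a b :: "'i \<Rightarrow> 'c"
  assumes X: "finite X" and C: "finite C" "a ` X \<subseteq> C" "b ` X \<subseteq> C"
  shows "\<exists>\<sigma>. bij_betw \<sigma> X X \<and> real (card {x\<in>X. a x \<noteq> b (\<sigma> x)})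
    \<le> (\<Sum>c\<in>C. \<bar>real (card {x\<in>X. a x = c}) - real (card {x\<in>X. b x = c})\<bar>)"
proof -
  let ?A = "\<lambda>c. {x\<in>X. a x = c}" and ?B = "\<lambda>c. {x\<in>X. b x = c}"
  let ?n = "\<lambda>c. min (card (?A c)) (card (?B c))"
  have fin: "finite (?A c)" "finite (?B c)" for c using X by auto
  have "\<exists>P. P \<subseteq> ?A c \<and> card P = ?n c" for c
    by (rule obtain_subset_with_card_n[of "?n c" "?A c"]) auto
  then obtain P where P: "\<And>c. P c \<subseteq> ?A c" "\<And>c. card (P c) = ?n c" by metis
  have "\<exists>Q. Q \<subseteq> ?B c \<and> card Q = ?n c" for c
    by (rule obtain_subset_with_card_n[of "?n c" "?B c"]) auto
  then obtain Q where Q: "\<And>c. Q c \<subseteq> ?B c" "\<And>c. card (Q c) = ?n c" by metis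
  have "\<exists>f. bij_betw f (P c) (Q c)" for c
    using P(1)[of c] Q(1)[of c] fin[of c]
    by (intro finite_same_card_bij) (auto simp: P(2) Q(2) intro: finite_subset)
  then obtain f where f: "\<And>c. bij_betw (f c) (P c) (Q c)" by metis
  define PP where "PP = (\<Union>c\<in>C. P c)"
  define QQ where "QQ = (\<Union>c\<in>C. Q c)"
  define g where "g x = f (a x) x" for x
  have PP: "PP \<subseteq> X" and QQ: "QQ \<subseteq> X" using P(1) Q(1) by (auto simp: PP_def QQ_def)
  have a_P: "a x = c" if "x \<in> P c" for x c using P(1)[of c] that by auto
  have b_Q: "b x = c" if "x \<in> Q c" for x c using Q(1)[of c] that by auto
  have g_mem: "g x \<in> Q (a x)" if "x \<in> P c" for x c
    using bij_betwE[OF f[of c]] that a_P[OF that] by (auto simp: g_def)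
  have g_bij: "bij_betw g PP QQ"
  proof (rule bij_betw_imageI)
    show "inj_on g PP"
    proof (rule inj_onI)
      fix x y assume "x \<in> PP" "y \<in> PP" and eq: "g x = g y"
      then obtain c d where c: "x \<in> P c" and d: "y \<in> P d" by (auto simp: PP_def)
      have "c = d" using b_Q[OF g_mem[OF c]] b_Q[OF g_mem[OF d]] a_P[OF c] a_P[OF d] eq by simp
      then show "x = y"
        using eq c d a_P[OF c] a_P[OF d] bij_betw_imp_inj_on[OF f[of c]] by (auto simp: g_def inj_on_def)
    qed
    show "g ` PP = QQ"
    proof (intro equalityI subsetI)
      fix y assume "y \<in> g ` PP"
      then obtain x c where "y = g x" "c \<in> C" "x \<in> P c" by (auto simp: PP_def)
      then show "y \<in> QQ" using g_mem[of x c] a_P[of x c] by (auto simp: QQ_def)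
    next
      fix y assume "y \<in> QQ"
      then obtain c where c: "c \<in> C" "y \<in> Q c" by (auto simp: QQ_def)
      then obtain x where "x \<in> P c" "y = f c x"
        using bij_betw_imp_surj_on[OF f[of c]] by auto
      then show "y \<in> g ` PP" using a_P[of x c] c(1) by (auto simp: g_def PP_def)
    qed
  qed
  have "card PP = card QQ" using bij_betw_same_card[OF g_bij] .
  \<comment> \<open>The unmatched points on both sides are equally many, so any bijection
    \<open>h\<close> between them completes the permutation.\<close>
  then have "card (X - PP) = card (X - QQ)"
    using PP QQ X by (simp add: card_Diff_subset finite_subset)
  then obtain h where h: "bij_betw h (X - PP) (X - QQ)"
    using X by (meson finite_Diff finite_same_card_bij)
  define \<sigma> where "\<sigma> x = (if x \<in> PP then g x else h x)" for x
  have "bij_betw \<sigma> (PP \<union> (X - PP)) (QQ \<union> (X - QQ))"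
  proof (rule bij_betw_combine)
    show "bij_betw \<sigma> PP QQ" using g_bij by (rule bij_betw_cong[THEN iffD1, rotated]) (simp add: \<sigma>_def)
    show "bij_betw \<sigma> (X - PP) (X - QQ)" using h by (rule bij_betw_cong[THEN iffD1, rotated]) (simp add: \<sigma>_def)
  qed auto
  then have "bij_betw \<sigma> X X" using PP QQ by (simp add: Un_absorb1)
  moreover have "real (card {x\<in>X. a x \<noteq> b (\<sigma> x)}) \<le> (\<Sum>c\<in>C. \<bar>real (card (?A c)) - real (card (?B c))\<bar>)"
  proof -
    have "{x\<in>X. a x \<noteq> b (\<sigma> x)} \<subseteq> (\<Union>c\<in>C. ?A c - P c)"
    proof
      fix x assume x: "x \<in> {x\<in>X. a x \<noteq> b (\<sigma> x)}"
      have "x \<notin> P (a x)"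
      proof
        assume xP: "x \<in> P (a x)"
        then have "x \<in> PP" using x C(2) by (auto simp: PP_def)
        then show False using x b_Q[OF g_mem[OF xP]] by (simp add: \<sigma>_def)
      qed
      then show "x \<in> (\<Union>c\<in>C. ?A c - P c)" using x C(2) by auto
    qed
    then have "card {x\<in>X. a x \<noteq> b (\<sigma> x)} \<le> card (\<Union>c\<in>C. ?A c - P c)"
      using C(1) fin by (intro card_mono finite_UN_I) auto
    also have "\<dots> \<le> (\<Sum>c\<in>C. card (?A c - P c))" by (rule card_UN_le[OF C(1)])
    finally have "real (card {x\<in>X. a x \<noteq> b (\<sigma> x)}) \<le> (\<Sum>c\<in>C. real (card (?A c - P c)))"
      by (simp only: of_nat_le_iff flip: of_nat_sum)
    also have "\<dots> \<le> (\<Sum>c\<in>C. \<bar>real (card (?A c)) - real (card (?B c))\<bar>)"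
    proof (rule sum_mono)
      fix c
      have "card (?A c - P c) = card (?A c) - ?n c"
        using card_Diff_subset[OF finite_subset[OF P(1)[of c] fin(1)] P(1)[of c]] P(2)[of c] by simp
      then show "real (card (?A c - P c)) \<le> \<bar>real (card (?A c)) - real (card (?B c))\<bar>" by linarith
    qed
    finally show ?thesis .
  qed
  ultimately show ?thesis by blast
qed

section \<open>Exchanges of equal cells of the interval\<close>

definition cell_index :: "nat \<Rightarrow> real \<Rightarrow> nat" where
  "cell_index N x = nat \<lfloor>real N * x\<rfloor>"

text \<open>Half-open, so that the cells with index below \<open>N\<close> partition the interval
  without its endpoint 1.\<close>

definition cell :: "nat \<Rightarrow> nat \<Rightarrow> real set" where
  "cell N i = {real i / real N..<(real i + 1) / real N}"

lemma cell_iff: "N > 0 \<Longrightarrow> x \<in> cell N i \<longleftrightarrow> real i \<le> real N * x \<and> real N * x < real i + 1"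
  by (simp add: cell_def field_simps)

lemma cell_shift:
  assumes "N > 0"
  shows "x + (real j - real i) / real N \<in> cell N j \<longleftrightarrow> x \<in> cell N i"
proof -
  have "real N * (x + (real j - real i) / real N) = real N * x + real j - real i"
    using assms by (simp add: field_simps)
  then show ?thesis unfolding cell_iff[OF assms] by auto
qed

lemma cell_index_cell:
  assumes "N > 0"
  shows "x \<in> cell N i \<longleftrightarrow> 0 \<le> x \<and> cell_index N x = i"
proof -
  have "x \<in> cell N i \<longleftrightarrow> \<lfloor>real N * x\<rfloor> = int i"
    unfolding cell_iff[OF assms] by (simp add: floor_eq_iff)
  also have "\<dots> \<longleftrightarrow> 0 \<le> x \<and> cell_index N x = i"
  proof
    assume fl: "\<lfloor>real N * x\<rfloor> = int i"
    then have "real i \<le> real N * x" by linarith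
    then have "0 \<le> real N * x" by linarith
    then have "0 \<le> x" using assms by (simp add: zero_le_mult_iff)
    then show "0 \<le> x \<and> cell_index N x = i" using fl by (simp add: cell_index_def)
  next
    assume "0 \<le> x \<and> cell_index N x = i"
    then show "\<lfloor>real N * x\<rfloor> = int i" by (auto simp: cell_index_def)
  qed
  finally show ?thesis .
qed

lemma cell_index_less:
  assumes "N > 0" "0 \<le> x" "x < 1"
  shows "cell_index N x < N"
proof -
  have "real N * x < real N" using assms by simp
  then have "\<lfloor>real N * x\<rfloor> < int N" by linarith
  then show ?thesis using assms by (simp add: cell_index_def nat_less_iff)
qed

lemma cell_subset: "N > 0 \<Longrightarrow> i < N \<Longrightarrow> cell N i \<subseteq> {0..<1}"
proof
  fix x assume N: "N > 0" "i < N" and "x \<in> cell N i"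
  then have x: "real i / real N \<le> x" "x < (real i + 1) / real N" by (simp_all add: cell_def)
  have "0 \<le> real i / real N" by simp
  with x(1) have "0 \<le> x" by linarith
  moreover have "(real i + 1) / real N \<le> 1" using N by simp
  ultimately show "x \<in> {0..<1}" using x(2) by simp
qed

lemma cell_disjoint: "N > 0 \<Longrightarrow> i \<noteq> j \<Longrightarrow> cell N i \<inter> cell N j = {}"
  by (auto simp: cell_index_cell)

lemma UN_cell: "N > 0 \<Longrightarrow> (\<Union>i<N. cell N i) = {0..<1}"
proof (intro equalityI subsetI)
  fix x :: real assume "N > 0" "x \<in> {0..<1}"
  then show "x \<in> (\<Union>i<N. cell N i)" using cell_index_less[of N x] cell_index_cell[of N x] by auto
qed (use cell_subset in blast)

lemma cell_lmeasurable: "cell N i \<in> lmeasurable"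
proof (rule fmeasurableI)
  show "emeasure lebesgue (cell N i) < \<infinity>"
    by (rule order_le_less_trans[OF emeasure_mono[of _ "{real i / real N..(real i + 1) / real N}"]])
      (auto simp: cell_def emeasure_lborel_Icc_eq)
qed (simp add: cell_def)

lemma measure_cell: "N > 0 \<Longrightarrow> measure lebesgue (cell N i) = 1 / N"
  by (simp add: cell_def diff_divide_distrib[symmetric] divide_right_mono)

text \<open>The interval exchange that permutes the \<open>N\<close> cells of equal length by \<open>\<sigma>\<close>. The point 1, which
  lies in no cell, is fixed.\<close>

definition cell_exchange :: "nat \<Rightarrow> (nat \<Rightarrow> nat) \<Rightarrow> real \<Rightarrow> real" where
  "cell_exchange N \<sigma> x = (if x < 1 then x + (real (\<sigma> (cell_index N x)) - real (cell_index N x)) / real N else x)"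

context
  fixes N :: nat and \<sigma> :: "nat \<Rightarrow> nat"
  assumes N: "N > 0" and \<sigma>: "bij_betw \<sigma> {..<N} {..<N}"
begin

text \<open>A point moves with its own cell by a translation; injectivity of \<open>\<sigma>\<close>
  shows that no other cell lands in the same place.\<close>

lemma cell_exchange_cell:
  assumes "i < N"
  shows "cell_exchange N \<sigma> x \<in> cell N (\<sigma> i) \<and> x < 1 \<and> 0 \<le> x \<longleftrightarrow> x \<in> cell N i"
proof
  assume x: "x \<in> cell N i"
  then have "x < 1" "0 \<le> x" "cell_index N x = i" using cell_subset[OF N assms] cell_index_cell[OF N] by auto
  moreover have "x + (real (\<sigma> i) - real i) / real N \<in> cell N (\<sigma> i)"
    using x cell_shift[OF N] by blast
  ultimately show "cell_exchange N \<sigma> x \<in> cell N (\<sigma> i) \<and> x < 1 \<and> 0 \<le> x" by (simp add: cell_exchange_def)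
next
  assume x: "cell_exchange N \<sigma> x \<in> cell N (\<sigma> i) \<and> x < 1 \<and> 0 \<le> x"
  define j where "j = cell_index N x"
  have j: "j < N" using cell_index_less[OF N] x by (simp add: j_def)
  have xj: "x \<in> cell N j" using x cell_index_cell[OF N] by (simp add: j_def)
  have "x + (real (\<sigma> j) - real j) / real N \<in> cell N (\<sigma> j)"
    using xj cell_shift[OF N] by blast
  then have "cell_exchange N \<sigma> x \<in> cell N (\<sigma> j)" using x by (simp add: cell_exchange_def j_def)
  then have "\<sigma> j = \<sigma> i" using x cell_disjoint[OF N, of "\<sigma> j" "\<sigma> i"] by blast
  then have "j = i" using \<sigma> j assms by (auto simp: bij_betw_def inj_on_def)
  then show "x \<in> cell N i" using xj by simp
qed

lemma cell_index_exchange: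
  assumes "0 \<le> x" "x < 1"
  shows "cell_index N (cell_exchange N \<sigma> x) = \<sigma> (cell_index N x)"
    and "0 \<le> cell_exchange N \<sigma> x" "cell_exchange N \<sigma> x < 1"
proof -
  let ?i = "cell_index N x"
  have i: "?i < N" using cell_index_less[OF N assms] .
  have "x \<in> cell N ?i" using assms cell_index_cell[OF N] by simp
  then have c: "cell_exchange N \<sigma> x \<in> cell N (\<sigma> ?i)" using cell_exchange_cell[OF i] by blast
  then show "cell_index N (cell_exchange N \<sigma> x) = \<sigma> ?i" using cell_index_cell[OF N] by simp
  have "\<sigma> ?i < N" using \<sigma> i bij_betwE by fastforce
  then show "0 \<le> cell_exchange N \<sigma> x" "cell_exchange N \<sigma> x < 1" using cell_subset[OF N, of "\<sigma> ?i"] c by auto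
qed

lemma cell_exchange_in: "x \<in> unit_interval \<Longrightarrow> cell_exchange N \<sigma> x \<in> unit_interval"
  using cell_index_exchange(2,3)[of x] by (cases "x = 1") (auto simp: cell_exchange_def)

text \<open>Writing the preimage as finitely many translated pieces of \<open>A\<close>, plus
  possibly the point 1, reduces measurability and preservation of measure to translation
  invariance.\<close>

lemma cell_exchange_vimage:
  assumes "A \<subseteq> unit_interval"
  shows "cell_exchange N \<sigma> -` A \<inter> unit_interval
    = (\<Union>i<N. (+) ((real i - real (\<sigma> i)) / real N) ` (A \<inter> cell N (\<sigma> i))) \<union> (A \<inter> {1})"
proof (intro set_eqI iffI)
  fix x assume x: "x \<in> cell_exchange N \<sigma> -` A \<inter> unit_interval"
  show "x \<in> (\<Union>i<N. (+) ((real i - real (\<sigma> i)) / real N) ` (A \<inter> cell N (\<sigma> i))) \<union> (A \<inter> {1})"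
  proof (cases "x = 1")
    case True
    then show ?thesis using x by (simp add: cell_exchange_def)
  next
    case False
    then have x1: "0 \<le> x" "x < 1" using x by auto
    let ?i = "cell_index N x"
    have i: "?i < N" using cell_index_less[OF N x1] .
    have "cell_exchange N \<sigma> x \<in> cell N (\<sigma> ?i)"
      using cell_exchange_cell[OF i] x1 cell_index_cell[OF N] by blast
    moreover have "cell_exchange N \<sigma> x \<in> A" using x by simp
    moreover have "x = (real ?i - real (\<sigma> ?i)) / real N + cell_exchange N \<sigma> x"
      using x1 N by (simp add: cell_exchange_def field_simps)
    ultimately have "x \<in> (+) ((real ?i - real (\<sigma> ?i)) / real N) ` (A \<inter> cell N (\<sigma> ?i))" by blast
    then show ?thesis using i by blast
  qed
next
  fix x assume "x \<in> (\<Union>i<N. (+) ((real i - real (\<sigma> i)) / real N) ` (A \<inter> cell N (\<sigma> i))) \<union> (A \<inter> {1})"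
  then consider (one) "x = 1" "1 \<in> A" | (cell) i y where "i < N" "y \<in> A" "y \<in> cell N (\<sigma> i)" "x = (real i - real (\<sigma> i)) / real N + y"
    by blast
  then show "x \<in> cell_exchange N \<sigma> -` A \<inter> unit_interval"
  proof cases
    case one
    then show ?thesis by (simp add: cell_exchange_def)
  next
    case cell
    have "x \<in> cell N i" using cell(3,4) cell_shift[OF N, of y i "\<sigma> i"] by (simp add: add.commute)
    then have "x < 1" "0 \<le> x" "cell_index N x = i" using cell_subset[OF N cell(1)] cell_index_cell[OF N] by auto
    moreover have "(real i - real (\<sigma> i)) / real N = - ((real (\<sigma> i) - real i) / real N)"
      by (simp add: minus_divide_left)
    ultimately have "cell_exchange N \<sigma> x = y" using cell(4) by (simp add: cell_exchange_def)
    then show ?thesis using cell(2) \<open>x < 1\<close> \<open>0 \<le> x\<close> by simp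
  qed
qed

lemma measure_cell_exchange_vimage:
  assumes A: "A \<in> sets interval_measure01"
  shows "cell_exchange N \<sigma> -` A \<inter> unit_interval \<in> sets interval_measure01"
    and "measure lebesgue (cell_exchange N \<sigma> -` A \<inter> unit_interval) = measure lebesgue A"
proof -
  have A': "A \<in> sets lebesgue" "A \<subseteq> unit_interval" using A by (simp_all add: sets_interval01)
  let ?P = "\<lambda>i. (+) ((real i - real (\<sigma> i)) / real N) ` (A \<inter> cell N (\<sigma> i))"
  have cm: "cell N j \<in> sets lebesgue" for j by (simp add: cell_def)
  have lm: "A \<inter> cell N j \<in> lmeasurable" for j
    using fmeasurable_Int_fmeasurable[OF cell_lmeasurable A'(1)] by (simp add: Int_commute)
  have P: "?P i \<in> lmeasurable" for i by (intro measurable_translation lm)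
  have P_sub: "?P i \<subseteq> cell N i" if "i < N" for i
  proof
    fix x assume "x \<in> ?P i"
    then obtain y where "y \<in> cell N (\<sigma> i)" "x = y + (real i - real (\<sigma> i)) / real N"
      by (auto simp: add.commute)
    then show "x \<in> cell N i" using cell_shift[OF N] by blast
  qed
  have one: "A \<inter> {1} \<in> null_sets lebesgue"
    using null_sets_completion_iff2[of "A \<inter> {1}" lborel] by (auto intro!: bexI[of _ "{1}"] simp: null_sets_def)
  have UP: "(\<Union>i<N. ?P i) \<in> sets lebesgue" using P by (intro sets.finite_UN) (auto simp: fmeasurable_def)
  show "cell_exchange N \<sigma> -` A \<inter> unit_interval \<in> sets interval_measure01"
    unfolding sets_interval01
    by (subst cell_exchange_vimage[OF A'(2)]) (use UP one in \<open>auto simp: null_sets_def\<close>)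
  have "measure lebesgue (cell_exchange N \<sigma> -` A \<inter> unit_interval) = measure lebesgue (\<Union>i<N. ?P i)"
    unfolding cell_exchange_vimage[OF A'(2)] by (rule measure_Un_null_set[OF UP one])
  also have "\<dots> = (\<Sum>i<N. measure lebesgue (?P i))"
  proof (rule measure_UNION'[symmetric, THEN sym])
    show "pairwise (\<lambda>i j. disjnt (?P i) (?P j)) {..<N}"
      unfolding pairwise_def disjnt_def using P_sub cell_disjoint[OF N] by blast
  qed (use P in auto)
  also have "\<dots> = (\<Sum>i<N. measure lebesgue (A \<inter> cell N (\<sigma> i)))"
    by (simp only: measure_translation)
  \<comment> \<open>Preservation of measure comes down to reindexing the pieces by the
    permutation.\<close>
  also have "\<dots> = (\<Sum>j<N. measure lebesgue (A \<inter> cell N j))"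
    by (rule sum.reindex_bij_betw[OF \<sigma>])
  also have "\<dots> = measure lebesgue (\<Union>j<N. A \<inter> cell N j)"
  proof (rule measure_UNION'[symmetric])
    show "pairwise (\<lambda>i j. disjnt (A \<inter> cell N i) (A \<inter> cell N j)) {..<N}"
      unfolding pairwise_def disjnt_def using cell_disjoint[OF N] by blast
  qed (use lm in auto)
  also have "(\<Union>j<N. A \<inter> cell N j) = A \<inter> {0..<1}" using UN_cell[OF N] by blast
  also have "measure lebesgue (A \<inter> {0..<1}) = measure lebesgue (A \<inter> {0..<1} \<union> A \<inter> {1})"
    using A'(1) one by (intro measure_Un_null_set[symmetric]) auto
  also have "A \<inter> {0..<1} \<union> A \<inter> {1} = A" using A'(2) by (auto simp: subset_iff order_less_le)
  finally show "measure lebesgue (cell_exchange N \<sigma> -` A \<inter> unit_interval) = measure lebesgue A" .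
qed

lemma measurable_cell_exchange: "cell_exchange N \<sigma> \<in> interval_measure01 \<rightarrow>\<^sub>M interval_measure01"
  using measure_cell_exchange_vimage(1) cell_exchange_in by (intro measurableI) auto

lemma distr_cell_exchange: "distr interval_measure01 interval_measure01 (cell_exchange N \<sigma>) = interval_measure01"
proof (rule measure_eqI)
  fix A assume "A \<in> sets (distr interval_measure01 interval_measure01 (cell_exchange N \<sigma>))"
  then have A: "A \<in> sets interval_measure01" by simp
  note V = measure_cell_exchange_vimage[OF A]
  have *: "emeasure interval_measure01 B = ennreal (measure lebesgue B)" if "B \<in> sets interval_measure01" for B
  proof -
    have "B \<subseteq> unit_interval" "B \<in> sets lebesgue" using that by (simp_all add: sets_interval01)
    then show ?thesis
      by (simp add: int01.emeasure_eq_measure measure_restrict_space)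
  qed
  have "emeasure (distr interval_measure01 interval_measure01 (cell_exchange N \<sigma>)) A
      = emeasure interval_measure01 (cell_exchange N \<sigma> -` A \<inter> unit_interval)"
    using emeasure_distr[OF measurable_cell_exchange A] by simp
  then show "emeasure (distr interval_measure01 interval_measure01 (cell_exchange N \<sigma>)) A = emeasure interval_measure01 A"
    using *[OF A] *[OF V(1)] V(2) by simp
qed simp

end

text \<open>Only a left inverse on the indices is assumed, so the lemma yields both compositions
  when \<open>\<sigma>\<close> and its inverse trade roles.\<close>

lemma cell_exchange_inverse:
  assumes N: "N > 0" and \<sigma>: "bij_betw \<sigma> {..<N} {..<N}" and x: "x \<in> unit_interval"
    and \<tau>: "\<And>i. i < N \<Longrightarrow> \<tau> (\<sigma> i) = i"
  shows "cell_exchange N \<tau> (cell_exchange N \<sigma> x) = x"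
proof (cases "x = 1")
  case False
  then have x1: "0 \<le> x" "x < 1" using x by auto
  have i: "cell_index N x < N" using cell_index_less[OF N x1] .
  have "cell_exchange N \<tau> (cell_exchange N \<sigma> x)
      = cell_exchange N \<sigma> x + (real (cell_index N x) - real (\<sigma> (cell_index N x))) / real N"
    using cell_index_exchange[OF N \<sigma> x1] \<tau>[OF i] by (subst cell_exchange_def) simp
  then show ?thesis using x1 N by (simp add: cell_exchange_def field_simps)
qed (simp add: cell_exchange_def)

lemma cell_exchange_imp:
  assumes N: "N > 0" and \<sigma>: "bij_betw \<sigma> {..<N} {..<N}"
  shows "cell_exchange N \<sigma> \<in> invertible_measure_preserving"
proof -
  define \<tau> where "\<tau> = inv_into {..<N} \<sigma>"
  have \<tau>: "bij_betw \<tau> {..<N} {..<N}" unfolding \<tau>_def by (rule bij_betw_inv_into[OF \<sigma>])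
  have 1: "\<tau> (\<sigma> i) = i" if "i < N" for i
    using bij_betw_inv_into_left[OF \<sigma>, of i] that by (simp add: \<tau>_def)
  have 2: "\<sigma> (\<tau> i) = i" if "i < N" for i
    using bij_betw_inv_into_right[OF \<sigma>, of i] that by (simp add: \<tau>_def)
  have i1: "cell_exchange N \<tau> (cell_exchange N \<sigma> x) = x" if "x \<in> unit_interval" for x
    using cell_exchange_inverse[OF N \<sigma> that] 1 by blast
  have i2: "cell_exchange N \<sigma> (cell_exchange N \<tau> x) = x" if "x \<in> unit_interval" for x
    using cell_exchange_inverse[OF N \<tau> that] 2 by blast
  have b: "bij_betw (cell_exchange N \<sigma>) unit_interval unit_interval"
    by (rule bij_betw_byWitness[where f'="cell_exchange N \<tau>"])
      (use i1 i2 cell_exchange_in[OF N \<sigma>] cell_exchange_in[OF N \<tau>] in blast)+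
  have "inv_into unit_interval (cell_exchange N \<sigma>) x = cell_exchange N \<tau> x" if "x \<in> unit_interval" for x
    using bij_betw_imp_inj_on[OF b] cell_exchange_in[OF N \<tau> that] i2[OF that] by (rule inv_into_f_eq)
  then have "inv_into unit_interval (cell_exchange N \<sigma>) \<in> interval_measure01 \<rightarrow>\<^sub>M interval_measure01"
    using measurable_cell_exchange[OF N \<tau>] by (subst measurable_cong) auto
  then show ?thesis
    using b measurable_cell_exchange[OF N \<sigma>] distr_cell_exchange[OF N \<sigma>]
    by (simp add: invertible_measure_preserving_def)
qed

text \<open>Labels that are constant on the \<open>N\<close> cells have level sets of measure count
  over \<open>N\<close>. The counting lemma applied to the cells then gives a permutation, and its
  interval exchange is the required map.\<close>

lemma matching_labels:
  fixes a b :: "real \<Rightarrow> 'c"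
  assumes N: "N > 0" and C: "finite C" "\<And>x. a x \<in> C" "\<And>x. b x \<in> C"
    and cst: "\<And>x y. 0 \<le> x \<Longrightarrow> x < 1 \<Longrightarrow> 0 \<le> y \<Longrightarrow> y < 1 \<Longrightarrow> cell_index N x = cell_index N y \<Longrightarrow> a x = a y \<and> b x = b y"
    and close: "\<And>c. c \<in> C \<Longrightarrow> \<bar>measure lebesgue {x. 0 \<le> x \<and> x < 1 \<and> a x = c} - measure lebesgue {x. 0 \<le> x \<and> x < 1 \<and> b x = c}\<bar> \<le> \<eta>"
  shows "\<exists>\<phi>\<in>invertible_measure_preserving.
    {x. 0 \<le> x \<and> x < 1 \<and> a x \<noteq> b (\<phi> x)} \<in> sets lebesgue \<and>
    measure lebesgue {x. 0 \<le> x \<and> x < 1 \<and> a x \<noteq> b (\<phi> x)} \<le> real (card C) * \<eta>"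
proof -
  \<comment> \<open>The left endpoint represents its cell when labels of points are read as labels
    of indices.\<close>
  define r where "r i = real i / real N" for i
  have r: "0 \<le> r i" "r i < 1" "cell_index N (r i) = i" if "i < N" for i
    using that N by (simp_all add: r_def cell_index_def)
  have level: "{x. 0 \<le> x \<and> x < 1 \<and> Q (cell_index N x)} = (\<Union>i\<in>{i. i < N \<and> Q i}. cell N i)" for Q
    using cell_index_less[OF N] cell_index_cell[OF N] cell_subset[OF N] by fastforce
  have meas: "{x. 0 \<le> x \<and> x < 1 \<and> Q (cell_index N x)} \<in> sets lebesgue \<and>
      measure lebesgue {x. 0 \<le> x \<and> x < 1 \<and> Q (cell_index N x)} = real (card {i. i < N \<and> Q i}) / real N" for Q
  proof -
    note lm = cell_lmeasurable[of N]
    have "measure lebesgue (\<Union>i\<in>{i. i < N \<and> Q i}. cell N i) = (\<Sum>i\<in>{i. i < N \<and> Q i}. measure lebesgue (cell N i))"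
    proof (rule measure_UNION')
      show "pairwise (\<lambda>i j. disjnt (cell N i) (cell N j)) {i. i < N \<and> Q i}"
        unfolding pairwise_def disjnt_def using cell_disjoint[OF N] by blast
    qed (use lm in auto)
    also have "\<dots> = real (card {i. i < N \<and> Q i}) / real N"
      by (simp add: measure_cell[OF N])
    finally show ?thesis unfolding level using lm by (auto intro!: sets.finite_UN simp: fmeasurable_def)
  qed
  have ar: "a x = a (r (cell_index N x))" "b x = b (r (cell_index N x))" if "0 \<le> x" "x < 1" for x
    using cst[OF that, of "r (cell_index N x)"] r[OF cell_index_less[OF N that]] by auto
  have freq: "measure lebesgue {x. 0 \<le> x \<and> x < 1 \<and> a x = c} = real (card {i. i < N \<and> a (r i) = c}) / real N"
    "measure lebesgue {x. 0 \<le> x \<and> x < 1 \<and> b x = c} = real (card {i. i < N \<and> b (r i) = c}) / real N" for c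
  proof -
    have "{x. 0 \<le> x \<and> x < 1 \<and> a x = c} = {x. 0 \<le> x \<and> x < 1 \<and> a (r (cell_index N x)) = c}"
      "{x. 0 \<le> x \<and> x < 1 \<and> b x = c} = {x. 0 \<le> x \<and> x < 1 \<and> b (r (cell_index N x)) = c}"
      using ar by auto
    then show "measure lebesgue {x. 0 \<le> x \<and> x < 1 \<and> a x = c} = real (card {i. i < N \<and> a (r i) = c}) / real N"
    "measure lebesgue {x. 0 \<le> x \<and> x < 1 \<and> b x = c} = real (card {i. i < N \<and> b (r i) = c}) / real N"
      using meas[of "\<lambda>i. a (r i) = c"] meas[of "\<lambda>i. b (r i) = c"] by simp_all
  qed
  obtain \<sigma> where \<sigma>: "bij_betw \<sigma> {..<N} {..<N}"
    "real (card {i\<in>{..<N}. a (r i) \<noteq> b (r (\<sigma> i))})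
      \<le> (\<Sum>c\<in>C. \<bar>real (card {i\<in>{..<N}. a (r i) = c}) - real (card {i\<in>{..<N}. b (r i) = c})\<bar>)"
    using permutation_matching_labels[of "{..<N}" C "\<lambda>i. a (r i)" "\<lambda>i. b (r i)"] C by auto
  define \<phi> where "\<phi> = cell_exchange N \<sigma>"
  have eq: "{x. 0 \<le> x \<and> x < 1 \<and> a x \<noteq> b (\<phi> x)} = {x. 0 \<le> x \<and> x < 1 \<and> a (r (cell_index N x)) \<noteq> b (r (\<sigma> (cell_index N x)))}"
    using ar cell_index_exchange[OF N \<sigma>(1)] by (auto simp: \<phi>_def)
  have "measure lebesgue {x. 0 \<le> x \<and> x < 1 \<and> a x \<noteq> b (\<phi> x)} = real (card {i. i < N \<and> a (r i) \<noteq> b (r (\<sigma> i))}) / real N"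
    unfolding eq using meas[of "\<lambda>i. a (r i) \<noteq> b (r (\<sigma> i))"] by simp
  also have "\<dots> \<le> (\<Sum>c\<in>C. \<bar>real (card {i\<in>{..<N}. a (r i) = c}) - real (card {i\<in>{..<N}. b (r i) = c})\<bar>) / real N"
    using \<sigma>(2) by (intro divide_right_mono) auto
  also have "\<dots> = (\<Sum>c\<in>C. \<bar>measure lebesgue {x. 0 \<le> x \<and> x < 1 \<and> a x = c} - measure lebesgue {x. 0 \<le> x \<and> x < 1 \<and> b x = c}\<bar>)"
    unfolding freq sum_divide_distrib by (simp flip: diff_divide_distrib)
  also have "\<dots> \<le> real (card C) * \<eta>" using close by (rule sum_bounded_above)
  finally have "measure lebesgue {x. 0 \<le> x \<and> x < 1 \<and> a x \<noteq> b (\<phi> x)} \<le> real (card C) * \<eta>" .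
  moreover have "{x. 0 \<le> x \<and> x < 1 \<and> a x \<noteq> b (\<phi> x)} \<in> sets lebesgue"
    unfolding eq using meas[of "\<lambda>i. a (r i) \<noteq> b (r (\<sigma> i))"] by simp
  moreover have "\<phi> \<in> invertible_measure_preserving"
    unfolding \<phi>_def by (rule cell_exchange_imp[OF N \<sigma>(1)])
  ultimately show ?thesis by blast
qed

section \<open>Total boundedness\<close>

context
  fixes k m :: nat and e :: real
begin

text \<open>One dyadic level \<open>n\<close> serves all components. It may depend on the system and
  is not part of the data that will be restricted to finitely many cases.\<close>

definition approximant :: "kernel_tuple \<Rightarrow> nat \<Rightarrow> (nat set \<Rightarrow> nat \<Rightarrow> int) \<Rightarrow>
    (nat set \<Rightarrow> nat \<Rightarrow> real set) \<Rightarrow> (nat set \<Rightarrow> nat \<Rightarrow> real set) \<Rightarrow> bool" where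
  "approximant W n s S T \<longleftrightarrow> (\<forall>I\<in>Pow {1..k}.
     (\<forall>i<m. s I i \<in> {-1, 0, 1} \<and> dyadic_set n (S I i) \<and> dyadic_set n (T I i)) \<and>
     (\<forall>A\<in>sets interval_measure01. \<forall>B\<in>sets interval_measure01.
         \<bar>rect_integral (\<lambda>z. W I z - step_kernel e m (s I) (S I) (T I) z) A B\<bar> \<le> e))"

text \<open>The level sets of this map are the atoms of the partition generated by all sides of all
  rectangles in all components; the boolean tells first sides from second sides.\<close>

definition label :: "(nat set \<Rightarrow> nat \<Rightarrow> real set) \<Rightarrow> (nat set \<Rightarrow> nat \<Rightarrow> real set) \<Rightarrow> real \<Rightarrow> (nat set \<times> nat \<times> bool) set" where
  "label S T x = {(I, i, b). I \<in> Pow {1..k} \<and> i < m \<and> x \<in> (if b then S I i else T I i)}"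

definition labels :: "(nat set \<times> nat \<times> bool) set set" where
  "labels = Pow (Pow {1..k} \<times> {..<m} \<times> UNIV)"

text \<open>The point 1 is excluded because it lies in none of the exchanged cells.\<close>

definition frequency :: "(nat set \<Rightarrow> nat \<Rightarrow> real set) \<Rightarrow> (nat set \<Rightarrow> nat \<Rightarrow> real set) \<Rightarrow> (nat set \<times> nat \<times> bool) set \<Rightarrow> real" where
  "frequency S T c = measure lebesgue {x. 0 \<le> x \<and> x < 1 \<and> label S T x = c}"

lemma finite_labels: "finite labels"
  by (simp add: labels_def)

lemma label_in: "label S T x \<in> labels"
  by (auto simp: label_def labels_def)

text \<open>Weak regularity is applied to each component separately; the maximum of the finitely
  many levels is common to all.\<close>

lemma approximant_exists:
  assumes W: "W \<in> graphon_systems k" and e: "e > 0" and m: "1 < real m * e\<^sup>2"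
  shows "\<exists>n s S T. approximant W n s S T"
proof -
  define good where "good I n s S T \<longleftrightarrow> (\<forall>i<m. s i \<in> {-1, 0, 1} \<and> dyadic_set n (S i) \<and> dyadic_set n (T i)) \<and>
     (\<forall>A\<in>sets interval_measure01. \<forall>B\<in>sets interval_measure01.
         \<bar>rect_integral (\<lambda>z. W I z - step_kernel e m s S T z) A B\<bar> \<le> e)" for I n s S T
  have "\<exists>n s S T. good I n s S T" if I: "I \<in> Pow {1..k}" for I
  proof -
    have g: "W I \<in> graphons" using W I by (simp add: graphon_systems_def)
    have "\<bar>W I z\<bar> \<le> 1" if "z \<in> unit_square" for z
      using g that unfolding graphons_def by fastforce
    from weak_regularity[OF graphons_bounded_kernels[OF g] this e m] show ?thesis
      unfolding good_def .
  qed
  then have "\<forall>I. \<exists>n s S T. I \<in> Pow {1..k} \<longrightarrow> good I n s S T" by blast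
  then obtain n s S T where *: "\<And>I. I \<in> Pow {1..k} \<Longrightarrow> good I (n I) (s I) (S I) (T I)"
    by metis
  define N where "N = Max (n ` Pow {1..k})"
  have N: "n I \<le> N" if "I \<in> Pow {1..k}" for I using that by (simp add: N_def)
  have "approximant W N s S T"
    unfolding approximant_def
  proof (intro ballI conjI allI impI)
    fix I assume I: "I \<in> Pow {1..k}"
    note g = *[OF I, unfolded good_def]
    show "s I i \<in> {-1, 0, 1}" if "i < m" for i using g that by blast
    show "dyadic_set N (S I i)" if "i < m" for i using g that dyadic_set_mono[OF _ N[OF I]] by blast
    show "dyadic_set N (T I i)" if "i < m" for i using g that dyadic_set_mono[OF _ N[OF I]] by blast
    show "\<bar>rect_integral (\<lambda>z. W I z - step_kernel e m (s I) (S I) (T I) z) A B\<bar> \<le> e"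
      if "A \<in> sets interval_measure01" "B \<in> sets interval_measure01" for A B
      using g that by blast
  qed
  then show ?thesis by blast
qed

lemma approximant_bounded:
  assumes "approximant W n s S T" "I \<in> Pow {1..k}"
  shows "step_kernel e m (s I) (S I) (T I) \<in> bounded_kernels"
  using assms unfolding approximant_def
  by (intro step_kernel_bounded) (blast intro: dyadic_set_measurable)+

lemma label_constant:
  assumes "approximant W n s S T" "n \<le> N"
    and "x \<in> unit_interval" "y \<in> unit_interval" "\<lfloor>2 ^ N * x\<rfloor> = \<lfloor>2 ^ N * y\<rfloor>"
  shows "label S T x = label S T y"
proof -
  have "x \<in> D \<longleftrightarrow> y \<in> D" if "dyadic_set n D" for D
    using dyadic_set_mono[OF that assms(2)] assms(3-5) unfolding dyadic_set_def by blast
  then have "x \<in> S I i \<longleftrightarrow> y \<in> S I i" "x \<in> T I i \<longleftrightarrow> y \<in> T I i" if "I \<in> Pow {1..k}" "i < m" for I i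
    using assms(1) that unfolding approximant_def by blast+
  then show ?thesis unfolding label_def by (intro Collect_cong) auto
qed

text \<open>With the signs fixed, a step kernel depends on its arguments only through their labels.
  Matching labels thus matches all components by one and the same map.\<close>

lemma step_kernel_label:
  assumes I: "I \<in> Pow {1..k}" and s: "\<And>i. i < m \<Longrightarrow> s I i = s' I i"
    and x: "label S T x = label S' T' x'" and y: "label S T y = label S' T' y'"
  shows "step_kernel e m (s I) (S I) (T I) (x, y) = step_kernel e m (s' I) (S' I) (T' I) (x', y')"
  unfolding step_kernel_def
proof (intro sum.cong refl)
  fix i assume "i \<in> {..<m}"
  then have i: "i < m" by simp
  have "(I, i, True) \<in> label S T x \<longleftrightarrow> (I, i, True) \<in> label S' T' x'"
    "(I, i, False) \<in> label S T y \<longleftrightarrow> (I, i, False) \<in> label S' T' y'" using x y by simp_all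
  then have "x \<in> S I i \<longleftrightarrow> x' \<in> S' I i" "y \<in> T I i \<longleftrightarrow> y' \<in> T' I i"
    using i I by (simp_all add: label_def)
  then show "e * of_int (s I i) * indicator (S I i \<times> T I i) (x, y)
     = e * of_int (s' I i) * indicator (S' I i \<times> T' I i) (x', y')"
    by (simp add: s[OF i] indicator_def)
qed

text \<open>With equal signs, corresponding terms take values in the same pair of 0 and a number of
  size at most \<open>e\<close>. This crude bound is used where the labels disagree.\<close>

lemma step_kernel_diff_le:
  assumes "e > 0" "\<And>i. i < m \<Longrightarrow> s i = s' i" "\<And>i. i < m \<Longrightarrow> s i \<in> {-1, 0, 1}"
  shows "\<bar>step_kernel e m s S T z - step_kernel e m s' S' T' z'\<bar> \<le> real m * e"
proof -
  have "\<bar>step_kernel e m s S T z - step_kernel e m s' S' T' z'\<bar>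
      = \<bar>\<Sum>i<m. e * of_int (s i) * indicator (S i \<times> T i) z - e * of_int (s' i) * indicator (S' i \<times> T' i) z'\<bar>"
    by (simp add: step_kernel_def sum_subtractf)
  also have "\<dots> \<le> (\<Sum>i<m. \<bar>e * of_int (s i) * indicator (S i \<times> T i) z - e * of_int (s' i) * indicator (S' i \<times> T' i) z'\<bar>)"
    by (rule sum_abs)
  also have "\<dots> \<le> (\<Sum>i<m. e)"
  proof (rule sum_mono)
    fix i assume "i \<in> {..<m}"
    then have "s' i = s i" "s i = -1 \<or> s i = 0 \<or> s i = 1" using assms(2,3)[of i] by auto
    then show "\<bar>e * of_int (s i) * indicator (S i \<times> T i) z - e * of_int (s' i) * indicator (S' i \<times> T' i) z'\<bar> \<le> e"
      using \<open>e > 0\<close> by (auto simp: indicator_def)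
  qed
  finally show ?thesis by simp
qed

text \<open>In each component the difference splits through the two step kernels. The outer parts
  contribute \<open>e\<close> each; the middle part vanishes off the cross over the mismatched
  points, where it is at most \<open>real m * e\<close>. The two strips of the cross give the second
  factor 2, and \<open>2 ^ k\<close> counts components.\<close>

lemma cut_distance_approximants:
  assumes W: "W \<in> graphon_systems k" and U: "U \<in> graphon_systems k" and e: "e > 0"
    and aW: "approximant W n s S T" and aU: "approximant U n' s' S' T'"
    and s: "\<And>I i. I \<in> Pow {1..k} \<Longrightarrow> i < m \<Longrightarrow> s I i = s' I i"
    and close: "\<And>c. c \<in> labels \<Longrightarrow> \<bar>frequency S T c - frequency S' T' c\<bar> \<le> \<eta>"
  shows "cut_distance k W U \<le> 2 ^ k * (2 * e + 2 * real m * e * (real (card labels) * \<eta>))"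
proof -
  define M where "M = max n n'"
  \<comment> \<open>With \<open>N\<close> a power of 2, the cells are the dyadic intervals of the
    finer of the two levels, so both labellings are constant on them.\<close>
  define N :: nat where "N = 2 ^ M"
  have N: "N > 0" by (simp add: N_def)
  have "\<exists>\<phi>\<in>invertible_measure_preserving.
    {x. 0 \<le> x \<and> x < 1 \<and> label S T x \<noteq> label S' T' (\<phi> x)} \<in> sets lebesgue \<and>
    measure lebesgue {x. 0 \<le> x \<and> x < 1 \<and> label S T x \<noteq> label S' T' (\<phi> x)} \<le> real (card labels) * \<eta>"
  proof (rule matching_labels[OF N finite_labels label_in label_in])
    fix x y :: real assume xy: "0 \<le> x" "x < 1" "0 \<le> y" "y < 1" "cell_index N x = cell_index N y"
    have "0 \<le> \<lfloor>real N * x\<rfloor>" "0 \<le> \<lfloor>real N * y\<rfloor>" using xy by simp_all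
    then have "\<lfloor>real N * x\<rfloor> = \<lfloor>real N * y\<rfloor>" using xy(5) by (simp only: cell_index_def eq_nat_nat_iff)
    then have "\<lfloor>2 ^ M * x\<rfloor> = \<lfloor>2 ^ M * y\<rfloor>" by (simp add: N_def)
    then show "label S T x = label S T y \<and> label S' T' x = label S' T' y"
      using xy by (intro conjI label_constant[OF aW, of M] label_constant[OF aU, of M]) (simp_all add: M_def)
  next
    fix c assume "c \<in> labels"
    then show "\<bar>measure lebesgue {x. 0 \<le> x \<and> x < 1 \<and> label S T x = c}
        - measure lebesgue {x. 0 \<le> x \<and> x < 1 \<and> label S' T' x = c}\<bar> \<le> \<eta>"
      using close by (simp add: frequency_def)
  qed
  then obtain \<phi> where \<phi>: "\<phi> \<in> invertible_measure_preserving"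
    and Zm: "{x. 0 \<le> x \<and> x < 1 \<and> label S T x \<noteq> label S' T' (\<phi> x)} \<in> sets lebesgue"
    and Zl: "measure lebesgue {x. 0 \<le> x \<and> x < 1 \<and> label S T x \<noteq> label S' T' (\<phi> x)} \<le> real (card labels) * \<eta>"
    by blast
  \<comment> \<open>The matching says nothing about the endpoint 1, so it is added to the
    exceptional set at no cost in measure.\<close>
  define Z where "Z = {x. 0 \<le> x \<and> x < 1 \<and> label S T x \<noteq> label S' T' (\<phi> x)} \<union> {1}"
  have Z: "Z \<in> sets interval_measure01"
  proof -
    have "Z \<in> sets lebesgue" unfolding Z_def using Zm by (rule sets.Un) simp
    then show ?thesis by (auto simp: sets_interval01 Z_def)
  qed
  have "{1} \<in> null_sets (lebesgue :: real measure)" by (simp add: null_sets_completionI)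
  then have "measure lebesgue Z \<le> real (card labels) * \<eta>"
    using Zl unfolding Z_def by (subst measure_Un_null_set[OF Zm]) auto
  moreover have "measure interval_measure01 Z = measure lebesgue Z"
    using Z by (intro measure_restrict_space) (simp_all add: sets_interval01)
  ultimately have Zle: "measure interval_measure01 Z \<le> real (card labels) * \<eta>" by simp
  let ?B = "Z \<times> unit_interval \<union> unit_interval \<times> Z"
  have B: "?B \<in> sets square_measure01" "measure square_measure01 ?B \<le> 2 * (real (card labels) * \<eta>)"
    using measure_strips_le[OF Z Z] Zle by auto
  have lab: "label S T x = label S' T' (\<phi> x)" if "x \<in> unit_interval" "x \<notin> Z" for x
    using that by (cases "x = 1") (auto simp: Z_def)
  have Wb: "W \<in> bounded_tuples k" and Ub: "U \<in> bounded_tuples k"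
    by (simp_all add: graphon_systems_bounded W U)
  let ?b = "2 * e + 2 * real m * e * (real (card labels) * \<eta>)"
  have "cut_distance k W U \<le> cut_norm k (\<lambda>I z. W I z - relabel U \<phi> I z)"
    by (rule cut_distance_le[OF Wb Ub \<phi>])
  also have "\<dots> \<le> 2 ^ k * ?b"
  proof (rule cut_norm_least)
    fix A B assume AB: "A \<in> sets interval_measure01" "B \<in> sets interval_measure01"
    have "\<bar>rect_integral (\<lambda>z. W I z - relabel U \<phi> I z) A B\<bar> \<le> ?b" if I: "I \<in> Pow {1..k}" for I
    proof -
      define F where "F = step_kernel e m (s I) (S I) (T I)"
      define F' where "F' = step_kernel e m (s' I) (S' I) (T' I)"
      define G where "G = (\<lambda>(x, y). F' (\<phi> x, \<phi> y))"
      define H where "H = (\<lambda>z. U I z - F' z)"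
      have F: "F \<in> bounded_kernels" "F' \<in> bounded_kernels"
        unfolding F_def F'_def using approximant_bounded[OF aW I] approximant_bounded[OF aU I] .
      have WI: "W I \<in> bounded_kernels" and UI: "U I \<in> bounded_kernels"
        using Wb Ub I by (simp_all add: bounded_tuples_def)
      have H: "H \<in> bounded_kernels" unfolding H_def by (rule bounded_kernels_diff[OF UI F(2)])
      have G: "G \<in> bounded_kernels" unfolding G_def by (rule bounded_kernels_imp[OF \<phi> F(2)])
      have RU: "relabel U \<phi> I \<in> bounded_kernels"
        using bounded_tuples_relabel[OF \<phi> Ub] I by (simp add: bounded_tuples_def)
      have Hphi: "(\<lambda>(x, y). H (\<phi> x, \<phi> y)) = (\<lambda>z. relabel U \<phi> I z - G z)"
        by (auto simp: H_def G_def relabel_def)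
      have 1: "\<bar>rect_integral (\<lambda>z. W I z - F z) A B\<bar> \<le> e"
        using aW I AB unfolding approximant_def F_def by blast
      \<comment> \<open>The approximation of \<open>U\<close> holds on all measurable rectangles, in
        particular on the images under \<open>\<phi>\<close>; changing variables gives the bound for
        the relabelled kernel.\<close>
      have "\<bar>rect_integral H (\<phi> ` A) (\<phi> ` B)\<bar> \<le> e"
        using aU I imp_image_sets[OF \<phi> AB(1)] imp_image_sets[OF \<phi> AB(2)]
        unfolding approximant_def F'_def H_def by blast
      then have 2: "\<bar>rect_integral (\<lambda>z. relabel U \<phi> I z - G z) A B\<bar> \<le> e"
        using rect_integral_imp[OF \<phi> H AB] by (simp add: Hphi)
      have 3: "\<bar>rect_integral (\<lambda>z. F z - G z) A B\<bar> \<le> real m * e * measure square_measure01 ?B"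
      proof (rule abs_rect_integral_le[OF AB bounded_kernels_diff[OF F(1) G] _ B(1)])
        fix z assume "z \<in> unit_square"
        then obtain x y where z: "z = (x, y)" "x \<in> unit_interval" "y \<in> unit_interval" by blast
        show "\<bar>F z - G z\<bar> \<le> real m * e * indicator ?B z"
        proof (cases "z \<in> ?B")
          case True
          have "\<bar>F z - G z\<bar> \<le> real m * e"
            unfolding F_def G_def F'_def z(1) prod.case
          proof (rule step_kernel_diff_le[OF e])
            show "s I i = s' I i" if "i < m" for i by (rule s[OF I that])
            show "s I i \<in> {-1, 0, 1}" if "i < m" for i
              using aW I that unfolding approximant_def by blast
          qed
          then show ?thesis using True by simp
        next
          case False
          then have "x \<notin> Z" "y \<notin> Z" using z by auto
          then have "F z = G z"
            unfolding F_def G_def F'_def z(1) prod.case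
            using lab z s I by (intro step_kernel_label) auto
          then show ?thesis using False by simp
        qed
      qed
      have "real m * e * measure square_measure01 ?B \<le> real m * e * (2 * (real (card labels) * \<eta>))"
        using B(2) e by (intro mult_left_mono) auto
      with 3 have 3: "\<bar>rect_integral (\<lambda>z. F z - G z) A B\<bar> \<le> 2 * real m * e * (real (card labels) * \<eta>)"
        by (simp add: mult_ac)
      have "rect_integral (\<lambda>z. W I z - relabel U \<phi> I z) A B
          = rect_integral (\<lambda>z. W I z - F z) A B + rect_integral (\<lambda>z. F z - G z) A B
            - rect_integral (\<lambda>z. relabel U \<phi> I z - G z) A B"
        by (simp add: rect_integral_diff[OF AB] WI RU F G)
      then show ?thesis using 1 2 3 by linarith
    qed
    then have "(\<Sum>I\<in>Pow {1..k}. \<bar>rect_integral (\<lambda>z. W I z - relabel U \<phi> I z) A B\<bar>)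
        \<le> real (card (Pow {1..k})) * ?b"
      by (rule sum_bounded_above)
    then show "(\<Sum>I\<in>Pow {1..k}. \<bar>rect_integral (\<lambda>z. W I z - relabel U \<phi> I z) A B\<bar>) \<le> 2 ^ k * ?b"
      by (simp add: card_Pow)
  qed
  finally show ?thesis .
qed

end

text \<open>Total boundedness is stated as a finite colouring in which equal colours force distance
  below \<open>\<epsilon>\<close>. The colour consists of the signs and the rounded atom measures;
  no finite net has to be exhibited.\<close>

lemma graphon_systems_totally_bounded:
  assumes \<epsilon>: "\<epsilon> > 0"
  shows "\<exists>c :: kernel_tuple \<Rightarrow> (nat set \<Rightarrow> nat \<Rightarrow> int) \<times> ((nat set \<times> nat \<times> bool) set \<Rightarrow> int).
    finite (c ` graphon_systems k) \<and>
    (\<forall>W\<in>graphon_systems k. \<forall>U\<in>graphon_systems k. c W = c U \<longrightarrow> cut_distance k W U < \<epsilon>)"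
proof -
  \<comment> \<open>The final estimate stays below \<open>2 ^ k * (2 * e + 2 * e)\<close>, which
    this choice makes equal to \<open>\<epsilon>\<close>.\<close>
  define e where "e = \<epsilon> / (4 * 2 ^ k)"
  have e: "e > 0" using \<epsilon> by (simp add: e_def)
  obtain m where "1 / e\<^sup>2 < real m" using reals_Archimedean2 by blast
  then have m: "1 < real m * e\<^sup>2" using e by (simp add: field_simps)
  define L where "L = labels k m"
  have fL: "finite L" by (simp add: L_def finite_labels)
  define q where "q = real m * e * real (card L)"
  have q: "0 \<le> q" using e by (simp add: q_def)
  \<comment> \<open>Dividing by \<open>q + 1\<close> allows \<open>q\<close> to be 0 and makes
    \<open>q * \<eta>\<close> strictly less than \<open>e\<close>.\<close>
  define \<eta> where "\<eta> = e / (q + 1)"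
  have \<eta>: "\<eta> > 0" using e q by (simp add: \<eta>_def)
  have "\<forall>W. \<exists>n s S T. W \<in> graphon_systems k \<longrightarrow> approximant k m e W n s S T"
    using approximant_exists[OF _ e m] by blast
  then obtain n s S T where a: "\<And>W. W \<in> graphon_systems k \<Longrightarrow> approximant k m e W (n W) (s W) (S W) (T W)"
    by metis
  \<comment> \<open>Restriction fixes the values outside the relevant indices, so the codes lie in
    finite extensional function spaces.\<close>
  define c where "c W = (restrict (\<lambda>I. restrict (s W I) {..<m}) (Pow {1..k}),
      restrict (\<lambda>l. \<lfloor>frequency k m (S W) (T W) l / \<eta>\<rfloor>) L)" for W
  have "c ` graphon_systems k \<subseteq> (Pow {1..k} \<rightarrow>\<^sub>E {..<m} \<rightarrow>\<^sub>E {-1, 0, 1}) \<times> (L \<rightarrow>\<^sub>E {0..\<lfloor>1 / \<eta>\<rfloor>})"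
  proof (rule image_subsetI)
    fix W assume W: "W \<in> graphon_systems k"
    have "0 \<le> frequency k m (S W) (T W) l \<and> frequency k m (S W) (T W) l \<le> 1" for l
    proof -
      have "frequency k m (S W) (T W) l \<le> measure lebesgue {0..1::real}"
      \<comment> \<open>A set that is not measurable has measure 0 by convention, so the bound
        follows without proving the level set measurable.\<close>
      proof (cases "{x. 0 \<le> x \<and> x < 1 \<and> label k m (S W) (T W) x = l} \<in> sets lebesgue")
        case True
        then show ?thesis unfolding frequency_def by (intro measure_mono_fmeasurable) auto
      next
        case False
        then show ?thesis by (simp add: frequency_def measure_notin_sets)
      qed
      then show ?thesis by (simp add: frequency_def)
    qed
    then have "\<lfloor>frequency k m (S W) (T W) l / \<eta>\<rfloor> \<in> {0..\<lfloor>1 / \<eta>\<rfloor>}" for l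
      using \<eta> by (auto intro!: floor_mono divide_right_mono)
    moreover have "s W I i \<in> {-1, 0, 1}" if "I \<in> Pow {1..k}" "i < m" for I i
      using a[OF W] that unfolding approximant_def by blast
    ultimately show "c W \<in> (Pow {1..k} \<rightarrow>\<^sub>E {..<m} \<rightarrow>\<^sub>E {-1, 0, 1}) \<times> (L \<rightarrow>\<^sub>E {0..\<lfloor>1 / \<eta>\<rfloor>})"
      unfolding c_def by (intro SigmaI restrict_PiE_iff[THEN iffD2] ballI) auto
  qed
  moreover have "finite ((Pow {1..k} \<rightarrow>\<^sub>E {..<m} \<rightarrow>\<^sub>E {-1, 0, 1::int}) \<times> (L \<rightarrow>\<^sub>E {0..\<lfloor>1 / \<eta>\<rfloor>}))"
    using fL by (intro finite_cartesian_product finite_PiE) auto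
  ultimately have "finite (c ` graphon_systems k)" by (rule finite_subset)
  moreover have "cut_distance k W U < \<epsilon>"
    if W: "W \<in> graphon_systems k" and U: "U \<in> graphon_systems k" and eq: "c W = c U" for W U
  proof -
    have "cut_distance k W U \<le> 2 ^ k * (2 * e + 2 * real m * e * (real (card (labels k m)) * \<eta>))"
    proof (rule cut_distance_approximants[OF W U e a[OF W] a[OF U]])
      fix I i assume I: "I \<in> Pow {1..k}" "i < m"
      have "fst (c W) I i = fst (c U) I i" using eq by simp
      then show "s W I i = s U I i" using I by (simp add: c_def)
    next
      fix l assume l: "l \<in> labels k m"
      have "snd (c W) l = snd (c U) l" using eq by simp
      then have "\<lfloor>frequency k m (S W) (T W) l / \<eta>\<rfloor> = \<lfloor>frequency k m (S U) (T U) l / \<eta>\<rfloor>"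
        using l by (simp add: c_def L_def)
      then have "\<bar>frequency k m (S W) (T W) l / \<eta> - frequency k m (S U) (T U) l / \<eta>\<bar> \<le> 1" by linarith
      then show "\<bar>frequency k m (S W) (T W) l - frequency k m (S U) (T U) l\<bar> \<le> \<eta>"
        using \<eta> by (simp flip: diff_divide_distrib)
    qed
    also have "\<dots> = 2 ^ k * (2 * e + 2 * (q * \<eta>))" by (simp add: q_def L_def)
    also have "q * \<eta> < e" using q e by (simp add: \<eta>_def field_simps)
    then have "2 ^ k * (2 * e + 2 * (q * \<eta>)) < 2 ^ k * (2 * e + 2 * e)" by simp
    also have "\<dots> = \<epsilon>" by (simp add: e_def)
    finally show ?thesis .
  qed
  ultimately show ?thesis by blast
qed

section \<open>The quotient of a pseudometric space\<close>

text \<open>Separates the passage to classes from everything specific to graphons: all arguments on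
  systems can work with representatives.\<close>

locale pseudometric_quotient =
  fixes X :: "'a set" and d :: "'a \<Rightarrow> 'a \<Rightarrow> real"
  assumes d_nonneg: "\<And>x y. x \<in> X \<Longrightarrow> y \<in> X \<Longrightarrow> 0 \<le> d x y"
    and d_self: "\<And>x. x \<in> X \<Longrightarrow> d x x = 0"
    and d_commute: "\<And>x y. x \<in> X \<Longrightarrow> y \<in> X \<Longrightarrow> d x y = d y x"
    and d_triangle: "\<And>x y z. x \<in> X \<Longrightarrow> y \<in> X \<Longrightarrow> z \<in> X \<Longrightarrow> d x z \<le> d x y + d y z"
begin

definition zero_relation :: "('a \<times> 'a) set" where
  "zero_relation = {(x, y). x \<in> X \<and> y \<in> X \<and> d x y = 0}"

text \<open>Has the shape of \<open>class_cut_distance\<close>, including the default 0, so that the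
  two coincide upon instantiation.\<close>

definition class_dist :: "'a set \<Rightarrow> 'a set \<Rightarrow> real" where
  "class_dist A B = (if A \<in> X // zero_relation \<and> B \<in> X // zero_relation then the_elem ((\<lambda>(x, y). d x y) ` (A \<times> B)) else 0)"

lemma equiv_zero_relation: "equiv X zero_relation"
proof (rule equivI)
  show "zero_relation \<subseteq> X \<times> X" by (auto simp: zero_relation_def)
  show "refl_on X zero_relation" by (auto simp: refl_on_def zero_relation_def d_self)
  show "sym zero_relation" by (auto simp: sym_def zero_relation_def d_commute)
  show "trans zero_relation"
  proof (rule transI)
    fix x y z assume "(x, y) \<in> zero_relation" "(y, z) \<in> zero_relation"
    then have *: "x \<in> X" "y \<in> X" "z \<in> X" "d x y = 0" "d y z = 0" by (auto simp: zero_relation_def)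
    then have "d x z = 0" using d_triangle[of x y z] d_nonneg[of x z] by simp
    then show "(x, z) \<in> zero_relation" using * by (simp add: zero_relation_def)
  qed
qed

text \<open>Moving either argument within its class costs distance 0, so triangle inequalities in
  both directions show that the image under \<open>the_elem\<close> is a singleton.\<close>

lemma class_dist_class:
  assumes x: "x \<in> X" and y: "y \<in> X"
  shows "class_dist (zero_relation `` {x}) (zero_relation `` {y}) = d x y"
proof -
  have Q: "zero_relation `` {x} \<in> X // zero_relation" "zero_relation `` {y} \<in> X // zero_relation"
    using assms by (auto simp: quotient_def)
  have "d u v = d x y" if "u \<in> zero_relation `` {x}" "v \<in> zero_relation `` {y}" for u v
  proof -
    have uv: "u \<in> X" "v \<in> X" "d x u = 0" "d y v = 0" using that by (auto simp: zero_relation_def)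
    note d_triangle[OF x uv(1) y] d_triangle[OF uv(1,2) y] d_triangle[OF uv(1) x uv(2)] d_triangle[OF x y uv(2)]
    then show ?thesis using uv d_commute[OF x uv(1)] d_commute[OF y uv(2)] by linarith
  qed
  then have *: "(\<lambda>(x, y). d x y) p = (\<lambda>(x, y). d x y) (x, y)" if "p \<in> zero_relation `` {x} \<times> zero_relation `` {y}" for p
    using that by (cases p) simp
  have "(x, y) \<in> zero_relation `` {x} \<times> zero_relation `` {y}" using assms by (simp add: zero_relation_def d_self)
  then have "zero_relation `` {x} \<times> zero_relation `` {y} \<noteq> {}" by blast
  from the_elem_image_unique[OF this *] show ?thesis using Q unfolding class_dist_def by simp
qed

lemma class_repr:
  assumes "A \<in> X // zero_relation"
  obtains x where "x \<in> X" "A = zero_relation `` {x}"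
  using assms by (auto simp: quotient_def)

lemma class_dist_outside: "A \<notin> X // zero_relation \<or> B \<notin> X // zero_relation \<Longrightarrow> class_dist A B = 0"
  by (auto simp: class_dist_def)

text \<open>Nonnegativity and symmetry are demanded for all sets, so there the default value 0 off
  the quotient enters; the other two axioms concern classes only.\<close>

lemma metric_space: "Metric_space (X // zero_relation) class_dist"
proof
  show "0 \<le> class_dist A B" for A B
    by (metis class_dist_outside class_dist_class class_repr d_nonneg order_refl)
  show "class_dist A B = class_dist B A" for A B
    by (metis class_dist_outside class_dist_class class_repr d_commute)
  show "class_dist A B = 0 \<longleftrightarrow> A = B" if AB: "A \<in> X // zero_relation" "B \<in> X // zero_relation" for A B
  proof -
    obtain x where x: "x \<in> X" "A = zero_relation `` {x}" using class_repr[OF AB(1)] .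
    obtain y where y: "y \<in> X" "B = zero_relation `` {y}" using class_repr[OF AB(2)] .
    have "A = B \<longleftrightarrow> (x, y) \<in> zero_relation"
      using x y eq_equiv_class_iff[OF equiv_zero_relation] by simp
    then show ?thesis using x y class_dist_class by (simp add: zero_relation_def)
  qed
  show "class_dist A C \<le> class_dist A B + class_dist B C" if "A \<in> X // zero_relation" "B \<in> X // zero_relation" "C \<in> X // zero_relation" for A B C
    using that by (metis class_dist_class class_repr d_triangle)
qed

sublocale Q: Metric_space "X // zero_relation" class_dist
  by (rule metric_space)

text \<open>Completeness is assumed only for sequences with geometrically small steps. That is
  enough, since every Cauchy sequence has such a subsequence and converges as soon as a subsequence
  does.\<close>

lemma compact_space_quotient:
  assumes bounded: "\<And>e. e > 0 \<Longrightarrow> \<exists>c :: 'a \<Rightarrow> 'c. finite (c ` X) \<and> (\<forall>x\<in>X. \<forall>y\<in>X. c x = c y \<longrightarrow> d x y < e)"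
    and complete: "\<And>x :: nat \<Rightarrow> 'a. (\<And>n. x n \<in> X) \<Longrightarrow> (\<And>n. d (x n) (x (Suc n)) < (1 / 2) ^ n) \<Longrightarrow>
      \<exists>l\<in>X. (\<lambda>n. d (x n) l) \<longlonglongrightarrow> 0"
  shows "compact_space Q.mtopology"
  unfolding Q.compact_space_eq_mcomplete_mtotally_bounded
proof
  show "Q.mtotally_bounded (X // zero_relation)"
    unfolding Q.mtotally_bounded_def
  proof (intro allI impI)
    fix e :: real assume "e > 0"
    then obtain c :: "'a \<Rightarrow> 'c" where c: "finite (c ` X)" "\<And>x y. x \<in> X \<Longrightarrow> y \<in> X \<Longrightarrow> c x = c y \<Longrightarrow> d x y < e"
      using bounded by blast
    \<comment> \<open>One representative per colour gives the centres of a finite net.\<close>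
    define K where "K = (\<lambda>v. zero_relation `` {inv_into X c v}) ` (c ` X)"
    have "finite K" using c(1) by (simp add: K_def)
    moreover have "K \<subseteq> X // zero_relation"
      unfolding K_def by (auto simp: inv_into_into intro!: quotientI)
    moreover have "X // zero_relation \<subseteq> (\<Union>A\<in>K. Q.mball A e)"
    proof
      fix A assume A: "A \<in> X // zero_relation"
      then obtain x where x: "x \<in> X" "A = zero_relation `` {x}" using class_repr by blast
      let ?y = "inv_into X c (c x)"
      have y: "?y \<in> X" "c ?y = c x" using x by (auto intro: inv_into_into f_inv_into_f)
      then have "zero_relation `` {?y} \<in> K" using x by (auto simp: K_def)
      moreover have "A \<in> Q.mball (zero_relation `` {?y}) e"
        using A x y c(2)[OF y(1) x(1) y(2)] by (simp add: class_dist_class quotientI)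
      ultimately show "A \<in> (\<Union>A\<in>K. Q.mball A e)" by blast
    qed
    ultimately show "\<exists>K. finite K \<and> K \<subseteq> X // zero_relation \<and> X // zero_relation \<subseteq> (\<Union>A\<in>K. Q.mball A e)" by blast
  qed
  show "Q.mcomplete"
    unfolding Q.mcomplete_def
  proof (intro allI impI)
    fix \<sigma> assume \<sigma>: "Q.MCauchy \<sigma>"
    then have "\<exists>N. \<forall>n n'. N \<le> n \<longrightarrow> N \<le> n' \<longrightarrow> class_dist (\<sigma> n) (\<sigma> n') < (1 / 2) ^ i" for i :: nat
      by (simp add: Q.MCauchy_def)
    then obtain N where N: "\<And>i n n'. N i \<le> n \<Longrightarrow> N i \<le> n' \<Longrightarrow> class_dist (\<sigma> n) (\<sigma> n') < (1 / 2) ^ i"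
      by metis
    \<comment> \<open>Indices that increase strictly and pass the i-th Cauchy threshold, so that
      consecutive terms are within \<open>(1 / 2) ^ i\<close>.\<close>
    define r where "r = rec_nat (N 0) (\<lambda>i m. max (Suc m) (N (Suc i)))"
    have r_Suc: "r (Suc i) = max (Suc (r i)) (N (Suc i))" for i by (simp add: r_def)
    have r: "strict_mono r" by (simp add: strict_mono_Suc_iff r_Suc less_max_iff_disj)
    have N_r: "N i \<le> r i" for i by (cases i) (simp_all add: r_Suc, simp add: r_def)
    have "\<exists>x\<in>X. \<sigma> n = zero_relation `` {x}" for n
      using \<sigma> class_repr[of "\<sigma> n"] by (metis Q.MCauchy_def range_subsetD)
    then obtain x where x: "\<And>n. x n \<in> X" "\<And>n. \<sigma> n = zero_relation `` {x n}" by metis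
    have "d (x (r n)) (x (r (Suc n))) < (1 / 2) ^ n" for n
    proof -
      have "r n \<le> r (Suc n)" by (simp add: r_Suc)
      then have "class_dist (\<sigma> (r n)) (\<sigma> (r (Suc n))) < (1 / 2) ^ n" using N_r[of n] by (intro N) auto
      then show ?thesis using x by (simp add: class_dist_class)
    qed
    with complete[of "\<lambda>n. x (r n)"] x obtain l where l: "l \<in> X" "(\<lambda>n. d (x (r n)) l) \<longlonglongrightarrow> 0" by blast
    have "limitin Q.mtopology (\<sigma> \<circ> r) (zero_relation `` {l}) sequentially"
      unfolding Q.limitin_metric
    proof (intro conjI allI impI)
      show "zero_relation `` {l} \<in> X // zero_relation" using l by (simp add: quotientI)
      fix e :: real assume "e > 0"
      then have "\<forall>\<^sub>F n in sequentially. d (x (r n)) l < e" using order_tendstoD(2)[OF l(2)] by blast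
      then show "\<forall>\<^sub>F n in sequentially. (\<sigma> \<circ> r) n \<in> X // zero_relation \<and> class_dist ((\<sigma> \<circ> r) n) (zero_relation `` {l}) < e"
        by (rule eventually_mono) (use x l in \<open>simp add: class_dist_class quotientI\<close>)
    qed
    then show "\<exists>A. limitin Q.mtopology \<sigma> A sequentially"
      using Q.MCauchy_convergent_subsequence[OF \<sigma> r] by blast
  qed
qed

end

theorem theorem2p11:
  fixes k :: nat
  assumes "k \<ge> 1"
  shows "Metric_space (graphon_system_space k) (class_cut_distance k)
    \<and> compact_space (Metric_space.mtopology (graphon_system_space k) (class_cut_distance k))"
proof -
  interpret PQ: pseudometric_quotient "graphon_systems k" "cut_distance k"
    by standard (simp_all add: cut_distance_nonneg cut_distance_self cut_distance_commute
      cut_distance_triangle graphon_systems_bounded)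
  have E: "PQ.zero_relation = cut_equiv k"
    by (simp add: PQ.zero_relation_def cut_equiv_def)
  have Q: "graphon_systems k // PQ.zero_relation = graphon_system_space k"
    by (simp add: E graphon_system_space_def)
  have D: "PQ.class_dist = class_cut_distance k"
    by (simp add: fun_eq_iff PQ.class_dist_def class_cut_distance_def Q)
  have "compact_space PQ.Q.mtopology"
    using graphon_systems_totally_bounded cut_distance_complete by (rule PQ.compact_space_quotient)
  then show ?thesis
    using PQ.metric_space unfolding Q D by blast
qed

end
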